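(* Let $n\ge1$, let $m$ be a non-negative integer, let $\alpha>0$, let $0<p\leq q<\infty$, and let $u:\mathbb{C}^n\to\mathbb{C}$ and $\psi:\mathbb{C}^n\to\mathbb{C}^n$ be entire. Then $uC_\psi:\mathcal{F}^p_{(m,\alpha)}\to\mathcal{F}^q_{(m,\alpha)}$ is (i) bounded if and only if $B_{(m,\psi)}(|u|^q)\in L^\infty$. Moreover, $$\|uC_\psi\|\simeq\|B_{(m,\psi)}(|u|^q)\|_{L^\infty}^{1/q}.$$ (ii) compact if and only if $\lim_{|z|\to\infty}B_{(m,\psi)}(|u|^q)(z)=0$.
   Context: $dV$ is Lebesgue measure on $\mathbb{C}^n$, $\langle z,w\rangle=\sum_j z_j\overline{w_j}$, $|z|=\sqrt{\langle z,z\rangle}$, $L^\infty=L^\infty(\mathbb{C}^n,dV)$. For $0<p<\infty$ put $\|f\|_p^p=(\frac{\alpha p}{2\pi})^n\int_{\mathbb{C}^n}|f(z)|^pe^{-\frac{\alpha p}{2}|z|^2}dV(z)$. The Fock--Sobolev space $\mathcal{F}^p_{(m,\alpha)}$ of order $m$ consists of the entire functions $f$ on $\mathbb{C}^n$ with $\sum_{\beta_1+\dots+\beta_n\le m}\|\partial^\beta f\|_p<\infty$. It is equipped throughout with the equivalent (quasi-)norm $\|f\|_{(p,m)}=\big(C_{(p,m,n)}\int_{\mathbb{C}^n}|z|^{mp}|f(z)|^pe^{-\frac{\alpha p}{2}|z|^2}dV(z)\big)^{1/p}$, where $C_{(p,m,n)}=(\frac{\alpha p}{2})^{\frac{mp}{2}+n}\frac{\Gamma(n)}{\pi^n\Gamma(\frac{mp}{2}+n)}$.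 The weighted composition operator is $uC_\psi f=u\cdot(f\circ\psi)$. With $k_w(z)=e^{\alpha\langle z,w\rangle-\frac{\alpha}{2}|w|^2}$, for $0<q<\infty$, $$B_{(m,\psi)}(|u|^q)(w)=\int_{\mathbb{C}^n}\frac{|k_w(\psi(z))|^q}{(1+|\psi(z)|)^{mq}}|u(z)|^q|z|^{qm}e^{-\frac{\alpha q}{2}|z|^2}dV(z).$$ $U\simeq V$ means $U\le CV$ and $V\le CU$ with a constant $C$ independent of $u,\psi$. *)

theory Defs
  imports "HOL-Analysis.Analysis" "HOL-Probability.Essential_Supremum"
begin

text \<open>
  Throughout, $\mathbb{C}^n$ is \<^typ>\<open>complex ^ 'n\<close> with $n$ = \<^term>\<open>CARD('n)\<close>; its library norm is the
  Euclidean norm and \<^term>\<open>lborel\<close> is Lebesgue measure on the underlying real space of dimension $2n$.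
  Integrals of nonnegative functions, and hence norms, take values in \<^typ>\<open>ennreal\<close>.
\<close>

text \<open>Entire means complex (Frechet) differentiable at every point of $\mathbb{C}^n$: the library's
  \<open>has_derivative\<close> is real, so complex linearity of the derivative is required separately.\<close>

definition entire :: "(complex ^ 'n \<Rightarrow> complex) \<Rightarrow> bool" where
  "entire f \<longleftrightarrow>
     (\<forall>z. \<exists>D. (f has_derivative D) (at z) \<and> (\<forall>c v. D (c *s v) = c * D v))"

definition entire_map :: "(complex ^ 'n \<Rightarrow> complex ^ 'n) \<Rightarrow> bool" where
  "entire_map \<psi> \<longleftrightarrow> (\<forall>i. entire (\<lambda>z. \<psi> z $ i))"

definition cpartial :: "'n \<Rightarrow> (complex ^ 'n \<Rightarrow> complex) \<Rightarrow> complex ^ 'n \<Rightarrow> complex" where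
  "cpartial i f z = deriv (\<lambda>t. f (z + axis i t)) 0"

text \<open>Each coordinate \<open>i\<close> is differentiated \<open>\<beta> i\<close> times. The index type carries no order, so some
  order of differentiation is chosen; for entire functions it does not matter.\<close>

definition mixed_partial ::
    "('n \<Rightarrow> nat) \<Rightarrow> (complex ^ 'n \<Rightarrow> complex) \<Rightarrow> complex ^ 'n \<Rightarrow> complex" where
  "mixed_partial \<beta> f = fold cpartial (SOME is. \<forall>i. count_list is i = \<beta> i) f"

lemma ex_count_list:
  fixes \<beta> :: "'n::finite \<Rightarrow> nat"
  shows "\<exists>is. \<forall>i. count_list is i = \<beta> i"
proof -
  obtain M where M: "\<forall>i. count M i = \<beta> i"
    using count_Abs_multiset[of \<beta>] by (metis finite)
  obtain "is" where "mset is = M" using ex_mset by blast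
  then show ?thesis using M by (metis count_mset)
qed

lemma finite_multi_indices: "finite {\<beta> :: 'n::finite \<Rightarrow> nat. (\<Sum>i\<in>UNIV. \<beta> i) \<le> m}"
proof (rule finite_subset)
  show "{\<beta> :: 'n \<Rightarrow> nat. (\<Sum>i\<in>UNIV. \<beta> i) \<le> m} \<subseteq> PiE UNIV (\<lambda>_. {..m})"
  proof
    fix \<beta> :: "'n \<Rightarrow> nat"
    assume "\<beta> \<in> {\<beta>. (\<Sum>i\<in>UNIV. \<beta> i) \<le> m}"
    then have "\<beta> i \<le> m" for i
      using member_le_sum[of i UNIV \<beta>] by (simp add: order_trans)
    then show "\<beta> \<in> PiE UNIV (\<lambda>_. {..m})" by auto
  qed
qed (auto intro: finite_PiE)

text \<open>Real powers with positive exponent, extended by \<open>\<infinity> \<mapsto> \<infinity>\<close>.\<close>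

definition enn_powr :: "ennreal \<Rightarrow> real \<Rightarrow> ennreal" where
  "enn_powr x r = (if x = \<infinity> then \<infinity> else ennreal (enn2real x powr r))"

definition fock_norm :: "real \<Rightarrow> real \<Rightarrow> (complex ^ 'n \<Rightarrow> complex) \<Rightarrow> ennreal" where
  "fock_norm \<alpha> p f =
     enn_powr (ennreal ((\<alpha> * p / (2 * pi)) ^ CARD('n)) *
       (\<integral>\<^sup>+ z. ennreal (norm (f z) powr p * exp (- (\<alpha> * p / 2) * (norm z)\<^sup>2)) \<partial>lborel)) (1 / p)"

definition fock_sobolev :: "real \<Rightarrow> real \<Rightarrow> nat \<Rightarrow> (complex ^ 'n \<Rightarrow> complex) set" where
  "fock_sobolev \<alpha> p m =
     {f. entire f \<and>
         (\<Sum>\<beta>\<in>{\<beta>. (\<Sum>i\<in>UNIV. \<beta> i) \<le> m}. fock_norm \<alpha> p (mixed_partial \<beta> f)) < \<infinity>}"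

definition fs_const :: "real \<Rightarrow> real \<Rightarrow> nat \<Rightarrow> nat \<Rightarrow> real" where
  "fs_const \<alpha> p m n =
     (\<alpha> * p / 2) powr (real m * p / 2 + real n) *
     (Gamma (real n) / (pi ^ n * Gamma (real m * p / 2 + real n)))"

text \<open>The weight $|z|^{mp}$ is written \<open>(norm z ^ m) powr p\<close>, since \<open>0 powr 0 = 0\<close> would give the
  wrong value at \<open>z = 0\<close> for \<open>m = 0\<close>.\<close>

definition fs_norm :: "real \<Rightarrow> real \<Rightarrow> nat \<Rightarrow> (complex ^ 'n \<Rightarrow> complex) \<Rightarrow> ennreal" where
  "fs_norm \<alpha> p m f =
     enn_powr (ennreal (fs_const \<alpha> p m CARD('n)) *
       (\<integral>\<^sup>+ z. ennreal ((norm z ^ m) powr p * norm (f z) powr p *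
                     exp (- (\<alpha> * p / 2) * (norm z)\<^sup>2)) \<partial>lborel)) (1 / p)"

definition wcomp ::
    "(complex ^ 'n \<Rightarrow> complex) \<Rightarrow> (complex ^ 'n \<Rightarrow> complex ^ 'n) \<Rightarrow>
     (complex ^ 'n \<Rightarrow> complex) \<Rightarrow> complex ^ 'n \<Rightarrow> complex" where
  "wcomp u \<psi> f = (\<lambda>z. u z * f (\<psi> z))"

definition maps_fs ::
    "real \<Rightarrow> real \<Rightarrow> real \<Rightarrow> nat \<Rightarrow>
     ((complex ^ 'n \<Rightarrow> complex) \<Rightarrow> (complex ^ 'n \<Rightarrow> complex)) \<Rightarrow> bool" where
  "maps_fs \<alpha> p q m T \<longleftrightarrow> (\<forall>f \<in> fock_sobolev \<alpha> p m. T f \<in> fock_sobolev \<alpha> q m)"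

definition bounded_fs ::
    "real \<Rightarrow> real \<Rightarrow> real \<Rightarrow> nat \<Rightarrow>
     ((complex ^ 'n \<Rightarrow> complex) \<Rightarrow> (complex ^ 'n \<Rightarrow> complex)) \<Rightarrow> bool" where
  "bounded_fs \<alpha> p q m T \<longleftrightarrow>
     maps_fs \<alpha> p q m T \<and>
     (\<exists>C::real. \<forall>f \<in> fock_sobolev \<alpha> p m. fs_norm \<alpha> q m (T f) \<le> ennreal C * fs_norm \<alpha> p m f)"

definition opnorm_fs ::
    "real \<Rightarrow> real \<Rightarrow> real \<Rightarrow> nat \<Rightarrow>
     ((complex ^ 'n \<Rightarrow> complex) \<Rightarrow> (complex ^ 'n \<Rightarrow> complex)) \<Rightarrow> ennreal" where
  "opnorm_fs \<alpha> p q m T =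
     (SUP f \<in> {f \<in> fock_sobolev \<alpha> p m. fs_norm \<alpha> p m f \<le> 1}. fs_norm \<alpha> q m (T f))"

text \<open>Bounded sets are mapped to relatively compact sets, in sequential form (the quasi-norm
  topology is metrizable).\<close>

definition compact_fs ::
    "real \<Rightarrow> real \<Rightarrow> real \<Rightarrow> nat \<Rightarrow>
     ((complex ^ 'n \<Rightarrow> complex) \<Rightarrow> (complex ^ 'n \<Rightarrow> complex)) \<Rightarrow> bool" where
  "compact_fs \<alpha> p q m T \<longleftrightarrow>
     maps_fs \<alpha> p q m T \<and>
     (\<forall>F :: nat \<Rightarrow> complex ^ 'n \<Rightarrow> complex.
        (\<forall>k. F k \<in> fock_sobolev \<alpha> p m) \<and> (\<exists>M::real. \<forall>k. fs_norm \<alpha> p m (F k) \<le> ennreal M) \<longrightarrow>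
        (\<exists>r g. strict_mono r \<and> g \<in> fock_sobolev \<alpha> q m \<and>
           (\<lambda>k. fs_norm \<alpha> q m (\<lambda>z. T (F (r k)) z - g z)) \<longlonglongrightarrow> 0))"

definition cdot :: "complex ^ 'n \<Rightarrow> complex ^ 'n \<Rightarrow> complex" where
  "cdot z w = (\<Sum>j\<in>UNIV. z $ j * cnj (w $ j))"

definition fock_kernel :: "real \<Rightarrow> complex ^ 'n \<Rightarrow> complex ^ 'n \<Rightarrow> complex" where
  "fock_kernel \<alpha> w z = exp (of_real \<alpha> * cdot z w - of_real (\<alpha> / 2 * (norm w)\<^sup>2))"

text \<open>The transform $B_{(m,\psi)}(|u|^q)$.\<close>

definition berezin ::
    "real \<Rightarrow> real \<Rightarrow> nat \<Rightarrow> (complex ^ 'n \<Rightarrow> complex) \<Rightarrow> (complex ^ 'n \<Rightarrow> complex ^ 'n) \<Rightarrow>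
     complex ^ 'n \<Rightarrow> ennreal" where
  "berezin \<alpha> q m u \<psi> w =
     (\<integral>\<^sup>+ z. ennreal (norm (fock_kernel \<alpha> w (\<psi> z)) powr q / (1 + norm (\<psi> z)) powr (real m * q) *
                   norm (u z) powr q * (norm z ^ m) powr q *
                   exp (- (\<alpha> * q / 2) * (norm z)\<^sup>2)) \<partial>lborel)"

text \<open>\<open>esssup\<close> is \<open>\<infinity>\<close> on non-measurable functions, but measurability is required explicitly.\<close>

definition in_Linf :: "(complex ^ 'n \<Rightarrow> ennreal) \<Rightarrow> bool" where
  "in_Linf g \<longleftrightarrow> g \<in> borel_measurable lborel \<and> esssup lborel g < \<infinity>"

end

theory Submission
  imports Defs "HOL-Complex_Analysis.Complex_Analysis" "HOL-Probability.Distributions"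
begin

text \<open>The proof rests on one elementary device, \<open>modulate\<close>. If \<open>f\<close> is entire, then so is
\<open>w \<mapsto> f w * exp (- \<alpha> * cdot w z)\<close>, and since
\<open>2 * Re (cdot w z) = norm w ^ 2 + norm z ^ 2 - norm (w - z) ^ 2\<close>, its modulus is
\<open>norm (f w) * exp (- \<alpha> / 2 * norm w ^ 2)\<close> up to a factor depending on \<open>z\<close> and a factor that is
bounded above and below near \<open>z\<close>. An unweighted estimate on a unit ball therefore becomes the
same estimate for the weighted modulus \<open>wmod\<close>, with constants independent of \<open>z\<close>. The unweighted
estimate is the sub-mean value inequality for \<open>norm (f w) powr s\<close> with any \<open>s > 0\<close>
(\<open>entire_submean_powr\<close>), which comes from Cauchy's formula on complex lines and the rotation
invariance of Lebesgue measure.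

Applied to the derivative at the centre, the same device bounds \<open>\<partial>\<^sub>i f - \<alpha> * cnj z\<^sub>i * f\<close> by \<open>f\<close>
alone. Hence differentiating once and multiplying by one power of \<open>1 + norm z\<close> are the same as far
as weighted integrability is concerned, and membership in the Fock--Sobolev space of order \<open>m\<close>,
which is defined by derivatives, is finiteness of the integral \<open>energy\<close> with the weight
\<open>(1 + norm z) ^ m\<close> (\<open>fock_sobolev_iff\<close>). The sub-mean value inequality also gives the embedding for
\<open>p \<le> q\<close> and the equivalence of the weights \<open>norm z ^ m\<close> and \<open>(1 + norm z) ^ m\<close>.

For the upper bound the weighted sub-mean value inequality is read as a reproducing inequality: it
bounds \<open>norm (f \<zeta>) powr q\<close> by an average of the kernels
\<open>norm (fock_kernel \<alpha> w \<zeta>) powr q / (1 + norm \<zeta>) powr (m * q)\<close> over \<open>w\<close>. Substituting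
\<open>\<zeta> = \<psi> z\<close> and applying Fubini's theorem bounds the norm of \<open>wcomp u \<psi> f\<close> by the integral of
\<open>wmod \<alpha> m f w powr q * berezin \<alpha> q m u \<psi> w\<close> (\<open>fs_integral_wcomp_le_berezin\<close>).

For the lower bound the natural test functions are the normalized kernels \<open>test_fun\<close>, that is,
\<open>fock_kernel \<alpha> v\<close> divided by \<open>(1 + norm v) ^ m\<close>. The transform contains
\<open>(1 + norm (\<psi> z)) ^ m\<close> instead, which is not the modulus of an entire function of \<open>\<psi> z\<close>; but a
Gaussian is a convolution of two narrower Gaussians, and the polynomial factors cost only a
part of the Gaussian decay, so that the transform at \<open>w\<close> is dominated by a Gaussian average
around \<open>w\<close> of the norms of the images of the test functions (\<open>berezin_le_test_fun\<close>).

Compactness follows from the same two inequalities. If the transform tends to zero, Montel's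
theorem extracts a locally uniformly convergent subsequence; in the integral of the upper bound the
difference to the limit is small on a ball and the transform is small outside. Conversely the test
functions are bounded and tend to zero pointwise, so compactness makes the norms of their images
tend to zero, and so do the Gaussian averages of these norms.\<close>

(* Frees the symbol $ for vector components. *)
unbundle no fps_syntax

section \<open>Powers of extended nonnegative reals\<close>

lemma enn_powr_ennreal: "0 \<le> x \<Longrightarrow> enn_powr (ennreal x) r = ennreal (x powr r)"
  by (simp add: enn_powr_def)

lemma enn_powr_top [simp]: "enn_powr top r = top"
  by (simp add: enn_powr_def)

lemma enn_powr_finite_iff: "enn_powr x r < \<infinity> \<longleftrightarrow> x < \<infinity>"
  by (simp add: enn_powr_def top.not_eq_extremum)

lemma enn_powr_mono:
  assumes "x \<le> y" "0 \<le> r" shows "enn_powr x r \<le> enn_powr y r"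
proof (cases "y = \<infinity>")
  case False
  then have "x \<noteq> \<infinity>" using assms top.extremum_unique by auto
  moreover have "enn2real x \<le> enn2real y"
    using assms False by (simp add: enn2real_mono top.not_eq_extremum)
  ultimately show ?thesis
    using assms False by (auto simp: enn_powr_def intro!: ennreal_leI powr_mono2)
qed (simp add: enn_powr_def)

lemma enn_powr_mult:
  assumes "0 < c" shows "enn_powr (ennreal c * x) r = ennreal (c powr r) * enn_powr x r"
proof (cases x)
  case (real a)
  then have "ennreal c * x = ennreal (c * a)" using assms by (simp add: ennreal_mult)
  then show ?thesis using real assms
    by (simp add: enn_powr_ennreal powr_mult flip: ennreal_mult)
next
  case top
  have "ennreal c * x = \<infinity>" using top assms by (simp add: ennreal_mult_top)
  then show ?thesis using top assms by (simp add: ennreal_mult_top)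
qed

lemma enn_powr_times:
  assumes "0 < r" shows "enn_powr (x * y) r = enn_powr x r * enn_powr y r"
proof -
  have z: "enn_powr 0 r = 0" using assms by (simp add: enn_powr_def)
  have p: "enn_powr y r \<noteq> 0" if "y \<noteq> 0" for y
    using that by (cases y) (auto simp: enn_powr_ennreal ennreal_eq_0_iff not_le)
  consider "x = 0 \<or> y = 0" | "x \<noteq> 0" "y \<noteq> 0" "x = top \<or> y = top" | "x \<noteq> top" "y \<noteq> top" by blast
  then show ?thesis
  proof cases
    case 2
    then have "x * y = top" by (auto simp: ennreal_mult_eq_top_iff)
    moreover have "enn_powr x r * enn_powr y r = top"
      using 2 p[of x] p[of y] by (auto simp: ennreal_mult_eq_top_iff)
    ultimately show ?thesis by simp
  next
    case 3
    then obtain a b where "0 \<le> a" "x = ennreal a" "0 \<le> b" "y = ennreal b"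
      by (metis ennreal_enn2real_if enn2real_nonneg)
    then show ?thesis by (simp add: enn_powr_ennreal powr_mult flip: ennreal_mult)
  qed (auto simp: z)
qed

lemma enn_powr_powr:
  assumes "0 < r" "0 < s" shows "enn_powr (enn_powr x r) s = enn_powr x (r * s)"
  by (cases x) (auto simp: enn_powr_ennreal powr_powr)

lemma enn_powr_one [simp]: "enn_powr x 1 = x"
  by (cases x) (auto simp: enn_powr_ennreal)

lemma enn_powr_inverse [simp]:
  assumes "0 < r"
  shows "enn_powr (enn_powr x (1/r)) r = x" "enn_powr (enn_powr x r) (1/r) = x"
  using assms by (simp_all add: enn_powr_powr)

lemma tendsto_enn_powr_0:
  assumes "(f \<longlongrightarrow> 0) F" "0 < r" shows "((\<lambda>x. enn_powr (f x) r) \<longlongrightarrow> 0) F"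
proof -
  have "((\<lambda>x. enn2real (f x)) \<longlongrightarrow> 0) F"
    using assms(1) tendsto_enn2real[of f 0 F] by simp
  then have "((\<lambda>x. enn2real (f x) powr r) \<longlongrightarrow> 0) F"
    using assms(2) by (auto intro!: tendsto_zero_powrI)
  then have "((\<lambda>x. ennreal (enn2real (f x) powr r)) \<longlongrightarrow> 0) F"
    using tendsto_ennrealI by fastforce
  moreover have "eventually (\<lambda>x. f x < 1) F"
    using assms(1) by (rule order_tendstoD) simp
  then have "eventually (\<lambda>x. ennreal (enn2real (f x) powr r) = enn_powr (f x) r) F"
    by eventually_elim (auto simp: enn_powr_def)
  ultimately show ?thesis
    by (rule Lim_transform_eventually)
qed

lemma tendsto_ennreal_0I:
  fixes f :: "'a \<Rightarrow> ennreal"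
  assumes "\<And>e::real. 0 < e \<Longrightarrow> eventually (\<lambda>x. f x \<le> ennreal e) F"
  shows "(f \<longlongrightarrow> 0) F"
proof (rule order_tendstoI)
  fix a :: ennreal assume "0 < a"
  then obtain b where b: "0 < b" "b < a" using dense by blast
  then obtain e where e: "b = ennreal e" "0 < e" by (cases b) (auto simp: top.not_eq_extremum)
  show "eventually (\<lambda>x. f x < a) F"
    using assms[OF e(2)] b by (auto elim!: eventually_mono simp: e(1))
qed simp

lemma powr_le_imp_le_root:
  fixes x y p :: real
  assumes "x powr p \<le> y" "0 \<le> x" "0 < p" shows "x \<le> y powr (1 / p)"
  using powr_mono2[of "1 / p" "x powr p" y] assms by (simp add: powr_powr)

lemma powr_add_le:
  fixes a b s :: real
  assumes "0 \<le> a" "0 \<le> b" "0 \<le> s"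
  shows "(a + b) powr s \<le> 2 powr s * (a powr s + b powr s)"
proof -
  have "(a + b) powr s \<le> (2 * max a b) powr s"
    using assms by (intro powr_mono2) auto
  also have "\<dots> = 2 powr s * max a b powr s" using assms by (simp add: powr_mult)
  also have "max a b powr s \<le> a powr s + b powr s" by (simp add: max_def)
  finally show ?thesis by simp
qed

section \<open>Lebesgue measure on complex space\<close>

lemma nn_integral_lborel_shift:
  fixes f :: "'a::euclidean_space \<Rightarrow> ennreal"
  assumes [measurable]: "f \<in> borel_measurable borel"
  shows "(\<integral>\<^sup>+x. f (a + x) \<partial>lborel) = (\<integral>\<^sup>+x. f x \<partial>lborel)"
  by (subst (2) lborel_distr_plus[of a, symmetric]) (simp add: nn_integral_distr)

lemma nn_integral_lborel_reflect:
  fixes f :: "'a::euclidean_space \<Rightarrow> ennreal"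
  assumes [measurable]: "f \<in> borel_measurable borel"
  shows "(\<integral>\<^sup>+x. f (a - x) \<partial>lborel) = (\<integral>\<^sup>+x. f x \<partial>lborel)"
proof -
  have "(lborel :: 'a measure) = distr lborel borel (\<lambda>x. a - x)"
    using lborel_affine[of "-1" a] by (simp add: density_1)
  then have "(\<integral>\<^sup>+x. f x \<partial>lborel) = (\<integral>\<^sup>+x. f x \<partial>distr lborel borel (\<lambda>x. a - x))"
    by simp
  then show ?thesis by (simp add: nn_integral_distr)
qed

text \<open>Uniqueness of translation invariant measures: if \<open>g\<close> is the indicator function of the unit ball,
both \<open>(\<integral>f (T x)) * (\<integral>g x)\<close> and \<open>(\<integral>g (T x)) * (\<integral>f x)\<close> equal the double integral of
\<open>f (T x) * g (T x + y)\<close>, and \<open>g \<circ> T = g\<close>.\<close>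

lemma nn_integral_lborel_linear_isometry:
  fixes f :: "'a::euclidean_space \<Rightarrow> ennreal" and T :: "'a \<Rightarrow> 'a"
  assumes [measurable]: "f \<in> borel_measurable borel"
    and T: "linear T" "\<And>x. norm (T x) = norm x"
  shows "(\<integral>\<^sup>+x. f (T x) \<partial>lborel) = (\<integral>\<^sup>+x. f x \<partial>lborel)"
proof -
  have [measurable]: "T \<in> borel_measurable borel"
    using T(1) by (intro borel_measurable_continuous_onI linear_continuous_on) 
      (simp add: linear_conv_bounded_linear)
  have "inj T"
    using T by (metis linear_injective_0 norm_eq_zero)
  then have "surj T" using T(1) by (simp add: linear_injective_imp_surjective)
  define g :: "'a \<Rightarrow> ennreal" where "g = indicator (ball 0 1)"
  have [measurable]: "g \<in> borel_measurable borel"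
    unfolding g_def by (intro borel_measurable_indicator) simp
  have gT: "g (T x) = g x" for x by (simp add: g_def indicator_def T)
  define v where "v = (\<integral>\<^sup>+x. g x \<partial>(lborel :: 'a measure))"
  have "v = emeasure lborel (ball (0::'a) 1)" by (simp add: v_def g_def)
  then have v: "v \<noteq> 0" "v \<noteq> \<infinity>"
    using emeasure_ball[of 1 "0::'a"] by (auto simp: unit_ball_vol_pos less_imp_neq[symmetric])
  have "(\<integral>\<^sup>+x. f (T x) \<partial>lborel) * v = (\<integral>\<^sup>+x. f (T x) * v \<partial>lborel)"
    by (simp add: nn_integral_multc)
  also have "\<dots> = (\<integral>\<^sup>+x. (\<integral>\<^sup>+y. f (T x) * g (T x + y) \<partial>lborel) \<partial>lborel)"
    by (simp add: nn_integral_cmult v_def nn_integral_lborel_shift)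
  also have "\<dots> = (\<integral>\<^sup>+y. (\<integral>\<^sup>+x. f (T x) * g (T x + y) \<partial>lborel) \<partial>lborel)"
    by (rule lborel_pair.Fubini') measurable
  also have "\<dots> = (\<integral>\<^sup>+y. (\<integral>\<^sup>+x. f (T x - y) * g (T x) \<partial>lborel) \<partial>lborel)"
  proof (rule nn_integral_cong)
    fix y :: 'a
    obtain c where c: "T c = - y" using \<open>surj T\<close> by (metis surjD)
    have "T (c + x) = T x - y" for x using T(1) c by (simp add: linear_add)
    then show "(\<integral>\<^sup>+x. f (T x) * g (T x + y) \<partial>lborel) = (\<integral>\<^sup>+x. f (T x - y) * g (T x) \<partial>lborel)"
      using nn_integral_lborel_shift[of "\<lambda>x. f (T x) * g (T x + y)" c] by simp
  qed
  also have "\<dots> = (\<integral>\<^sup>+x. (\<integral>\<^sup>+y. f (T x - y) * g (T x) \<partial>lborel) \<partial>lborel)"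
    by (rule lborel_pair.Fubini') measurable
  also have "\<dots> = (\<integral>\<^sup>+x. (\<integral>\<^sup>+y. f y \<partial>lborel) * g x \<partial>lborel)"
    by (simp add: nn_integral_multc nn_integral_lborel_reflect gT)
  also have "\<dots> = (\<integral>\<^sup>+y. f y \<partial>lborel) * v"
    by (simp add: nn_integral_cmult v_def)
  finally show ?thesis
    using v by (metis ennreal_mult_cancel_left mult.commute infinity_ennreal_def)
qed

lemma norm_cscale [simp]: "norm (t *s (w::complex^'n)) = norm t * norm w"
  unfolding norm_vec_def by (simp add: norm_mult L2_set_right_distrib)

lemma bounded_linear_cscale: "bounded_linear (\<lambda>w::complex^'n. t *s w)"
  by (rule bounded_linear_intro[where K="norm t"])
    (auto simp: vector_add_ldistrib vec_eq_iff algebra_simps)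

lemma bounded_linear_cscale_left: "bounded_linear (\<lambda>t::complex. t *s (w::complex^'n))"
  by (rule bounded_linear_intro[where K="norm w"])
    (auto simp: vector_sadd_rdistrib vec_eq_iff algebra_simps)

lemma continuous_on_cscale [continuous_intros]:
  fixes g :: "'a::topological_space \<Rightarrow> complex^'n"
  assumes "continuous_on S f" "continuous_on S g"
  shows "continuous_on S (\<lambda>x. f x *s g x)"
  unfolding vector_scalar_mult_def using assms by (intro continuous_intros)

lemma nn_integral_rotate:
  fixes f :: "complex^'n \<Rightarrow> ennreal"
  assumes "f \<in> borel_measurable borel" "norm t = 1"
  shows "(\<integral>\<^sup>+x. f (t *s x) \<partial>lborel) = (\<integral>\<^sup>+x. f x \<partial>lborel)"
  using assms by (intro nn_integral_lborel_linear_isometry)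
    (auto simp: linear_conv_bounded_linear bounded_linear_cscale)

lemma nn_integral_gaussian_finite:
  assumes "0 < c"
  shows "(\<integral>\<^sup>+x. ennreal (exp (- c * (norm x)\<^sup>2)) \<partial>(lborel :: 'a::euclidean_space measure)) < \<infinity>"
proof -
  define \<sigma> where "\<sigma> = sqrt (1 / (2 * c))"
  have \<sigma>: "0 < \<sigma>" "2 * \<sigma>\<^sup>2 = 1 / c" using assms by (auto simp: \<sigma>_def)
  have eq: "exp (- c * t\<^sup>2) = sqrt (2 * pi * \<sigma>\<^sup>2) * normal_density 0 \<sigma> t" for t
    using \<sigma> assms by (simp add: normal_density_def field_simps)
  have "(\<integral>\<^sup>+t. ennreal (exp (- c * t\<^sup>2)) \<partial>lborel)
      = ennreal (sqrt (2 * pi * \<sigma>\<^sup>2)) * (\<integral>\<^sup>+t. ennreal (normal_density 0 \<sigma> t) \<partial>lborel)"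
    unfolding eq by (subst nn_integral_cmult[symmetric]) (auto simp: ennreal_mult)
  also have "(\<integral>\<^sup>+t. ennreal (normal_density 0 \<sigma> t) \<partial>lborel) = 1"
    using prob_space.emeasure_space_1[OF prob_space_normal_density[OF \<sigma>(1), of 0]]
    by (simp add: emeasure_density)
  finally have fin: "(\<integral>\<^sup>+t. ennreal (exp (- c * t\<^sup>2)) \<partial>lborel) < \<infinity>" by simp
  have "exp (- c * (norm x)\<^sup>2) = (\<Prod>b\<in>Basis. exp (- c * (x \<bullet> b)\<^sup>2))" for x :: 'a
  proof -
    have "(norm x)\<^sup>2 = (\<Sum>b\<in>Basis. (x \<bullet> b)\<^sup>2)"
      by (subst power2_norm_eq_inner) (simp add: euclidean_inner[of x x] power2_eq_square)
    then show ?thesis by (simp add: sum_distrib_left exp_sum flip: sum_negf)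
  qed
  then have "(\<integral>\<^sup>+x. ennreal (exp (- c * (norm x)\<^sup>2)) \<partial>(lborel :: 'a measure))
     = (\<integral>\<^sup>+x. (\<Prod>b\<in>Basis. ennreal (exp (- c * (x \<bullet> b)\<^sup>2))) \<partial>(lborel :: 'a measure))"
    by (simp add: prod_ennreal)
  also have "\<dots> = (\<Prod>b\<in>(Basis::'a set). (\<integral>\<^sup>+t. ennreal (exp (- c * t\<^sup>2)) \<partial>lborel))"
    by (rule nn_integral_lborel_prod) auto
  also have "\<dots> < \<infinity>"
    using fin by (simp add: power_less_top_ennreal)
  finally show ?thesis .
qed

text \<open>By \<open>1 + t \<le> exp t\<close> and completing the square, an arbitrarily small part of a Gaussian
absorbs every polynomial factor.\<close>

lemma powr_le_exp_square:
  fixes t r c :: real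
  assumes "0 \<le> t" "0 \<le> r" "0 < c"
  shows "(1 + t) powr r \<le> exp (r\<^sup>2 / (4 * c)) * exp (c * t\<^sup>2)"
proof -
  have "(1 + t) powr r = exp (r * ln (1 + t))" using assms by (simp add: powr_def)
  also have "\<dots> \<le> exp (r * t)"
    using assms by (simp add: mult_left_mono ln_add_one_self_le_self)
  also have "r * t \<le> r\<^sup>2 / (4 * c) + c * t\<^sup>2"
  proof -
    have "0 \<le> (r - 2 * c * t)\<^sup>2 / (4 * c)" using assms by simp
    then show ?thesis using assms by (simp add: field_simps power2_eq_square)
  qed
  finally show ?thesis by (simp add: exp_add)
qed

lemma nn_integral_weighted_gaussian_finite:
  assumes "0 < c" "0 \<le> r"
  shows "(\<integral>\<^sup>+x. ennreal ((1 + norm x) powr r * exp (- c * (norm x)\<^sup>2)) \<partial>(lborel :: 'a::euclidean_space measure)) < \<infinity>"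
proof -
  define K where "K = exp (r\<^sup>2 / (2 * c))"
  have "(1 + norm x) powr r * exp (- c * (norm x)\<^sup>2) \<le> K * exp (- (c/2) * (norm x)\<^sup>2)" for x :: 'a
  proof -
    have "(1 + norm x) powr r * exp (- c * (norm x)\<^sup>2)
        \<le> (K * exp (c/2 * (norm x)\<^sup>2)) * exp (- c * (norm x)\<^sup>2)"
      using powr_le_exp_square[of "norm x" r "c/2"] assms by (simp add: K_def)
    also have "\<dots> = K * exp (- (c/2) * (norm x)\<^sup>2)"
      by (simp flip: exp_add)
    finally show ?thesis .
  qed
  then have "(\<integral>\<^sup>+x. ennreal ((1 + norm x) powr r * exp (- c * (norm x)\<^sup>2)) \<partial>(lborel :: 'a measure))
      \<le> (\<integral>\<^sup>+x. ennreal K * ennreal (exp (- (c/2) * (norm x)\<^sup>2)) \<partial>(lborel :: 'a measure))"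
    by (intro nn_integral_mono) (simp add: K_def flip: ennreal_mult)
  also have "\<dots> = ennreal K * (\<integral>\<^sup>+x. ennreal (exp (- (c/2) * (norm x)\<^sup>2)) \<partial>(lborel :: 'a measure))"
    by (rule nn_integral_cmult) simp
  also have "\<dots> < \<infinity>"
    using nn_integral_gaussian_finite[of "c/2", where 'a='a] assms by (simp add: ennreal_mult_less_top)
  finally show ?thesis .
qed

section \<open>Entire functions on complex space\<close>

text \<open>Multiplication by \<open>circ x\<close>, \<open>0 \<le> x \<le> 1\<close>, runs once through the rotations of a complex line.\<close>

definition circ :: "real \<Rightarrow> complex" where "circ x = exp (2 * of_real pi * \<i> * of_real x)"

lemma norm_circ [simp]: "norm (circ x) = 1"
  by (simp add: circ_def norm_exp_eq_Re)

lemma circ_nonzero [simp]: "circ x \<noteq> 0"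
  by (simp add: circ_def)

lemma circ_minus: "circ (- x) = inverse (circ x)"
  by (simp add: circ_def exp_minus)

lemma continuous_on_circ [continuous_intros]:
  "continuous_on S f \<Longrightarrow> continuous_on S (\<lambda>x. circ (f x))"
  unfolding circ_def by (intro continuous_intros)

text \<open>A real-linear map that commutes with complex scalars is determined by its values on the standard
basis, so the derivative of an entire function has the form of a complex gradient.\<close>

lemma entire_iff_partials:
  "entire f \<longleftrightarrow> (\<forall>z. \<exists>c. (f has_derivative (\<lambda>v. \<Sum>i\<in>UNIV. v $ i * c i)) (at z))"
proof
  assume f: "entire f"
  show "\<forall>z. \<exists>c. (f has_derivative (\<lambda>v. \<Sum>i\<in>UNIV. v $ i * c i)) (at z)"
  proof
    fix z
    obtain D where D: "(f has_derivative D) (at z)" "\<And>c v. D (c *s v) = c * D v"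
      using f unfolding entire_def by blast
    have "D v = (\<Sum>i\<in>UNIV. v $ i * D (axis i 1))" for v
    proof -
      have "D v = D (\<Sum>i\<in>UNIV. v $ i *s axis i 1)" by (simp add: basis_expansion)
      also have "\<dots> = (\<Sum>i\<in>UNIV. D (v $ i *s axis i 1))"
        using has_derivative_linear[OF D(1)] by (rule linear_sum)
      finally show ?thesis by (simp add: D(2))
    qed
    then have "D = (\<lambda>v. \<Sum>i\<in>UNIV. v $ i * D (axis i 1))" by (rule ext)
    with D(1) have "(f has_derivative (\<lambda>v. \<Sum>i\<in>UNIV. v $ i * D (axis i 1))) (at z)" by simp
    then show "\<exists>c. (f has_derivative (\<lambda>v. \<Sum>i\<in>UNIV. v $ i * c i)) (at z)"
      by (rule exI[of _ "\<lambda>i. D (axis i 1)"])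
  qed
next
  assume *: "\<forall>z. \<exists>c. (f has_derivative (\<lambda>v. \<Sum>i\<in>UNIV. v $ i * c i)) (at z)"
  show "entire f" unfolding entire_def
  proof
    fix z
    obtain c where "(f has_derivative (\<lambda>v. \<Sum>i\<in>UNIV. v $ i * c i)) (at z)" using * by blast
    then show "\<exists>D. (f has_derivative D) (at z) \<and> (\<forall>c v. D (c *s v) = c * D v)"
      by (intro exI[of _ "\<lambda>v. \<Sum>i\<in>UNIV. v $ i * c i"]) (simp add: sum_distrib_left mult.assoc)
  qed
qed

lemma has_derivative_line:
  fixes f :: "complex^'n \<Rightarrow> complex"
  assumes "(f has_derivative (\<lambda>v. \<Sum>i\<in>UNIV. v $ i * c i)) (at (z + t *s w))"
  shows "((\<lambda>t. f (z + t *s w)) has_field_derivative (\<Sum>i\<in>UNIV. w $ i * c i)) (at t)"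
proof -
  have "((\<lambda>t. z + t *s w) has_derivative (\<lambda>h. h *s w)) (at t)"
    using has_derivative_add[OF has_derivative_const
      bounded_linear.has_derivative[OF bounded_linear_cscale_left[of w] has_derivative_ident]]
    by simp
  from diff_chain_at[OF this assms]
  have "((\<lambda>t. f (z + t *s w)) has_derivative (\<lambda>h. \<Sum>i\<in>UNIV. (h *s w) $ i * c i)) (at t)"
    unfolding o_def .
  moreover have "(\<lambda>h. \<Sum>i\<in>UNIV. (h *s w) $ i * c i) = (*) (\<Sum>i\<in>UNIV. w $ i * c i)"
    by (auto simp: fun_eq_iff sum_distrib_left mult_ac)
  ultimately show ?thesis
    unfolding has_field_derivative_def by (rule back_subst[of "\<lambda>D. (_ has_derivative D) _"])
qed

lemma entire_line_derivative:
  assumes "entire f"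
  obtains c where "((\<lambda>t. f (z + t *s w)) has_field_derivative c) (at t)"
proof -
  obtain c where "(f has_derivative (\<lambda>v. \<Sum>i\<in>UNIV. v $ i * c i)) (at (z + t *s w))"
    using assms unfolding entire_iff_partials by blast
  from that[OF has_derivative_line[OF this]] show thesis .
qed

lemma entire_line_holomorphic:
  assumes "entire f" shows "(\<lambda>t. f (z + t *s w)) holomorphic_on A"
proof -
  have "(\<lambda>t. f (z + t *s w)) field_differentiable at t within A" for t
    using entire_line_derivative[OF assms, of z w t]
    by (metis field_differentiable_at_within field_differentiable_def)
  then show ?thesis by (simp add: holomorphic_on_def)
qed

lemma axis_eq_cscale: "axis i t = t *s axis i (1::complex)"
  by (simp add: vec_eq_iff axis_def)

lemma cpartial_unique:
  assumes "(f has_derivative (\<lambda>v. \<Sum>i\<in>UNIV. v $ i * c i)) (at z)"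
  shows "cpartial i f z = c i"
proof -
  have "((\<lambda>t. f (z + t *s axis i 1)) has_field_derivative (\<Sum>j\<in>UNIV. axis i 1 $ j * c j)) (at 0)"
    using assms by (intro has_derivative_line) simp
  then have "cpartial i f z = (\<Sum>j\<in>UNIV. axis i 1 $ j * c j)"
    unfolding cpartial_def axis_eq_cscale[symmetric] by (rule DERIV_imp_deriv)
  then show ?thesis by (simp add: axis_def if_distrib[of "\<lambda>x. x * _"] cong: if_cong)
qed

lemma entire_has_derivative:
  assumes "entire f"
  shows "(f has_derivative (\<lambda>v. \<Sum>i\<in>UNIV. v $ i * cpartial i f z)) (at z)"
proof -
  obtain c where c: "(f has_derivative (\<lambda>v. \<Sum>i\<in>UNIV. v $ i * c i)) (at z)"
    using assms unfolding entire_iff_partials by blast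
  then have "cpartial i f z = c i" for i
    by (rule cpartial_unique)
  then show ?thesis using c by simp
qed

lemma entire_continuous_on: "entire f \<Longrightarrow> continuous_on S f"
  by (intro continuous_at_imp_continuous_on ballI has_derivative_continuous[OF entire_has_derivative])

lemma entire_measurable [measurable_dest]: "entire f \<Longrightarrow> f \<in> borel_measurable borel"
  by (simp add: borel_measurable_continuous_onI entire_continuous_on)

lemma entire_const: "entire (\<lambda>z. c)"
  unfolding entire_iff_partials by (intro allI exI[of _ "\<lambda>_. 0"]) simp

lemma entire_diff:
  assumes "entire f" "entire g" shows "entire (\<lambda>z. f z - g z)"
  unfolding entire_iff_partials
proof
  fix z
  show "\<exists>c. ((\<lambda>z. f z - g z) has_derivative (\<lambda>v. \<Sum>i\<in>UNIV. v $ i * c i)) (at z)"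
    using has_derivative_diff[OF assms[THEN entire_has_derivative], of z]
    by (intro exI[of _ "\<lambda>i. cpartial i f z - cpartial i g z"])
      (simp add: right_diff_distrib sum_subtractf)
qed

lemma entire_mult:
  assumes "entire f" "entire g" shows "entire (\<lambda>z. f z * g z)"
  unfolding entire_iff_partials
proof
  fix z
  have "(\<lambda>v. f z * (\<Sum>i\<in>UNIV. v $ i * cpartial i g z) + (\<Sum>i\<in>UNIV. v $ i * cpartial i f z) * g z)
     = (\<lambda>v. \<Sum>i\<in>UNIV. v $ i * (f z * cpartial i g z + cpartial i f z * g z))"
    by (simp add: sum_distrib_left sum_distrib_right sum.distrib algebra_simps)
  then show "\<exists>c. ((\<lambda>z. f z * g z) has_derivative (\<lambda>v. \<Sum>i\<in>UNIV. v $ i * c i)) (at z)"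
    using has_derivative_mult[OF assms[THEN entire_has_derivative], of z]
    by (intro exI[of _ "\<lambda>i. f z * cpartial i g z + cpartial i f z * g z"]) simp
qed

lemma entire_compose:
  assumes f: "entire f" and psi: "entire_map \<psi>" shows "entire (\<lambda>z. f (\<psi> z))"
  unfolding entire_def
proof
  fix z
  define D where "D v = (\<chi> i. \<Sum>j\<in>UNIV. v $ j * cpartial j (\<lambda>z. \<psi> z $ i) z)" for v
  have D: "(\<psi> has_derivative D) (at z)"
  proof (subst has_derivative_componentwise_within, rule ballI)
    fix b :: "complex^'a" assume "b \<in> Basis"
    then obtain i c where b: "b = axis i c" by (auto simp: Basis_vec_def)
    have "((\<lambda>z. \<psi> z $ i) has_derivative (\<lambda>v. D v $ i)) (at z)"
      using psi entire_has_derivative[of "\<lambda>z. \<psi> z $ i" z] by (simp add: entire_map_def D_def)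
    then show "((\<lambda>x. \<psi> x \<bullet> b) has_derivative (\<lambda>x. D x \<bullet> b)) (at z)"
      unfolding b inner_axis by (rule has_derivative_inner_left)
  qed
  have lin: "D (c *s v) = c *s D v" for c v
    by (simp add: D_def vec_eq_iff sum_distrib_left mult.assoc)
  obtain E where E: "(f has_derivative E) (at (\<psi> z))" "\<And>c v. E (c *s v) = c * E v"
    using f unfolding entire_def by blast
  have "((\<lambda>z. f (\<psi> z)) has_derivative (\<lambda>v. E (D v))) (at z)"
    using diff_chain_at[OF D E(1)] by (simp add: o_def)
  then show "\<exists>D. ((\<lambda>z. f (\<psi> z)) has_derivative D) (at z) \<and> (\<forall>c v. D (c *s v) = c * D v)"
    using E(2) lin by (intro exI[of _ "\<lambda>v. E (D v)"]) simp
qed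

lemma entire_map_continuous_on:
  assumes "entire_map \<psi>" shows "continuous_on S \<psi>"
proof -
  have "continuous_on S (\<lambda>z. \<chi> i. \<psi> z $ i)"
    using assms by (intro continuous_intros entire_continuous_on) (simp add: entire_map_def)
  then show ?thesis by simp
qed

lemma entire_map_measurable [measurable_dest]:
  "entire_map \<psi> \<Longrightarrow> \<psi> \<in> borel_measurable borel"
  by (simp add: borel_measurable_continuous_onI entire_map_continuous_on)

text \<open>Cauchy's formulas for the value and the first derivative on a circle of a complex line, written as
integrals over the real interval from \<open>0\<close> to \<open>1\<close>; in this form they can be integrated and
differentiated with respect to \<open>z\<close>.\<close>

lemma entire_cauchy_formula:
  assumes "entire f"
  shows "((\<lambda>x. f (z + circ x *s w)) has_integral f z) {0..1}"
    and "((\<lambda>x. f (z + circ x *s axis i 1) * circ (-x)) has_integral cpartial i f z) {0..1}"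
proof -
  have circle: "circlepath 0 1 x = circ x" for x
    by (simp add: circlepath circ_def)
  have key: "((\<lambda>x. g (circ x) * inverse (circ x) ^ k) has_integral (deriv ^^ k) g 0 / fact k) {0..1}"
    if g: "g holomorphic_on UNIV" for g :: "complex \<Rightarrow> complex" and k :: nat
  proof -
    let ?c = "2 * of_real pi * \<i>" and ?d = "(deriv ^^ k) g 0"
    have "continuous_on (cball 0 1) g" "g holomorphic_on ball 0 1" "(0::complex) \<in> ball 0 1"
      by (simp_all add: holomorphic_on_imp_continuous_on[OF holomorphic_on_subset[OF g subset_UNIV]]
          holomorphic_on_subset[OF g subset_UNIV])
    from Cauchy_has_contour_integral_higher_derivative_circlepath[OF this, of k]
    have "((\<lambda>u. g u / (u - 0) ^ Suc k) has_contour_integral (?c / fact k * ?d)) (circlepath 0 1)"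
      unfolding of_real_mult of_real_numeral .
    then have int: "((\<lambda>x. g (circ x) / circ x ^ Suc k * vector_derivative (circlepath 0 1) (at x within {0..1}))
        has_integral (?c / fact k * ?d)) {0..1}"
      unfolding has_contour_integral_def circle diff_zero .
    have "((\<lambda>x. g (circ x) / circ x ^ Suc k * (?c * circ x)) has_integral (?c / fact k * ?d)) {0..1}"
    proof (rule has_integral_spike[OF negligible_empty _ int])
      fix x :: real assume "x \<in> {0..1} - {}"
      then have "vector_derivative (circlepath 0 1) (at x within {0..1}) = ?c * circ x"
        by (simp add: vector_derivative_circlepath01 circ_def)
      then show "g (circ x) / circ x ^ Suc k * (?c * circ x) =
          g (circ x) / circ x ^ Suc k * vector_derivative (circlepath 0 1) (at x within {0..1})"
        by (simp only:)
    qed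
    from has_integral_mult_right[OF this, of "inverse ?c"]
    have "((\<lambda>x. inverse ?c * (g (circ x) / circ x ^ Suc k * (?c * circ x))) has_integral
      inverse ?c * (?c / fact k * ?d)) {0..1}" .
    moreover have "inverse ?c * (g (circ x) / circ x ^ Suc k * (?c * circ x)) = g (circ x) * inverse (circ x) ^ k" for x
      by (simp add: field_simps)
    moreover have "inverse ?c * (?c / fact k * ?d) = ?d / fact k"
    proof -
      have "inverse c * (c / b * d) = d / b" if "c \<noteq> 0" for b c d :: complex
        using that by simp
      from this[of ?c] show ?thesis by force
    qed
    ultimately show ?thesis by (simp only:)
  qed
  show "((\<lambda>x. f (z + circ x *s w)) has_integral f z) {0..1}"
    using key[OF entire_line_holomorphic[OF assms, of z w], of 0] by simp
  show "((\<lambda>x. f (z + circ x *s axis i 1) * circ (-x)) has_integral cpartial i f z) {0..1}"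
    using key[OF entire_line_holomorphic[OF assms, of z "axis i 1"], of 1]
    by (simp add: cpartial_def axis_eq_cscale[symmetric] circ_minus)
qed

lemma cpartial_integral:
  assumes "entire f"
  shows "cpartial i f = (\<lambda>z. integral (cbox 0 1) (\<lambda>x. f (z + circ x *s axis i 1) * circ (-x)))"
proof
  show "cpartial i f z = integral (cbox 0 1) (\<lambda>x. f (z + circ x *s axis i 1) * circ (-x))" for z
    using integral_unique[OF entire_cauchy_formula(2)[OF assms, of z i]] by simp
qed

lemma continuous_on_cpartial:
  assumes "entire f" shows "continuous_on S (cpartial i f)"
proof -
  have "continuous_on UNIV (cpartial i f)"
    unfolding cpartial_integral[OF assms]
    by (intro integral_continuous_on_param)
      (auto simp: split_beta intro!: continuous_intros continuous_on_compose2[OF entire_continuous_on[OF assms, of UNIV]])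
  then show ?thesis by (rule continuous_on_subset) simp
qed

text \<open>Cauchy's formula expresses \<open>cpartial i f\<close> as an integral of \<open>f\<close>. The partial derivatives of \<open>f\<close>
are continuous by the same formula, so it may be differentiated under the integral sign; this
shows both that partial derivatives are entire and that they commute.\<close>

lemma cpartial_entire_aux:
  assumes f: "entire f"
  shows "(cpartial i f has_derivative
     (\<lambda>v. \<Sum>j\<in>UNIV. v $ j * integral (cbox 0 1) (\<lambda>x. cpartial j f (z + circ x *s axis i 1) * circ (-x)))) (at z)"
proof -
  define L where "L z x = (\<Sum>j\<in>UNIV. blinfun_mult_right (cpartial j f (z + circ x *s axis i 1) * circ (-x))
      o\<^sub>L Blinfun (\<lambda>v. v $ j))" for z :: "complex^'a" and x :: real
  have L_apply: "blinfun_apply (L z x) v = (\<Sum>j\<in>UNIV. v $ j * (cpartial j f (z + circ x *s axis i 1) * circ (-x)))"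
    for z x v
    by (simp add: L_def blinfun.sum_left bounded_linear_Blinfun_apply bounded_linear_vec_nth mult_ac)
  have cont: "continuous_on S (\<lambda>x. cpartial j f (g x + circ (h x) *s axis i 1) * circ (- h x))"
    if "continuous_on S g" "continuous_on S h" for S :: "'b::topological_space set" and g h j
    using that
    by (intro continuous_intros continuous_on_compose2[OF continuous_on_cpartial[OF f, of UNIV]]) auto
  have L_cont: "continuous_on (UNIV \<times> cbox 0 1) (\<lambda>(z, x). L z x)"
    unfolding L_def split_beta
    by (intro continuous_on_sum bounded_bilinear.continuous_on[OF bounded_bilinear_blinfun_compose]
        bounded_linear.continuous_on[OF bounded_linear_blinfun_mult_right] cont continuous_intros)
  have der: "((\<lambda>z. integral (cbox 0 1) (\<lambda>x. f (z + circ x *s axis i 1) * circ (-x)))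
      has_derivative integral (cbox 0 1) (L z)) (at z within UNIV)"
  proof (rule leibniz_rule[OF _ _ L_cont])
    fix z x
    have "((\<lambda>z. z + circ x *s axis i 1) has_derivative (\<lambda>v. v)) (at z)"
      by (auto intro!: derivative_eq_intros)
    from has_derivative_mult_left[OF diff_chain_at[OF this entire_has_derivative[OF f]], of "circ (-x)"]
    show "((\<lambda>z. f (z + circ x *s axis i 1) * circ (-x)) has_derivative L z x) (at z within UNIV)"
      unfolding L_apply[abs_def] o_def sum_distrib_right mult.assoc by simp
  next
    fix z
    show "(\<lambda>x. f (z + circ x *s axis i 1) * circ (-x)) integrable_on cbox 0 1"
      by (intro integrable_continuous continuous_intros continuous_on_compose2[OF entire_continuous_on[OF f, of UNIV]]) auto
  qed auto
  have eq: "integral (cbox 0 1) (L z) v =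
     (\<Sum>j\<in>UNIV. v $ j * integral (cbox 0 1) (\<lambda>x. cpartial j f (z + circ x *s axis i 1) * circ (-x)))" for v
  proof -
    have "continuous_on (cbox 0 1) (\<lambda>x. case (z, x) of (z, x) \<Rightarrow> L z x)"
      by (rule continuous_on_compose2[OF L_cont]) (auto intro!: continuous_intros)
    then have "L z integrable_on cbox 0 1"
      by (intro integrable_continuous) simp
    then have "integral (cbox 0 1) (L z) v = integral (cbox 0 1) (\<lambda>x. L z x v)"
      by (rule blinfun_apply_integral)
    also have "\<dots> = (\<Sum>j\<in>UNIV. v $ j * integral (cbox 0 1) (\<lambda>x. cpartial j f (z + circ x *s axis i 1) * circ (-x)))"
    proof -
      have int: "(\<lambda>x. cpartial j f (z + circ x *s axis i 1) * circ (-x)) integrable_on cbox 0 1" for j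
        by (intro integrable_continuous cont continuous_intros)
      show ?thesis
        unfolding L_apply
        by (subst integral_sum) (intro finite integrable_on_mult_right int ballI | simp)+
    qed
    finally show ?thesis .
  qed
  show ?thesis
    by (rule has_derivative_eq_rhs[OF der[unfolded cpartial_integral[OF f, of i, symmetric]] ext]) (rule eq)
qed

lemma entire_cpartial:
  assumes "entire f" shows "entire (cpartial i f)"
  unfolding entire_iff_partials[of "cpartial i f"]
proof
  fix z
  show "\<exists>c. (cpartial i f has_derivative (\<lambda>v. \<Sum>j\<in>UNIV. v $ j * c j)) (at z)"
    using cpartial_entire_aux[OF assms, of i z]
    by (intro exI[of _ "\<lambda>j. integral (cbox 0 1) (\<lambda>x. cpartial j f (z + circ x *s axis i 1) * circ (-x))"])
qed

lemma cpartial_commute: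
  assumes f: "entire f" shows "cpartial j (cpartial i f) = cpartial i (cpartial j f)"
proof
  fix z
  have "((\<lambda>t. cpartial i f (z + t *s axis j 1)) has_field_derivative
     (\<Sum>k\<in>UNIV. axis j 1 $ k * integral (cbox 0 1) (\<lambda>x. cpartial k f (z + circ x *s axis i 1) * circ (-x)))) (at 0)"
    using cpartial_entire_aux[OF f] by (intro has_derivative_line) simp
  then have "cpartial j (cpartial i f) z = (\<Sum>k\<in>UNIV. axis j 1 $ k * integral (cbox 0 1) (\<lambda>x. cpartial k f (z + circ x *s axis i 1) * circ (-x)))"
    unfolding cpartial_def[of j] axis_eq_cscale[symmetric] by (rule DERIV_imp_deriv)
  also have "\<dots> = integral (cbox 0 1) (\<lambda>x. cpartial j f (z + circ x *s axis i 1) * circ (-x))"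
    by (simp add: axis_def if_distrib[of "\<lambda>x. x * _"] cong: if_cong)
  also have "\<dots> = cpartial i (cpartial j f) z"
    unfolding cpartial_integral[OF entire_cpartial[OF f], of i] ..
  finally show "cpartial j (cpartial i f) z = cpartial i (cpartial j f) z" .
qed


text \<open>Bounds on derivatives that depend on \<open>f\<close> only through a bound on \<open>f\<close>: locally bounded families of
entire functions are locally equicontinuous.\<close>

lemma norm_cpartial_le:
  assumes f: "entire f" and "\<And>w. w \<in> cball z 1 \<Longrightarrow> norm (f w) \<le> B"
  shows "norm (cpartial i f z) \<le> B"
proof -
  have "0 \<le> B" using order_trans[OF norm_ge_zero assms(2)[of z]] by simp
  moreover have "norm (f (z + circ x *s axis i 1) * circ (- x)) \<le> B" for x
    using assms(2)[of "z + circ x *s axis i 1"] by (simp add: norm_mult dist_norm)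
  ultimately show ?thesis
    using has_integral_bound[OF _ entire_cauchy_formula(2)[OF f, of z i, unfolded cbox_interval[symmetric]], of B]
    by simp
qed

lemma entire_lipschitz_on_cball:
  assumes f: "entire f" and B: "\<And>w. w \<in> cball 0 (R + 1) \<Longrightarrow> norm (f w) \<le> B"
    and xy: "x \<in> cball 0 R" "y \<in> cball 0 R"
  shows "norm (f x - f y) \<le> (real CARD('n) * B) * norm (x - (y :: complex^'n))"
proof (rule differentiable_bound[OF convex_cball _ _ xy])
  fix z :: "complex^'n" assume z: "z \<in> cball 0 R"
  show "(f has_derivative (\<lambda>v. \<Sum>i\<in>UNIV. v $ i * cpartial i f z)) (at z within cball 0 R)"
    using entire_has_derivative[OF f] by (rule has_derivative_at_withinI)
  have "norm w \<le> R + 1" if "w \<in> cball z 1" for w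
    using that z norm_triangle_sub[of w z] by (simp add: dist_norm norm_minus_commute)
  then have c: "norm (cpartial i f z) \<le> B" for i
    by (intro norm_cpartial_le[OF f] B) simp
  show "onorm (\<lambda>v. \<Sum>i\<in>UNIV. v $ i * cpartial i f z) \<le> real CARD('n) * B"
  proof (rule onorm_le)
    fix v :: "complex^'n"
    have "norm (\<Sum>i\<in>UNIV. v $ i * cpartial i f z) \<le> (\<Sum>i\<in>(UNIV::'n set). norm v * B)"
      by (intro sum_norm_le) (auto simp: norm_mult intro!: mult_mono c Finite_Cartesian_Product.norm_nth_le)
    then show "norm (\<Sum>i\<in>UNIV. v $ i * cpartial i f z) \<le> real CARD('n) * B * norm v"
      by (simp add: mult_ac)
  qed
qed

text \<open>The integrals in Cauchy's formula converge together with the functions, so the gradients converge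
locally uniformly as well, and limits may be differentiated termwise.\<close>

lemma entire_locally_uniform_limit:
  fixes g :: "complex^'n \<Rightarrow> complex"
  assumes F: "\<And>k::nat. entire (F k)" and lim: "\<And>R. uniform_limit (cball 0 R) F g sequentially"
  shows "entire g"
  unfolding entire_iff_partials
proof
  fix z :: "complex^'n"
  define R where "R = norm z + 2"
  have gc: "continuous_on (cball 0 r) g" for r
    using uniform_limit_theorem[OF _ lim[of r]] entire_continuous_on[OF F] by auto
  have g_cont: "continuous_on UNIV g"
    unfolding continuous_on_eq_continuous_at[OF open_UNIV]
  proof
    fix x show "isCont g x"
      using gc[of "norm x + 1"] continuous_on_interior[of "cball 0 (norm x + 1)" g x] by simp
  qed
  define G where "G i x = integral (cbox 0 1) (\<lambda>t. g (x + circ t *s axis i 1) * circ (-t))" for i x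
  have G: "((\<lambda>t. g (x + circ t *s axis i 1) * circ (-t)) has_integral G i x) (cbox 0 1)" for i x
    unfolding G_def
    by (intro integrable_integral integrable_continuous continuous_intros
        continuous_on_compose2[OF g_cont]) auto
  have conv: "norm (cpartial i (F k) x - G i x) \<le> e"
    if e: "0 \<le> e" "\<And>w. w \<in> cball 0 R \<Longrightarrow> norm (F k w - g w) \<le> e" and x: "x \<in> ball z 1" for e k x i
  proof -
    have int: "((\<lambda>t. F k (x + circ t *s axis i 1) * circ (-t) - g (x + circ t *s axis i 1) * circ (-t))
        has_integral cpartial i (F k) x - G i x) (cbox 0 1)"
      using has_integral_diff[OF entire_cauchy_formula(2)[OF F, of k x i, unfolded cbox_interval[symmetric]] G] .
    have "norm (F k (x + circ t *s axis i 1) * circ (-t) - g (x + circ t *s axis i 1) * circ (-t)) \<le> e" for t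
    proof -
      have "norm (x + circ t *s axis i 1) \<le> norm x + 1"
        using norm_triangle_ineq[of x "circ t *s axis i 1"] by simp
      moreover have "norm x \<le> norm z + 1"
        using x norm_triangle_sub[of x z] by (auto simp: dist_norm norm_minus_commute)
      ultimately have "x + circ t *s axis i 1 \<in> cball 0 R" by (simp add: R_def)
      from e(2)[OF this] show ?thesis
        by (simp add: norm_mult flip: left_diff_distrib)
    qed
    then show ?thesis using has_integral_bound[OF e(1) int] by simp
  qed
  have "\<exists>g2. \<forall>x\<in>ball z 1. (\<lambda>n. F n x) \<longlonglongrightarrow> g2 x \<and>
      (g2 has_derivative (\<lambda>v. \<Sum>i\<in>UNIV. v $ i * G i x)) (at x within ball z 1)"
  proof (rule has_derivative_sequence[OF convex_ball])
    show "(F n has_derivative (\<lambda>v. \<Sum>i\<in>UNIV. v $ i * cpartial i (F n) x)) (at x within ball z 1)" for n x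
      using entire_has_derivative[OF F] by (rule has_derivative_at_withinI)
    show "z \<in> ball z 1" by simp
    show "(\<lambda>n. F n z) \<longlonglongrightarrow> g z"
      using lim[of R] by (rule tendsto_uniform_limitI) (simp add: R_def)
    fix e :: real assume "0 < e"
    then have "0 < e / real CARD('n)" by simp
    from uniform_limitD[OF lim[of R] this]
    show "\<forall>\<^sub>F n in sequentially. \<forall>x\<in>ball z 1. \<forall>h. norm ((\<Sum>i\<in>UNIV. h $ i * cpartial i (F n) x) -
        (\<Sum>i\<in>UNIV. h $ i * G i x)) \<le> e * norm h"
    proof eventually_elim
      case (elim n)
      show ?case
      proof (intro ballI allI)
        fix x and h :: "complex^'n" assume x: "x \<in> ball z 1"
        have c: "norm (cpartial i (F n) x - G i x) \<le> e / real CARD('n)" for i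
          using elim \<open>0 < e\<close> x by (intro conv) (auto simp: dist_norm less_imp_le)
        have "norm (\<Sum>i\<in>UNIV. h $ i * (cpartial i (F n) x - G i x)) \<le> (\<Sum>i\<in>(UNIV::'n set). norm h * (e / real CARD('n)))"
          unfolding norm_mult using \<open>0 < e\<close>
          by (intro sum_norm_le) (unfold norm_mult, intro mult_mono c Finite_Cartesian_Product.norm_nth_le, auto)
        then show "norm ((\<Sum>i\<in>UNIV. h $ i * cpartial i (F n) x) - (\<Sum>i\<in>UNIV. h $ i * G i x)) \<le> e * norm h"
          by (simp add: right_diff_distrib sum_subtractf mult_ac)
      qed
    qed
  qed
  then obtain g2 where g2: "\<And>x. x \<in> ball z 1 \<Longrightarrow> (\<lambda>n. F n x) \<longlonglongrightarrow> g2 x"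
      "(g2 has_derivative (\<lambda>v. \<Sum>i\<in>UNIV. v $ i * G i z)) (at z within ball z 1)"
    by force
  have "g2 x = g x" if "x \<in> ball z 1" for x
    using g2(1)[OF that] tendsto_uniform_limitI[OF lim[of "norm x"], of x] by (auto intro: LIMSEQ_unique)
  then have "(g has_derivative (\<lambda>v. \<Sum>i\<in>UNIV. v $ i * G i z)) (at z within ball z 1)"
    using has_derivative_transform[of z "ball z 1" g g2, OF _ _ g2(2)] by simp
  then show "\<exists>c. (g has_derivative (\<lambda>v. \<Sum>i\<in>UNIV. v $ i * c i)) (at z)"
    by (auto simp: at_within_open[of z "ball z 1"])
qed

text \<open>Montel's theorem: the Lipschitz bounds give a uniformly convergent subsequence on each ball by the
theorem of Arzela and Ascoli, and a diagonal argument serves all balls of integer radius.\<close>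

lemma entire_montel:
  fixes F :: "nat \<Rightarrow> complex^'n \<Rightarrow> complex"
  assumes F: "\<And>k. entire (F k)" and bdd: "\<And>R. \<exists>B. \<forall>k. \<forall>z\<in>cball 0 R. norm (F k z) \<le> B"
  obtains r g where "strict_mono r" "entire g"
    "\<And>R. uniform_limit (cball 0 R) (\<lambda>k. F (r k)) g sequentially"
proof -
  define P where "P i r \<longleftrightarrow> (\<exists>g. uniform_limit (cball 0 (real i)) (\<lambda>k. F (r k)) g sequentially)"
    for i and r :: "nat \<Rightarrow> nat"
  obtain r where r: "strict_mono (r :: nat \<Rightarrow> nat)" "\<And>i. P i (id \<circ> r)"
  proof (rule subsequence_diagonalization_lemma[of P id])
    fix i and r :: "nat \<Rightarrow> nat"
    obtain B0 where B0: "\<And>k z. z \<in> cball 0 (real i + 1) \<Longrightarrow> norm (F k z) \<le> B0"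
      using bdd by blast
    define K where "K = real CARD('n) * B0"
    have lip: "norm (F k x - F k y) \<le> K * norm (x - y)"
      if "x \<in> cball 0 (real i)" "y \<in> cball 0 (real i)" for k x y
      unfolding K_def using that by (intro entire_lipschitz_on_cball[OF F B0])
    obtain g k where "strict_mono (k :: nat \<Rightarrow> nat)" and
      k: "\<And>e. 0 < e \<Longrightarrow> \<exists>N. \<forall>n x. n \<ge> N \<and> x \<in> cball 0 (real i) \<longrightarrow> norm (F (r (k n)) x - g x) < e"
    proof (rule Arzela_Ascoli[of "cball 0 (real i)" "\<lambda>k. F (r k)" B0])
      show "norm (F (r n) x) \<le> B0" if "x \<in> cball 0 (real i)" for n x
        using that by (intro B0) simp
      fix x :: "complex^'n" and e :: real assume x: "x \<in> cball 0 (real i)" and "0 < e"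
      define d where "d = e / (\<bar>K\<bar> + 1)"
      have "0 < d" using \<open>0 < e\<close> by (simp add: d_def)
      moreover have "norm (F (r n) x - F (r n) y) < e"
        if "y \<in> cball 0 (real i)" "norm (x - y) < d" for n y
      proof -
        have "norm (F (r n) x - F (r n) y) \<le> K * norm (x - y)" using lip x that by blast
        also have "\<dots> \<le> \<bar>K\<bar> * norm (x - y)" by (intro mult_right_mono) auto
        also have "\<dots> \<le> (\<bar>K\<bar> + 1) * norm (x - y)" by (intro mult_right_mono) auto
        also have "\<dots> < (\<bar>K\<bar> + 1) * d" using that by (intro mult_strict_left_mono) auto
        also have "\<dots> = e" by (simp add: d_def)
        finally show ?thesis .
      qed
      ultimately show "\<exists>d>0. \<forall>n y. y \<in> cball 0 (real i) \<and> norm (x - y) < d \<longrightarrow>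
          norm (F (r n) x - F (r n) y) < e" by blast
    qed auto
    then have "uniform_limit (cball 0 (real i)) (\<lambda>n. F (r (k n))) g sequentially"
      unfolding uniform_limit_sequentially_iff dist_norm by blast
    then show "\<exists>k. strict_mono k \<and> P i (r \<circ> k)"
      using \<open>strict_mono k\<close> unfolding P_def o_def by blast
  next
    fix i N and r k1 k2 :: "nat \<Rightarrow> nat"
    assume "P i (r \<circ> k1)" and sub: "\<And>j. N \<le> j \<Longrightarrow> \<exists>j'\<ge>j. k2 j = k1 j'"
    then obtain g where g: "uniform_limit (cball 0 (real i)) (\<lambda>k. F (r (k1 k))) g sequentially"
      by (auto simp: P_def)
    have "uniform_limit (cball 0 (real i)) (\<lambda>k. F (r (k2 k))) g sequentially"
      unfolding uniform_limit_sequentially_iff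
    proof (intro allI impI)
      fix e :: real assume "0 < e"
      then obtain M where M: "\<And>n x. n \<ge> M \<Longrightarrow> x \<in> cball 0 (real i) \<Longrightarrow> dist (F (r (k1 n)) x) (g x) < e"
        using g unfolding uniform_limit_sequentially_iff by blast
      have "dist (F (r (k2 n)) x) (g x) < e" if "n \<ge> max M N" "x \<in> cball 0 (real i)" for n x
        using sub[of n] M that by (metis max.bounded_iff order_trans)
      then show "\<exists>N. \<forall>n\<ge>N. \<forall>x\<in>cball 0 (real i). dist (F (r (k2 n)) x) (g x) < e" by blast
    qed
    then show "P i (r \<circ> k2)" by (auto simp: P_def)
  qed blast
  define g where "g z = lim (\<lambda>k. F (r k) z)" for z
  have lim: "uniform_limit (cball 0 R) (\<lambda>k. F (r k)) g sequentially" for R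
  proof -
    define i where "i = nat \<lceil>R\<rceil>"
    have i: "cball 0 R \<subseteq> cball (0 :: complex^'n) (real i)" by (auto simp: i_def le_nat_iff) linarith
    obtain h where h: "uniform_limit (cball 0 (real i)) (\<lambda>k. F (r k)) h sequentially"
      using r(2)[of i] by (auto simp: P_def)
    have "g z = h z" if "z \<in> cball 0 (real i)" for z
      using tendsto_uniform_limitI[OF h that] by (simp add: g_def limI)
    then have "uniform_limit (cball 0 (real i)) (\<lambda>k. F (r k)) g sequentially"
      using uniform_limit_cong'[of "cball 0 (real i)" "\<lambda>k. F (r k)" "\<lambda>k. F (r k)" g h sequentially] h by simp
    then show ?thesis using i by (rule uniform_limit_on_subset)
  qed
  have "entire g" using F lim by (rule entire_locally_uniform_limit)
  then show thesis using r(1) lim that by blast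
qed

section \<open>Sub-mean value inequalities\<close>

lemma borel_measurable_cscale [measurable]:
  fixes g :: "'a \<Rightarrow> complex^'n"
  assumes "f \<in> borel_measurable M" "g \<in> borel_measurable M"
  shows "(\<lambda>x. f x *s g x) \<in> borel_measurable M"
  using assms by (rule borel_measurable_continuous_Pair) (intro continuous_intros)

lemma borel_measurable_circ [measurable]: "circ \<in> borel_measurable borel"
  by (intro borel_measurable_continuous_onI continuous_intros)

lemma entire_norm_le_circle_mean:
  assumes f: "entire f"
  shows "ennreal (norm (f z)) \<le> (\<integral>\<^sup>+x\<in>{0..1}. ennreal (norm (f (z + circ x *s w))) \<partial>lborel)"
proof -
  have c: "continuous_on S (\<lambda>x. f (z + circ x *s w))" for S
    by (intro continuous_intros continuous_on_compose2[OF entire_continuous_on[OF f, of UNIV]]) auto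
  have cn: "continuous_on S (\<lambda>x. norm (f (z + circ x *s w)))" for S
    using c by (rule continuous_on_norm)
  have int: "(\<lambda>x. f (z + circ x *s w)) integrable_on {0..1}"
    "(\<lambda>x. norm (f (z + circ x *s w))) integrable_on {0..1}"
    using integrable_continuous_real[OF c] integrable_continuous_real[OF cn] by auto
  have "norm (f z) = norm (integral {0..1} (\<lambda>x. f (z + circ x *s w)))"
    using integral_unique[OF entire_cauchy_formula(1)[OF f, of z w]] by simp
  also have "\<dots> \<le> integral {0..1} (\<lambda>x. norm (f (z + circ x *s w)))"
    using int by (rule integral_norm_bound_integral) simp
  finally have "ennreal (norm (f z)) \<le> ennreal (integral {0..1} (\<lambda>x. norm (f (z + circ x *s w))))"
    by (rule ennreal_leI)
  also have "\<dots> = (\<integral>\<^sup>+x. ennreal (if x \<in> {0..1} then norm (f (z + circ x *s w)) else 0) \<partial>lborel)"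
  proof (rule nn_integral_has_integral_lborel[symmetric])
    have [measurable]: "(\<lambda>x. norm (f (z + circ x *s w))) \<in> borel_measurable borel"
      by (intro borel_measurable_continuous_onI cn)
    show "(\<lambda>x. if x \<in> {0..1} then norm (f (z + circ x *s w)) else 0) \<in> borel_measurable borel"
      by measurable
    show "((\<lambda>x. if x \<in> {0..1} then norm (f (z + circ x *s w)) else 0) has_integral
        integral {0..1} (\<lambda>x. norm (f (z + circ x *s w)))) UNIV"
      using int(2) by (simp only: has_integral_restrict_UNIV integrable_integral)
  qed auto
  also have "\<dots> = (\<integral>\<^sup>+x\<in>{0..1}. ennreal (norm (f (z + circ x *s w))) \<partial>lborel)"
    by (intro nn_integral_cong) (simp add: indicator_def)
  finally show ?thesis .
qed

text \<open>For each \<open>w\<close> the circle through \<open>z + w\<close> of the complex line through \<open>z\<close> and \<open>z + w\<close> gives a mean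
value inequality. Averaging it over \<open>w\<close> in a ball yields the solid mean, because Lebesgue measure
and the ball are invariant under \<open>w \<mapsto> circ x *s w\<close>.\<close>

lemma entire_submean_ball:
  fixes f :: "complex^'n \<Rightarrow> complex"
  assumes f: "entire f"
  shows "ennreal (norm (f z)) * emeasure lborel (ball (0::complex^'n) r)
      \<le> (\<integral>\<^sup>+w\<in>ball z r. ennreal (norm (f w)) \<partial>lborel)"
proof -
  have [measurable]: "f \<in> borel_measurable borel" "ball z r \<in> sets borel"
    using f by (auto intro: entire_measurable)
  define B where "B = (indicator (ball (0::complex^'n) r) :: _ \<Rightarrow> ennreal)"
  have [measurable]: "B \<in> borel_measurable borel"
    unfolding B_def by (intro borel_measurable_indicator) simp
  have rot: "B (circ x *s w) = B w" for x w by (simp add: B_def indicator_def)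
  have "ennreal (norm (f z)) * emeasure lborel (ball (0::complex^'n) r)
      = (\<integral>\<^sup>+w. ennreal (norm (f z)) * B w \<partial>lborel)"
  proof -
    have "(\<integral>\<^sup>+w. B w \<partial>lborel) = emeasure lborel (ball (0::complex^'n) r)" by (simp add: B_def)
    then show ?thesis by (simp add: nn_integral_cmult)
  qed
  also have "\<dots> \<le> (\<integral>\<^sup>+w. (\<integral>\<^sup>+x\<in>{0..1}. ennreal (norm (f (z + circ x *s w))) \<partial>lborel) * B w \<partial>lborel)"
    by (intro nn_integral_mono mult_right_mono entire_norm_le_circle_mean f) simp
  also have "\<dots> = (\<integral>\<^sup>+w. (\<integral>\<^sup>+x. ennreal (norm (f (z + circ x *s w))) * indicator {0..1} x * B w \<partial>lborel) \<partial>lborel)"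
    by (simp add: nn_integral_multc)
  also have "\<dots> = (\<integral>\<^sup>+x. (\<integral>\<^sup>+w. ennreal (norm (f (z + circ x *s w))) * indicator {0..1} x * B w \<partial>lborel) \<partial>lborel)"
    by (rule lborel_pair.Fubini') measurable
  also have "\<dots> = (\<integral>\<^sup>+x. (\<integral>\<^sup>+w. ennreal (norm (f (z + w))) * B w \<partial>lborel) * indicator {0..1::real} x \<partial>lborel)"
  proof (rule nn_integral_cong)
    fix x :: real
    have "(\<integral>\<^sup>+w. ennreal (norm (f (z + circ x *s w))) * indicator {0..1} x * B w \<partial>lborel)
        = (\<integral>\<^sup>+w. (ennreal (norm (f (z + circ x *s w))) * B (circ x *s w)) * indicator {0..1} x \<partial>lborel)"
      by (simp add: rot mult_ac)
    also have "\<dots> = (\<integral>\<^sup>+w. (ennreal (norm (f (z + circ x *s w))) * B (circ x *s w)) \<partial>lborel) * indicator {0..1} x"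
      by (rule nn_integral_multc) measurable
    also have "(\<integral>\<^sup>+w. (ennreal (norm (f (z + circ x *s w))) * B (circ x *s w)) \<partial>lborel)
        = (\<integral>\<^sup>+w. ennreal (norm (f (z + w))) * B w \<partial>lborel)"
      by (rule nn_integral_rotate[where f="\<lambda>w. ennreal (norm (f (z + w))) * B w"]) auto
    finally show "(\<integral>\<^sup>+w. ennreal (norm (f (z + circ x *s w))) * indicator {0..1} x * B w \<partial>lborel)
        = (\<integral>\<^sup>+w. ennreal (norm (f (z + w))) * B w \<partial>lborel) * indicator {0..1} x" .
  qed
  also have "\<dots> = (\<integral>\<^sup>+w. ennreal (norm (f (z + w))) * B w \<partial>lborel)"
    by (simp add: nn_integral_cmult)
  also have "\<dots> = (\<integral>\<^sup>+w. ennreal (norm (f (z + w))) * indicator (ball z r) (z + w) \<partial>lborel)"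
    by (simp add: B_def indicator_def dist_norm)
  also have "\<dots> = (\<integral>\<^sup>+w\<in>ball z r. ennreal (norm (f w)) \<partial>lborel)"
    by (rule nn_integral_lborel_shift) measurable
  finally show ?thesis .
qed

lemma entire_submean_bound:
  fixes f :: "complex^'n \<Rightarrow> complex" and h :: "complex^'n \<Rightarrow> real"
  assumes f: "entire f" and r: "0 < r"
    and [measurable]: "h \<in> borel_measurable borel"
    and h: "\<And>w. w \<in> ball z r \<Longrightarrow> 0 \<le> h w" "\<And>w. w \<in> ball z r \<Longrightarrow> norm (f w) \<le> K * h w"
    and K: "0 \<le> K"
    and I: "0 \<le> I" "(\<integral>\<^sup>+w\<in>ball z r. ennreal (h w) \<partial>lborel) \<le> ennreal I"
  shows "norm (f z) * (unit_ball_vol (DIM(complex^'n)) * r ^ DIM(complex^'n)) \<le> K * I"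
proof -
  have [measurable]: "ball z r \<in> sets borel" by simp
  have "ennreal (norm (f z) * (unit_ball_vol (DIM(complex^'n)) * r ^ DIM(complex^'n)))
      = ennreal (norm (f z)) * emeasure lborel (ball (0::complex^'n) r)"
    using r by (simp add: emeasure_ball ennreal_mult)
  also have "\<dots> \<le> (\<integral>\<^sup>+w\<in>ball z r. ennreal (norm (f w)) \<partial>lborel)"
    by (rule entire_submean_ball[OF f])
  also have "\<dots> \<le> (\<integral>\<^sup>+w. ennreal K * (ennreal (h w) * indicator (ball z r) w) \<partial>lborel)"
    using h K by (intro nn_integral_mono) (auto simp: indicator_def ennreal_leI simp flip: ennreal_mult)
  also have "\<dots> = ennreal K * (\<integral>\<^sup>+w\<in>ball z r. ennreal (h w) \<partial>lborel)"
    by (rule nn_integral_cmult) measurable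
  also have "\<dots> \<le> ennreal K * ennreal I"
    using I by (intro mult_left_mono) auto
  also have "\<dots> = ennreal (K * I)" using K I by (simp add: ennreal_mult)
  finally show ?thesis using K I by (simp add: ennreal_le_iff)
qed

text \<open>For \<open>s < 1\<close> the mean value inequality for \<open>norm (f w)\<close> does not imply the one for its power by
convexity. Instead, choose a point \<open>w0\<close> at which \<open>norm (f w)\<close> times a power of the distance from \<open>w\<close>
to the sphere is maximal. On a ball around \<open>w0\<close> the modulus is then at most a constant times its
value at \<open>w0\<close>, so that the factor \<open>norm (f w) powr (1 - s)\<close> can be taken out of the mean value
integral over that ball.\<close>

lemma entire_submean_powr_le_1:
  fixes f :: "complex^'n \<Rightarrow> complex"
  assumes f: "entire f" and s: "0 < s" "s \<le> 1"
    and I: "0 \<le> I" "(\<integral>\<^sup>+w\<in>ball z 1. ennreal (norm (f w) powr s) \<partial>lborel) \<le> ennreal I"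
  shows "norm (f z) powr s * unit_ball_vol (DIM(complex^'n)) \<le> 2 powr (real DIM(complex^'n) / s) * I"
proof -
  have [measurable]: "f \<in> borel_measurable borel" using f by (rule entire_measurable)
  define D where "D = DIM(complex^'n)"
  define V where "V = unit_ball_vol (real D)"
  \<comment> \<open>With this exponent all powers of \<open>r\<close> cancel in the final estimate.\<close>
  define N where "N = real D / s"
  have N: "0 < N" "N * s = real D" using s by (auto simp: N_def D_def)
  have V: "0 < V" by (simp add: V_def unit_ball_vol_pos)
  define d where "d w = 1 - norm (w - z)" for w
  define \<phi> where "\<phi> w = norm (f w) * d w powr N" for w
  have dpos: "0 \<le> d w" if "w \<in> cball z 1" for w
    using that by (simp add: d_def dist_norm norm_minus_commute)
  have "continuous_on (cball z 1) \<phi>"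
    unfolding \<phi>_def using N dpos
    by (intro continuous_intros continuous_on_powr' entire_continuous_on f ballI)
       (auto simp: d_def[abs_def] intro!: continuous_intros)
  then obtain w0 where w0: "w0 \<in> cball z 1" "\<And>w. w \<in> cball z 1 \<Longrightarrow> \<phi> w \<le> \<phi> w0"
    using continuous_attains_sup[of "cball z 1" \<phi>] by auto
  define M where "M = \<phi> w0"
  have fz: "norm (f z) \<le> M"
    using w0(2)[of z] by (simp add: \<phi>_def d_def M_def)
  show ?thesis
  proof (cases "f z = 0")
    case False
    then have M: "0 < M" using fz by (meson less_le_trans zero_less_norm_iff)
    then have "d w0 \<noteq> 0" using N by (auto simp: M_def \<phi>_def)
    then have d0: "0 < d w0" using dpos[OF w0(1)] by simp
    \<comment> \<open>On the ball of radius \<open>r\<close> around \<open>w0\<close> the distance to the sphere is at least \<open>r\<close>.\<close>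
    define r where "r = d w0 / 2"
    have r: "0 < r" "d w0 = 2 * r" using d0 by (auto simp: r_def)
    have inball: "w \<in> ball z 1" "r \<le> d w" if "w \<in> ball w0 r" for w
    proof -
      have "norm (w - z) \<le> norm (w - w0) + norm (w0 - z)"
        using norm_triangle_ineq[of "w - w0" "w0 - z"] by simp
      then show "r \<le> d w" using that r by (simp add: d_def dist_norm norm_minus_commute)
      then show "w \<in> ball z 1" using r by (simp add: d_def dist_norm norm_minus_commute)
    qed
    define K where "K = (M * r powr - N) powr (1 - s)"
    have "norm (f w0) * (unit_ball_vol (DIM(complex^'n)) * r ^ DIM(complex^'n)) \<le> K * I"
    proof (rule entire_submean_bound[OF f r(1), where h="\<lambda>w. norm (f w) powr s"])
      fix w assume w: "w \<in> ball w0 r"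
      have "norm (f w) * r powr N \<le> norm (f w) * d w powr N"
        using inball[OF w] r N by (intro mult_left_mono powr_mono2) auto
      also have "\<dots> \<le> M" using w0(2)[of w] inball(1)[OF w] by (simp add: \<phi>_def M_def)
      finally have "norm (f w) \<le> M * r powr - N"
        using r by (simp add: powr_minus field_simps)
      then have "norm (f w) powr (1 - s) \<le> K"
        unfolding K_def using s by (intro powr_mono2) auto
      then have "norm (f w) powr (1 - s) * norm (f w) powr s \<le> K * norm (f w) powr s"
        by (intro mult_right_mono) auto
      moreover have "norm (f w) powr (1 - s) * norm (f w) powr s = norm (f w)"
        by (simp flip: powr_add)
      ultimately show "norm (f w) \<le> K * norm (f w) powr s" by simp
    next
      have "(\<integral>\<^sup>+w\<in>ball w0 r. ennreal (norm (f w) powr s) \<partial>lborel)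
          \<le> (\<integral>\<^sup>+w\<in>ball z 1. ennreal (norm (f w) powr s) \<partial>lborel)"
        using inball(1) by (intro nn_integral_mono mult_left_mono) (auto simp: indicator_def)
      then show "(\<integral>\<^sup>+w\<in>ball w0 r. ennreal (norm (f w) powr s) \<partial>lborel) \<le> ennreal I"
        using I(2) by (rule order_trans)
    qed (use I in \<open>auto simp: K_def\<close>)
    moreover have "norm (f w0) = M * (2 * r) powr - N"
      using d0 by (simp add: M_def \<phi>_def r(2) powr_minus field_simps)
    ultimately have "M * (2 * r) powr - N * (V * r powr real D) \<le> K * I"
    proof -
      have "r ^ DIM(complex^'n) = r powr real D" using powr_realpow[OF r(1), of D] by (simp only: D_def)
      with \<open>_ \<le> K * I\<close> \<open>norm (f w0) = _\<close> show ?thesis by (simp only: V_def D_def)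
    qed
    moreover have "K = M powr (1 - s) * (r powr - N * r powr real D)"
    proof -
      have "K = M powr (1 - s) * r powr (- N * (1 - s))"
        using M r by (simp add: K_def powr_mult powr_powr)
      also have "- N * (1 - s) = - N + real D" using N by (simp add: algebra_simps)
      finally show ?thesis by (simp only: powr_add)
    qed
    moreover have "(2 * r) powr - N = 2 powr - N * r powr - N"
      using r by (simp add: powr_mult)
    ultimately have "(M * 2 powr - N * V) * (r powr - N * r powr real D) \<le> (M powr (1 - s) * I) * (r powr - N * r powr real D)"
      by (simp add: mult_ac)
    then have "M * 2 powr - N * V \<le> M powr (1 - s) * I"
      using r by (simp add: mult_le_cancel_right)
    moreover have "M = M powr (1 - s) * M powr s"
      using M by (simp flip: powr_add)
    ultimately have "M powr (1 - s) * (M powr s * 2 powr - N * V) \<le> M powr (1 - s) * I"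
      by (metis mult.assoc)
    then have "M powr s * 2 powr - N * V \<le> I"
      using M by (simp add: mult_le_cancel_left)
    then have "M powr s * V \<le> 2 powr N * I"
      by (simp add: powr_minus field_simps)
    moreover have "norm (f z) powr s * V \<le> M powr s * V"
      using fz s V by (intro mult_right_mono powr_mono2) auto
    ultimately have "norm (f z) powr s * V \<le> 2 powr N * I" by linarith
    then show ?thesis by (simp only: V_def N_def D_def)
  qed (use I in simp)
qed

text \<open>For every \<open>l > 0\<close> and \<open>s \<ge> 1\<close> one has \<open>t \<le> l + l powr (1 - s) * t powr s\<close>. With \<open>l\<close> equal to half
the value at the centre, the first summand is absorbed on the left.\<close>

lemma entire_submean_powr_ge_1:
  fixes f :: "complex^'n \<Rightarrow> complex"
  assumes f: "entire f" and s: "1 \<le> s"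
    and I: "0 \<le> I" "(\<integral>\<^sup>+w\<in>ball z 1. ennreal (norm (f w) powr s) \<partial>lborel) \<le> ennreal I"
  shows "norm (f z) powr s * unit_ball_vol (DIM(complex^'n)) \<le> 2 powr s * I"
proof (cases "f z = 0")
  case False
  have [measurable]: "f \<in> borel_measurable borel" "ball z 1 \<in> sets borel"
    using f by (auto intro: entire_measurable)
  define V where "V = unit_ball_vol (real DIM(complex^'n))"
  have V: "0 < V" by (simp add: V_def unit_ball_vol_pos)
  define l where "l = norm (f z) / 2"
  have l: "0 < l" using False by (simp add: l_def)
  have "norm (f z) * (unit_ball_vol (DIM(complex^'n)) * 1 ^ DIM(complex^'n)) \<le> 1 * (l * V + l powr (1 - s) * I)"
  proof (rule entire_submean_bound[OF f, where h="\<lambda>w. l + l powr (1 - s) * norm (f w) powr s"])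
    fix w
    show "norm (f w) \<le> 1 * (l + l powr (1 - s) * norm (f w) powr s)"
    proof (cases "norm (f w) \<le> l")
      case True
      then show ?thesis by (simp add: add_increasing2)
    next
      case False
      then have "l powr (s - 1) \<le> norm (f w) powr (s - 1)" using s l by (intro powr_mono2) auto
      moreover have "norm (f w) = norm (f w) powr (s - 1) * norm (f w) powr (1 - s) * norm (f w)"
        using False l by (simp flip: powr_add)
      moreover have "l powr (1 - s) * norm (f w) powr s
          = l powr (1 - s) * norm (f w) powr (s - 1) * norm (f w)"
        using False l by (simp add: powr_diff)
      moreover have "1 \<le> l powr (1 - s) * norm (f w) powr (s - 1)"
        using mult_left_mono[OF calculation(1), of "l powr (1 - s)"] l by (simp flip: powr_add)
      then have "norm (f w) \<le> l powr (1 - s) * norm (f w) powr (s - 1) * norm (f w)"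
        by (simp add: mult_le_cancel_right1)
      ultimately show ?thesis using l by simp
    qed
    show "0 \<le> l + l powr (1 - s) * norm (f w) powr s" using l by simp
  next
    have "(\<integral>\<^sup>+w\<in>ball z 1. ennreal (l + l powr (1 - s) * norm (f w) powr s) \<partial>lborel)
        = (\<integral>\<^sup>+w. ennreal l * indicator (ball z 1) w + ennreal (l powr (1 - s)) * (ennreal (norm (f w) powr s) * indicator (ball z 1) w) \<partial>lborel)"
      using l by (intro nn_integral_cong) (auto simp: indicator_def ennreal_plus ennreal_mult)
    also have "\<dots> = ennreal l * emeasure lborel (ball z 1) + ennreal (l powr (1 - s)) * (\<integral>\<^sup>+w\<in>ball z 1. ennreal (norm (f w) powr s) \<partial>lborel)"
      by (simp add: nn_integral_add nn_integral_cmult)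
    also have "\<dots> \<le> ennreal l * ennreal V + ennreal (l powr (1 - s)) * ennreal I"
      using I by (intro add_mono mult_left_mono) (simp_all add: emeasure_ball V_def)
    also have "\<dots> = ennreal (l * V + l powr (1 - s) * I)"
      using I l V by (simp add: ennreal_mult ennreal_plus)
    finally show "(\<integral>\<^sup>+w\<in>ball z 1. ennreal (l + l powr (1 - s) * norm (f w) powr s) \<partial>lborel)
        \<le> ennreal (l * V + l powr (1 - s) * I)" .
  qed (use I l V in auto)
  then have "2 * l * V \<le> l * V + l powr (1 - s) * I" by (simp add: l_def V_def)
  then have "l * V \<le> l powr (1 - s) * I" by (simp add: mult.commute)
  then have "l powr (s - 1) * (l * V) \<le> l powr (s - 1) * (l powr (1 - s) * I)"
    by (intro mult_left_mono) auto
  moreover have "l powr (s - 1) * (l powr (1 - s) * I) = I"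
    using l by (simp add: mult.assoc[symmetric] flip: powr_add)
  moreover have "l powr (s - 1) * (l * V) = l powr s * V"
    using l by (simp add: powr_diff)
  ultimately have "l powr s * V \<le> I" by simp
  moreover have "l powr s = norm (f z) powr s / 2 powr s" by (simp add: l_def powr_divide)
  ultimately show ?thesis by (simp add: V_def field_simps)
qed (use I in simp)

lemma entire_submean_powr:
  assumes s: "0 < s"
  shows "\<exists>C>0. \<forall>f z. entire (f :: complex^'n \<Rightarrow> complex) \<longrightarrow>
    ennreal (norm (f z) powr s) \<le> ennreal C * (\<integral>\<^sup>+w\<in>ball z 1. ennreal (norm (f w) powr s) \<partial>lborel)"
proof -
  define V where "V = unit_ball_vol (real DIM(complex^'n))"
  have V: "0 < V" by (simp add: V_def unit_ball_vol_pos)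
  define A where "A = max (2 powr (real DIM(complex^'n) / s)) (2 powr s)"
  have A: "0 < A" by (simp add: A_def less_max_iff_disj)
  show ?thesis
  proof (intro exI[of _ "A / V"] conjI allI impI)
    show "0 < A / V" using A V by simp
    fix f :: "complex^'n \<Rightarrow> complex" and z assume f: "entire f"
    define J where "J = (\<integral>\<^sup>+w\<in>ball z 1. ennreal (norm (f w) powr s) \<partial>lborel)"
    show "ennreal (norm (f z) powr s) \<le> ennreal (A / V) * J"
    proof (cases J)
      case (real I)
      then have I: "0 \<le> I" "(\<integral>\<^sup>+w\<in>ball z 1. ennreal (norm (f w) powr s) \<partial>lborel) \<le> ennreal I"
        by (auto simp: J_def)
      have "norm (f z) powr s * V \<le> A * I"
      proof (cases "s \<le> 1")
        case True
        have "norm (f z) powr s * V \<le> 2 powr (real DIM(complex^'n) / s) * I"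
          unfolding V_def by (rule entire_submean_powr_le_1[OF f s True I])
        also have "\<dots> \<le> A * I" using I by (intro mult_right_mono) (auto simp: A_def)
        finally show ?thesis .
      next
        case False
        then have "norm (f z) powr s * V \<le> 2 powr s * I"
          unfolding V_def by (intro entire_submean_powr_ge_1[OF f _ I]) simp
        also have "\<dots> \<le> A * I" using I by (intro mult_right_mono) (auto simp: A_def)
        finally show ?thesis .
      qed
      then have "norm (f z) powr s \<le> A / V * I" using V by (simp add: field_simps)
      then have "ennreal (norm (f z) powr s) \<le> ennreal (A / V * I)" by (rule ennreal_leI)
      moreover have "ennreal (A / V) * J = ennreal (A / V * I)"
        using real A V by (subst ennreal_mult) auto
      ultimately show ?thesis by (simp only:)
    next
      case top
      then show ?thesis using A V by (simp add: ennreal_mult_top)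
    qed
  qed
qed

section \<open>Weighted integrals of entire functions\<close>

text \<open>The weight \<open>(1 + norm z) ^ k\<close> changes only by a bounded factor on unit balls, unlike
\<open>norm z ^ k\<close>.\<close>

definition wmod :: "real \<Rightarrow> nat \<Rightarrow> (complex^'n \<Rightarrow> complex) \<Rightarrow> complex^'n \<Rightarrow> real" where
  "wmod \<alpha> k f z = (1 + norm z) ^ k * norm (f z) * exp (- (\<alpha> / 2) * (norm z)\<^sup>2)"

definition energy :: "real \<Rightarrow> real \<Rightarrow> nat \<Rightarrow> (complex^'n \<Rightarrow> complex) \<Rightarrow> ennreal" where
  "energy \<alpha> s k f = (\<integral>\<^sup>+z. ennreal (wmod \<alpha> k f z powr s) \<partial>lborel)"

lemma wmod_nonneg [simp]: "0 \<le> wmod \<alpha> k f z"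
  by (simp add: wmod_def)

lemma wmod_measurable [measurable]:
  fixes f :: "complex^'n \<Rightarrow> complex"
  shows "f \<in> borel_measurable borel \<Longrightarrow> wmod \<alpha> k f \<in> borel_measurable borel"
proof -
  assume [measurable]: "f \<in> borel_measurable borel"
  have [measurable]: "(\<lambda>z::complex^'n. (1 + norm z) ^ k * exp (- (\<alpha> / 2) * (norm z)\<^sup>2)) \<in> borel_measurable borel"
    by (intro borel_measurable_continuous_onI continuous_intros)
  have "(\<lambda>z. ((1 + norm z) ^ k * exp (- (\<alpha> / 2) * (norm z)\<^sup>2)) * norm (f z)) \<in> borel_measurable borel"
    by (rule borel_measurable_times) measurable
  then show "wmod \<alpha> k f \<in> borel_measurable borel"
    unfolding wmod_def[abs_def] by (simp only: mult_ac)
qed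

lemma wmod_mono: "j \<le> k \<Longrightarrow> wmod \<alpha> j f z \<le> wmod \<alpha> k f z"
  unfolding wmod_def by (intro mult_right_mono power_increasing) auto

lemma norm_le_wmod:
  assumes "0 \<le> \<alpha>" "norm z \<le> R"
  shows "norm (f z) \<le> exp (\<alpha> / 2 * R\<^sup>2) * wmod \<alpha> k f z"
proof -
  have "(norm z)\<^sup>2 \<le> R\<^sup>2" using assms by (intro power_mono) auto
  then have "\<alpha> / 2 * (norm z)\<^sup>2 \<le> \<alpha> / 2 * R\<^sup>2" using assms by (intro mult_left_mono) auto
  then have "1 \<le> exp (\<alpha> / 2 * R\<^sup>2) * exp (- (\<alpha> / 2) * (norm z)\<^sup>2)" by (simp flip: exp_add)
  moreover have "1 \<le> (1 + norm z) ^ k" by (intro one_le_power) simp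
  ultimately have "1 * 1 \<le> (exp (\<alpha> / 2 * R\<^sup>2) * exp (- (\<alpha> / 2) * (norm z)\<^sup>2)) * (1 + norm z) ^ k"
    by (intro mult_mono) auto
  then have "1 * norm (f z) \<le> ((exp (\<alpha> / 2 * R\<^sup>2) * exp (- (\<alpha> / 2) * (norm z)\<^sup>2)) * (1 + norm z) ^ k) * norm (f z)"
    by (intro mult_right_mono) auto
  then show ?thesis by (simp add: wmod_def mult_ac)
qed

lemma energy_mono: "j \<le> k \<Longrightarrow> 0 \<le> s \<Longrightarrow> energy \<alpha> s j f \<le> energy \<alpha> s k f"
  unfolding energy_def by (intro nn_integral_mono ennreal_leI powr_mono2 wmod_mono) auto

lemma norm_vec_power2: "(norm (z :: complex^'n))\<^sup>2 = (\<Sum>i\<in>UNIV. (norm (z $ i))\<^sup>2)"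
  by (simp add: norm_vec_def L2_set_def sum_nonneg)

lemma norm_diff_power2_cdot:
  "(norm (w - z))\<^sup>2 = (norm w)\<^sup>2 + (norm z)\<^sup>2 - 2 * Re (cdot w (z :: complex^'n))"
proof -
  have "(norm (a - b))\<^sup>2 = (norm a)\<^sup>2 + (norm b)\<^sup>2 - 2 * Re (a * cnj b)" for a b :: complex
    unfolding cmod_power2 by (simp add: power2_eq_square algebra_simps)
  then show ?thesis
    by (simp add: norm_vec_power2 cdot_def sum.distrib sum_subtractf sum_distrib_left)
qed

lemma cdot_self: "cdot z z = of_real ((norm (z :: complex^'n))\<^sup>2)"
  unfolding cdot_def norm_vec_power2 by (simp add: complex_norm_square del: of_real_power)

lemma has_derivative_exp_cdot:
  "((\<lambda>w. exp (c * cdot w a + d)) has_derivative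
     (\<lambda>v. \<Sum>i\<in>UNIV. v $ i * (c * cnj (a $ i) * exp (c * cdot z a + d)))) (at (z :: complex^'n))"
proof -
  have "((\<lambda>w. c * cdot w a + d) has_derivative (\<lambda>v. c * cdot v a)) (at z)"
  proof -
    have "((\<lambda>w. cdot w a) has_derivative (\<lambda>v. cdot v a)) (at z)"
      unfolding cdot_def
      by (intro has_derivative_sum has_derivative_mult_left bounded_linear.has_derivative[OF bounded_linear_vec_nth]
          has_derivative_ident)
    from has_derivative_add[OF has_derivative_mult_right[OF this, of c] has_derivative_const]
    show ?thesis by simp
  qed
  from has_derivative_compose[OF this DERIV_exp[THEN has_field_derivative_imp_has_derivative]]
  show ?thesis
    by (rule has_derivative_eq_rhs) (simp add: fun_eq_iff cdot_def sum_distrib_left sum_distrib_right mult_ac)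
qed

lemma entire_exp_cdot: "entire (\<lambda>w :: complex^'n. exp (c * cdot w a + d))"
  unfolding entire_iff_partials
proof
  show "\<exists>e. ((\<lambda>w. exp (c * cdot w a + d)) has_derivative (\<lambda>v. \<Sum>i\<in>UNIV. v $ i * e i)) (at z)" for z
    using has_derivative_exp_cdot[of c a d z]
    by (rule exI[of _ "\<lambda>i. c * cnj (a $ i) * exp (c * cdot z a + d)"])
qed

text \<open>The exponential factor turns the Gaussian weight centred at the origin into one centred at \<open>z\<close>,
so that weighted estimates at \<open>z\<close> follow from unweighted ones. The summand \<open>0\<close> makes the
exponent an instance of the general affine exponent of \<open>entire_exp_cdot\<close>.\<close>

definition modulate :: "real \<Rightarrow> complex^'n \<Rightarrow> (complex^'n \<Rightarrow> complex) \<Rightarrow> complex^'n \<Rightarrow> complex" where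
  "modulate \<alpha> z f w = f w * exp (- of_real \<alpha> * cdot w z + 0)"

lemma entire_modulate: "entire f \<Longrightarrow> entire (modulate \<alpha> z f)"
  unfolding modulate_def[abs_def] by (intro entire_mult entire_exp_cdot)

lemma norm_modulate:
  "norm (modulate \<alpha> z f w) * exp (\<alpha> / 2 * (norm z)\<^sup>2) =
   norm (f w) * exp (- (\<alpha> / 2) * (norm w)\<^sup>2) * exp (\<alpha> / 2 * (norm (w - z))\<^sup>2)"
  unfolding norm_diff_power2_cdot modulate_def
  by (simp add: norm_mult norm_exp_eq_Re algebra_simps flip: exp_add)

lemma cpartial_modulate:
  assumes f: "entire f"
  shows "norm (cpartial i (modulate \<alpha> z f) z) * exp (\<alpha> / 2 * (norm z)\<^sup>2) =
    norm (cpartial i f z - of_real \<alpha> * cnj (z $ i) * f z) * exp (- (\<alpha> / 2) * (norm z)\<^sup>2)"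
proof -
  let ?e = "exp (- of_real \<alpha> * cdot z z + 0)"
  have "cpartial i (modulate \<alpha> z f) z = (cpartial i f z - of_real \<alpha> * cnj (z $ i) * f z) * ?e"
    unfolding modulate_def[abs_def]
  proof (rule cpartial_unique)
    show "((\<lambda>w. f w * exp (- of_real \<alpha> * cdot w z + 0)) has_derivative
        (\<lambda>v. \<Sum>i\<in>UNIV. v $ i * ((cpartial i f z - of_real \<alpha> * cnj (z $ i) * f z) * ?e))) (at z)"
      by (rule has_derivative_eq_rhs[OF has_derivative_mult[OF entire_has_derivative[OF f] has_derivative_exp_cdot]])
        (simp add: fun_eq_iff sum_distrib_left sum_distrib_right algebra_simps flip: sum.distrib)
  qed
  moreover have "norm ?e * exp (\<alpha> / 2 * (norm z)\<^sup>2) = exp (- (\<alpha> / 2) * (norm z)\<^sup>2)"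
    by (simp add: norm_exp_eq_Re cdot_self flip: exp_add)
  ultimately show ?thesis by (simp add: norm_mult mult.assoc)
qed

text \<open>The sub-mean value inequality for the modulated function. The point \<open>v\<close> is allowed to differ from
the centre \<open>z\<close> of the modulation because Cauchy's estimate for the derivative at \<open>z\<close> needs a bound
on a neighbourhood of \<open>z\<close>.\<close>

lemma modulate_submean:
  fixes \<alpha> s :: real and k :: nat
  assumes "0 \<le> \<alpha>" "0 < s"
  shows "\<exists>C>0. \<forall>f z v. entire (f :: complex^'n \<Rightarrow> complex) \<longrightarrow> v \<in> cball z 1 \<longrightarrow>
    ennreal (((1 + norm z) ^ k * (norm (modulate \<alpha> z f v) * exp (\<alpha> / 2 * (norm z)\<^sup>2))) powr s)
      \<le> ennreal C * (\<integral>\<^sup>+w\<in>ball v 1. ennreal (wmod \<alpha> k f w powr s) \<partial>lborel)"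
proof -
  obtain C0 where C0: "0 < C0" "\<And>f z. entire (f :: complex^'n \<Rightarrow> complex) \<Longrightarrow>
    ennreal (norm (f z) powr s) \<le> ennreal C0 * (\<integral>\<^sup>+w\<in>ball z 1. ennreal (norm (f w) powr s) \<partial>lborel)"
    using entire_submean_powr[OF assms(2), where 'n='n] by blast
  define L where "L = 3 ^ k * exp (2 * \<alpha>)"
  have L: "0 < L" by (simp add: L_def)
  show ?thesis
  proof (intro exI[of _ "C0 * L powr s"] conjI allI impI)
    show "0 < C0 * L powr s" using C0 L by simp
    fix f :: "complex^'n \<Rightarrow> complex" and z v :: "complex^'n"
    assume f: "entire f" and v: "v \<in> cball z 1"
    have [measurable]: "f \<in> borel_measurable borel" using f by (rule entire_measurable)
    have [measurable]: "modulate \<alpha> z f \<in> borel_measurable borel"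
      using f by (intro entire_measurable entire_modulate)
    have [measurable]: "ball v 1 \<in> sets borel" by simp
    define A where "A = (1 + norm z) ^ k * exp (\<alpha> / 2 * (norm z)\<^sup>2)"
    have A: "0 < A" by (simp add: A_def add_pos_nonneg)
    have le: "A * norm (modulate \<alpha> z f w) \<le> L * wmod \<alpha> k f w" if w: "w \<in> ball v 1" for w
    proof -
      have "norm (w - z) \<le> norm (w - v) + norm (v - z)"
        using norm_triangle_ineq[of "w - v" "v - z"] by simp
      then have wz: "norm (w - z) \<le> 2" using v w by (simp add: dist_norm norm_minus_commute)
      have "1 + norm z \<le> 3 * (1 + norm w)"
        using wz norm_triangle_sub[of z w] norm_ge_zero[of w]
        by (simp only: norm_minus_commute[of z w]) argo
      then have "(1 + norm z) ^ k \<le> 3 ^ k * (1 + norm w) ^ k"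
        by (simp flip: power_mult_distrib add: power_mono)
      moreover have "exp (\<alpha> / 2 * (norm (w - z))\<^sup>2) \<le> exp (2 * \<alpha>)"
      proof -
        have "\<alpha> / 2 * (norm (w - z))\<^sup>2 \<le> \<alpha> / 2 * 2\<^sup>2"
          using wz assms by (intro mult_left_mono power_mono) auto
        then show ?thesis by simp
      qed
      moreover have "A * norm (modulate \<alpha> z f w) =
          (1 + norm z) ^ k * (norm (f w) * exp (- (\<alpha> / 2) * (norm w)\<^sup>2) * exp (\<alpha> / 2 * (norm (w - z))\<^sup>2))"
        unfolding norm_modulate[symmetric] A_def by (simp add: mult_ac)
      ultimately have "A * norm (modulate \<alpha> z f w) \<le>
          (3 ^ k * (1 + norm w) ^ k) * (norm (f w) * exp (- (\<alpha> / 2) * (norm w)\<^sup>2) * exp (2 * \<alpha>))"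
        by (auto intro!: mult_mono mult_left_mono)
      then show ?thesis by (simp add: L_def wmod_def mult_ac)
    qed
    have "ennreal ((A * norm (modulate \<alpha> z f v)) powr s) = ennreal (A powr s) * ennreal (norm (modulate \<alpha> z f v) powr s)"
      using A by (simp add: powr_mult ennreal_mult)
    also have "\<dots> \<le> ennreal (A powr s) * (ennreal C0 * (\<integral>\<^sup>+w\<in>ball v 1. ennreal (norm (modulate \<alpha> z f w) powr s) \<partial>lborel))"
      using f by (intro mult_left_mono C0 entire_modulate) auto
    also have "\<dots> = ennreal C0 * (\<integral>\<^sup>+w. ennreal (A powr s) * (ennreal (norm (modulate \<alpha> z f w) powr s) * indicator (ball v 1) w) \<partial>lborel)"
      by (subst nn_integral_cmult) (simp_all add: mult_ac)
    also have "\<dots> \<le> ennreal C0 * (\<integral>\<^sup>+w. ennreal (L powr s) * (ennreal (wmod \<alpha> k f w powr s) * indicator (ball v 1) w) \<partial>lborel)"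
    proof (intro mult_left_mono nn_integral_mono)
      fix w
      have "(A * norm (modulate \<alpha> z f w)) powr s \<le> (L * wmod \<alpha> k f w) powr s" if "w \<in> ball v 1"
        using le[OF that] A assms by (intro powr_mono2) auto
      then show "ennreal (A powr s) * (ennreal (norm (modulate \<alpha> z f w) powr s) * indicator (ball v 1) w)
          \<le> ennreal (L powr s) * (ennreal (wmod \<alpha> k f w powr s) * indicator (ball v 1) w)"
        using A L by (auto simp: indicator_def powr_mult ennreal_leI simp flip: ennreal_mult)
    qed simp
    also have "\<dots> = ennreal C0 * (ennreal (L powr s) * (\<integral>\<^sup>+w\<in>ball v 1. ennreal (wmod \<alpha> k f w powr s) \<partial>lborel))"
      by (subst nn_integral_cmult) simp_all
    also have "\<dots> = ennreal (C0 * L powr s) * (\<integral>\<^sup>+w\<in>ball v 1. ennreal (wmod \<alpha> k f w powr s) \<partial>lborel)"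
      using C0 by (simp add: ennreal_mult mult_ac)
    finally show "ennreal (((1 + norm z) ^ k * (norm (modulate \<alpha> z f v) * exp (\<alpha> / 2 * (norm z)\<^sup>2))) powr s)
      \<le> ennreal (C0 * L powr s) * (\<integral>\<^sup>+w\<in>ball v 1. ennreal (wmod \<alpha> k f w powr s) \<partial>lborel)"
      by (simp add: A_def mult_ac)
  qed
qed

lemma wmod_submean:
  fixes \<alpha> s :: real and k :: nat
  assumes "0 \<le> \<alpha>" "0 < s"
  shows "\<exists>C>0. \<forall>f z. entire (f :: complex^'n \<Rightarrow> complex) \<longrightarrow>
    ennreal (wmod \<alpha> k f z powr s) \<le> ennreal C * (\<integral>\<^sup>+w\<in>ball z 1. ennreal (wmod \<alpha> k f w powr s) \<partial>lborel)"
proof -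
  obtain C where C: "0 < C" "\<And>f z v. entire (f :: complex^'n \<Rightarrow> complex) \<Longrightarrow> v \<in> cball z 1 \<Longrightarrow>
    ennreal (((1 + norm z) ^ k * (norm (modulate \<alpha> z f v) * exp (\<alpha> / 2 * (norm z)\<^sup>2))) powr s)
      \<le> ennreal C * (\<integral>\<^sup>+w\<in>ball v 1. ennreal (wmod \<alpha> k f w powr s) \<partial>lborel)"
    using modulate_submean[OF assms, where 'n='n and k=k] by blast
  show ?thesis
  proof (intro exI[of _ C] conjI allI impI C(1))
    fix f :: "complex^'n \<Rightarrow> complex" and z assume "entire f"
    then show "ennreal (wmod \<alpha> k f z powr s) \<le> ennreal C * (\<integral>\<^sup>+w\<in>ball z 1. ennreal (wmod \<alpha> k f w powr s) \<partial>lborel)"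
      using C(2)[of f z z] unfolding norm_modulate by (simp add: wmod_def mult_ac)
  qed
qed

lemma wmod_le_energy:
  fixes \<alpha> s :: real and k :: nat
  assumes "0 \<le> \<alpha>" "0 < s"
  shows "\<exists>C>0. \<forall>f z. entire (f :: complex^'n \<Rightarrow> complex) \<longrightarrow>
    ennreal (wmod \<alpha> k f z powr s) \<le> ennreal C * energy \<alpha> s k f"
proof -
  obtain C where C: "0 < C" "\<And>f z. entire (f :: complex^'n \<Rightarrow> complex) \<Longrightarrow>
    ennreal (wmod \<alpha> k f z powr s) \<le> ennreal C * (\<integral>\<^sup>+w\<in>ball z 1. ennreal (wmod \<alpha> k f w powr s) \<partial>lborel)"
    using wmod_submean[OF assms, where 'n='n and k=k] by blast
  show ?thesis
  proof (intro exI[of _ C] conjI allI impI C(1))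
    fix f :: "complex^'n \<Rightarrow> complex" and z assume "entire f"
    moreover have "(\<integral>\<^sup>+w\<in>ball z 1. ennreal (wmod \<alpha> k f w powr s) \<partial>lborel) \<le> energy \<alpha> s k f"
      unfolding energy_def by (intro nn_integral_mono) (auto simp: indicator_def)
    ultimately show "ennreal (wmod \<alpha> k f z powr s) \<le> ennreal C * energy \<alpha> s k f"
      using C(2)[of f z] by (meson mult_left_mono order_trans zero_le)
  qed
qed

text \<open>The product rule gives exactly this operator as the derivative of \<open>modulate \<alpha> z f\<close> at its centre,
up to an exponential factor. It is therefore controlled by \<open>f\<close> alone, and \<open>\<partial>\<^sub>i f\<close> and
\<open>\<alpha> * cnj z\<^sub>i * f\<close> have the same integrability whenever \<open>f\<close> is integrable.\<close>

definition twisted_partial where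
  "twisted_partial \<alpha> i f z = cpartial i f z - of_real \<alpha> * cnj (z $ i) * f z"

lemma twisted_partial_measurable [measurable]:
  assumes "entire f" shows "twisted_partial \<alpha> i f \<in> borel_measurable borel"
proof -
  have [measurable]: "f \<in> borel_measurable borel" "cpartial i f \<in> borel_measurable borel"
    using assms by (auto intro: entire_measurable entire_cpartial)
  have [measurable]: "(\<lambda>z. cnj (z $ i)) \<in> borel_measurable borel"
    by (intro borel_measurable_continuous_onI continuous_intros)
  show ?thesis unfolding twisted_partial_def by measurable
qed

text \<open>Cauchy's estimate on the unit ball around \<open>z\<close>, each value being bounded by \<open>modulate_submean\<close>.\<close>

lemma wmod_twisted_le:
  fixes \<alpha> s :: real and k :: nat
  assumes "0 \<le> \<alpha>" "0 < s"
  shows "\<exists>C>0. \<forall>f z i. entire (f :: complex^'n \<Rightarrow> complex) \<longrightarrow>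
    ennreal (wmod \<alpha> k (twisted_partial \<alpha> i f) z powr s)
      \<le> ennreal C * (\<integral>\<^sup>+w\<in>ball z 2. ennreal (wmod \<alpha> k f w powr s) \<partial>lborel)"
proof -
  obtain C where C: "0 < C" "\<And>f z v. entire (f :: complex^'n \<Rightarrow> complex) \<Longrightarrow> v \<in> cball z 1 \<Longrightarrow>
    ennreal (((1 + norm z) ^ k * (norm (modulate \<alpha> z f v) * exp (\<alpha> / 2 * (norm z)\<^sup>2))) powr s)
      \<le> ennreal C * (\<integral>\<^sup>+w\<in>ball v 1. ennreal (wmod \<alpha> k f w powr s) \<partial>lborel)"
    using modulate_submean[OF assms, where 'n='n and k=k] by blast
  show ?thesis
  proof (intro exI[of _ C] conjI allI impI C(1))
    fix f :: "complex^'n \<Rightarrow> complex" and z i assume f: "entire f"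
    define J where "J = (\<integral>\<^sup>+w\<in>ball z 2. ennreal (wmod \<alpha> k f w powr s) \<partial>lborel)"
    show "ennreal (wmod \<alpha> k (twisted_partial \<alpha> i f) z powr s) \<le> ennreal C * J"
    proof (cases J)
      case (real I)
      define A where "A = (1 + norm z) ^ k * exp (\<alpha> / 2 * (norm z)\<^sup>2)"
      have A: "0 < A" by (simp add: A_def add_pos_nonneg)
      define B where "B = (C * I) powr (1 / s)"
      have bound: "norm (modulate \<alpha> z f v) \<le> B / A" if v: "v \<in> cball z 1" for v
      proof -
        have sub: "w \<in> ball z 2" if "w \<in> ball v 1" for w
          using v that dist_triangle[of z w v] by simp
        have "ennreal ((A * norm (modulate \<alpha> z f v)) powr s)
            \<le> ennreal C * (\<integral>\<^sup>+w\<in>ball v 1. ennreal (wmod \<alpha> k f w powr s) \<partial>lborel)"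
          using C(2)[OF f v] by (simp add: A_def mult_ac)
        also have "\<dots> \<le> ennreal C * J"
          unfolding J_def using sub
          by (intro mult_left_mono nn_integral_mono) (auto simp: indicator_def)
        also have "\<dots> = ennreal (C * I)" using C(1) real by (simp add: ennreal_mult)
        finally have "(A * norm (modulate \<alpha> z f v)) powr s \<le> C * I"
          using C(1) real by (simp add: ennreal_le_iff)
        then have "A * norm (modulate \<alpha> z f v) \<le> B"
          unfolding B_def using assms A by (intro powr_le_imp_le_root) auto
        then show ?thesis using A by (simp add: field_simps)
      qed
      have "norm (cpartial i (modulate \<alpha> z f) z) \<le> B / A"
        by (rule norm_cpartial_le[OF entire_modulate[OF f] bound])
      then have "A * norm (cpartial i (modulate \<alpha> z f) z) \<le> B" using A by (simp add: field_simps)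
      moreover have "A * norm (cpartial i (modulate \<alpha> z f) z) = wmod \<alpha> k (twisted_partial \<alpha> i f) z"
        using cpartial_modulate[OF f, of i \<alpha> z] by (simp add: A_def wmod_def twisted_partial_def mult_ac)
      ultimately have "wmod \<alpha> k (twisted_partial \<alpha> i f) z powr s \<le> B powr s"
        using assms by (intro powr_mono2) auto
      also have "B powr s = C * I" using assms C(1) real by (simp add: B_def powr_powr)
      finally show ?thesis
        using C(1) real by (simp add: ennreal_leI flip: ennreal_mult)
    next
      case top
      then show ?thesis using C(1) by (simp add: ennreal_mult_top)
    qed
  qed
qed

lemma nn_integral_ball_average:
  fixes F :: "'a::euclidean_space \<Rightarrow> ennreal"
  assumes [measurable]: "F \<in> borel_measurable borel"
  shows "(\<integral>\<^sup>+z. (\<integral>\<^sup>+w\<in>ball z r. F w \<partial>lborel) \<partial>lborel) = emeasure lborel (ball (0::'a) r) * (\<integral>\<^sup>+w. F w \<partial>lborel)"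
proof -
  have "(\<integral>\<^sup>+z. (\<integral>\<^sup>+w\<in>ball z r. F w \<partial>lborel) \<partial>lborel)
      = (\<integral>\<^sup>+z. (\<integral>\<^sup>+w. F w * (if norm (w - z) < r then 1 else 0) \<partial>lborel) \<partial>lborel)"
    by (intro nn_integral_cong) (auto simp: indicator_def dist_norm norm_minus_commute)
  also have "\<dots> = (\<integral>\<^sup>+w. (\<integral>\<^sup>+z. F w * (if norm (w - z) < r then 1 else 0) \<partial>lborel) \<partial>lborel)"
    by (rule lborel_pair.Fubini') measurable
  also have "\<dots> = (\<integral>\<^sup>+w. F w * emeasure lborel (ball (0::'a) r) \<partial>lborel)"
  proof (rule nn_integral_cong)
    fix w :: 'a
    have "(\<integral>\<^sup>+z. (if norm (w - z) < r then 1 else 0) \<partial>lborel) = (\<integral>\<^sup>+z. indicator (ball w r) z \<partial>lborel)"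
      by (intro nn_integral_cong) (simp add: indicator_def dist_norm)
    also have "\<dots> = emeasure lborel (ball (0::'a) r)"
      by (cases "0 \<le> r") (simp_all add: emeasure_ball ball_empty)
    finally show "(\<integral>\<^sup>+z. F w * (if norm (w - z) < r then 1 else 0) \<partial>lborel) = F w * emeasure lborel (ball (0::'a) r)"
      by (subst nn_integral_cmult) auto
  qed
  also have "\<dots> = emeasure lborel (ball (0::'a) r) * (\<integral>\<^sup>+w. F w \<partial>lborel)"
    by (simp add: nn_integral_multc mult.commute)
  finally show ?thesis .
qed

lemma energy_twisted_finite:
  fixes f :: "complex^'n \<Rightarrow> complex"
  assumes "0 \<le> \<alpha>" "0 < s" and f: "entire f" and fin: "energy \<alpha> s k f < \<infinity>"
  shows "energy \<alpha> s k (twisted_partial \<alpha> i f) < \<infinity>"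
proof -
  have [measurable]: "f \<in> borel_measurable borel" using f by (rule entire_measurable)
  obtain C where C: "0 < C" "\<And>z. ennreal (wmod \<alpha> k (twisted_partial \<alpha> i f) z powr s)
      \<le> ennreal C * (\<integral>\<^sup>+w\<in>ball z 2. ennreal (wmod \<alpha> k f w powr s) \<partial>lborel)"
    using wmod_twisted_le[OF assms(1,2), where 'n='n and k=k] f by blast
  have [measurable]: "(\<lambda>z. \<integral>\<^sup>+w\<in>ball z 2. ennreal (wmod \<alpha> k f w powr s) \<partial>lborel) \<in> borel_measurable borel"
  proof -
    have "(\<lambda>z. \<integral>\<^sup>+w. ennreal (wmod \<alpha> k f w powr s) * (if norm (w - z) < 2 then 1 else 0) \<partial>lborel) \<in> borel_measurable borel"
      by measurable
    then show ?thesis by (simp add: indicator_def dist_norm norm_minus_commute)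
  qed
  have "energy \<alpha> s k (twisted_partial \<alpha> i f)
      \<le> (\<integral>\<^sup>+z. ennreal C * (\<integral>\<^sup>+w\<in>ball z 2. ennreal (wmod \<alpha> k f w powr s) \<partial>lborel) \<partial>lborel)"
    unfolding energy_def by (intro nn_integral_mono C)
  also have "\<dots> = ennreal C * (emeasure lborel (ball (0::complex^'n) 2) * energy \<alpha> s k f)"
    unfolding energy_def by (subst nn_integral_cmult) (simp_all add: nn_integral_ball_average)
  also have "\<dots> < \<infinity>"
    using fin by (simp add: emeasure_ball ennreal_mult_less_top)
  finally show ?thesis .
qed

lemma nn_integral_powr_add_finite:
  fixes h1 h2 :: "'a \<Rightarrow> real"
  assumes [measurable]: "h1 \<in> borel_measurable M" "h2 \<in> borel_measurable M"
    and "0 \<le> s" and nn: "\<And>x. 0 \<le> h1 x" "\<And>x. 0 \<le> h2 x"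
    and fin: "(\<integral>\<^sup>+x. ennreal (h1 x powr s) \<partial>M) < \<infinity>" "(\<integral>\<^sup>+x. ennreal (h2 x powr s) \<partial>M) < \<infinity>"
  shows "(\<integral>\<^sup>+x. ennreal ((h1 x + h2 x) powr s) \<partial>M) < \<infinity>"
proof -
  have "(\<integral>\<^sup>+x. ennreal ((h1 x + h2 x) powr s) \<partial>M)
      \<le> (\<integral>\<^sup>+x. ennreal (2 powr s) * (ennreal (h1 x powr s) + ennreal (h2 x powr s)) \<partial>M)"
    using nn assms(3)
    by (intro nn_integral_mono) (simp add: ennreal_leI powr_add_le flip: ennreal_mult ennreal_plus)
  also have "\<dots> = ennreal (2 powr s) * ((\<integral>\<^sup>+x. ennreal (h1 x powr s) \<partial>M) + (\<integral>\<^sup>+x. ennreal (h2 x powr s) \<partial>M))"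
    by (simp add: nn_integral_cmult nn_integral_add)
  also have "\<dots> < \<infinity>" using fin by (simp add: ennreal_mult_less_top)
  finally show ?thesis .
qed

lemma nn_integral_powr_sum_finite:
  fixes h :: "'i \<Rightarrow> 'a \<Rightarrow> real"
  assumes "finite J" "0 < s" and [measurable]: "\<And>j. j \<in> J \<Longrightarrow> h j \<in> borel_measurable M"
    and "\<And>j x. j \<in> J \<Longrightarrow> 0 \<le> h j x"
    and "\<And>j. j \<in> J \<Longrightarrow> (\<integral>\<^sup>+x. ennreal (h j x powr s) \<partial>M) < \<infinity>"
  shows "(\<integral>\<^sup>+x. ennreal ((\<Sum>j\<in>J. h j x) powr s) \<partial>M) < \<infinity>"
  using assms
proof (induction J)
  case (insert j J)
  then have "(\<integral>\<^sup>+x. ennreal ((h j x + (\<Sum>j\<in>J. h j x)) powr s) \<partial>M) < \<infinity>"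
    by (intro nn_integral_powr_add_finite) (auto intro: sum_nonneg)
  then show ?case using insert by simp
qed simp

lemma nn_integral_powr_mono_finite:
  fixes h1 h2 :: "'a \<Rightarrow> real"
  assumes "0 \<le> s" "\<And>x. 0 \<le> h1 x" "\<And>x. h1 x \<le> h2 x" "(\<integral>\<^sup>+x. ennreal (h2 x powr s) \<partial>M) < \<infinity>"
  shows "(\<integral>\<^sup>+x. ennreal (h1 x powr s) \<partial>M) < \<infinity>"
proof -
  have "(\<integral>\<^sup>+x. ennreal (h1 x powr s) \<partial>M) \<le> (\<integral>\<^sup>+x. ennreal (h2 x powr s) \<partial>M)"
    using assms by (intro nn_integral_mono ennreal_leI powr_mono2)
  then show ?thesis using assms(4) by (rule le_less_trans)
qed

lemma nn_integral_powr_cmult_finite: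
  fixes h :: "'a \<Rightarrow> real"
  assumes [measurable]: "h \<in> borel_measurable M" and "0 \<le> c" "\<And>x. 0 \<le> h x" "(\<integral>\<^sup>+x. ennreal (h x powr s) \<partial>M) < \<infinity>"
  shows "(\<integral>\<^sup>+x. ennreal ((c * h x) powr s) \<partial>M) < \<infinity>"
  using assms by (simp add: powr_mult ennreal_mult nn_integral_cmult ennreal_mult_less_top)

text \<open>Since \<open>\<partial>\<^sub>i f = twisted_partial \<alpha> i f + \<alpha> * cnj z\<^sub>i * f\<close>, one derivative costs one power of the
weight.\<close>

lemma energy_cpartial_finite:
  fixes f :: "complex^'n \<Rightarrow> complex"
  assumes \<alpha>: "0 < \<alpha>" and s: "0 < s" and f: "entire f" and fin: "energy \<alpha> s (Suc k) f < \<infinity>"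
  shows "energy \<alpha> s k (cpartial i f) < \<infinity>"
proof -
  have [measurable]: "f \<in> borel_measurable borel" using f by (rule entire_measurable)
  note [measurable] = twisted_partial_measurable[OF f]
  have "energy \<alpha> s k f < \<infinity>"
    using energy_mono[of k "Suc k" s \<alpha> f] fin s by (simp add: le_less_trans)
  then have "energy \<alpha> s k (twisted_partial \<alpha> i f) < \<infinity>"
    using \<alpha> s f by (intro energy_twisted_finite) auto
  then have "(\<integral>\<^sup>+z. ennreal ((wmod \<alpha> k (twisted_partial \<alpha> i f) z + \<alpha> * wmod \<alpha> (Suc k) f z) powr s) \<partial>lborel) < \<infinity>"
    using \<alpha> s fin unfolding energy_def
    by (intro nn_integral_powr_add_finite nn_integral_powr_cmult_finite) auto
  then show ?thesis
    unfolding energy_def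
  proof (rule nn_integral_powr_mono_finite[rotated 3])
    fix z :: "complex^'n"
    let ?c = "(1 + norm z) ^ k * exp (- (\<alpha> / 2) * (norm z)\<^sup>2)"
    have "norm (cpartial i f z) \<le> norm (twisted_partial \<alpha> i f z) + \<alpha> * norm (z $ i) * norm (f z)"
      using norm_triangle_ineq[of "twisted_partial \<alpha> i f z" "of_real \<alpha> * cnj (z $ i) * f z"] \<alpha>
      by (simp add: twisted_partial_def norm_mult)
    also have "\<dots> \<le> norm (twisted_partial \<alpha> i f z) + \<alpha> * (1 + norm z) * norm (f z)"
      using \<alpha> Finite_Cartesian_Product.norm_nth_le[of z i]
      by (intro add_left_mono mult_right_mono mult_left_mono) auto
    finally have "?c * norm (cpartial i f z) \<le> ?c * (norm (twisted_partial \<alpha> i f z) + \<alpha> * (1 + norm z) * norm (f z))"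
      by (intro mult_left_mono) auto
    then show "wmod \<alpha> k (cpartial i f) z \<le> wmod \<alpha> k (twisted_partial \<alpha> i f) z + \<alpha> * wmod \<alpha> (Suc k) f z"
      by (simp add: wmod_def algebra_simps)
  qed (use s in auto)
qed

text \<open>Since \<open>\<alpha> * cnj z\<^sub>i * f = \<partial>\<^sub>i f - twisted_partial \<alpha> i f\<close> and \<open>norm z\<close> is at most the sum of the
moduli of the coordinates, one power of the weight is bought with one derivative.\<close>

lemma energy_Suc_finite:
  fixes f :: "complex^'n \<Rightarrow> complex"
  assumes \<alpha>: "0 < \<alpha>" and s: "0 < s" and f: "entire f" and fin: "energy \<alpha> s k f < \<infinity>"
    "\<And>i. energy \<alpha> s k (cpartial i f) < \<infinity>"
  shows "energy \<alpha> s (Suc k) f < \<infinity>"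
proof -
  have [measurable]: "f \<in> borel_measurable borel" "cpartial i f \<in> borel_measurable borel" for i
    using f by (auto intro: entire_measurable entire_cpartial)
  note [measurable] = twisted_partial_measurable[OF f]
  have tw: "energy \<alpha> s k (twisted_partial \<alpha> i f) < \<infinity>" for i
    using \<alpha> s f fin by (intro energy_twisted_finite) auto
  define S where "S z = (\<Sum>i\<in>UNIV. wmod \<alpha> k (twisted_partial \<alpha> i f) z + wmod \<alpha> k (cpartial i f) z)" for z
  have "(\<integral>\<^sup>+z. ennreal (S z powr s) \<partial>lborel) < \<infinity>"
    unfolding S_def using s tw fin unfolding energy_def
    by (intro nn_integral_powr_sum_finite nn_integral_powr_add_finite) auto
  moreover have [measurable]: "S \<in> borel_measurable borel" unfolding S_def[abs_def] by measurable
  moreover have S_nonneg: "0 \<le> S z" for z by (simp add: S_def sum_nonneg)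
  ultimately have "(\<integral>\<^sup>+z. ennreal ((wmod \<alpha> k f z + (1 / \<alpha>) * S z) powr s) \<partial>lborel) < \<infinity>"
    using \<alpha> s fin unfolding energy_def
    by (intro nn_integral_powr_add_finite nn_integral_powr_cmult_finite) (auto simp: S_nonneg)
  then show ?thesis
    unfolding energy_def
  proof (rule nn_integral_powr_mono_finite[rotated 3])
    fix z :: "complex^'n"
    let ?c = "(1 + norm z) ^ k * exp (- (\<alpha> / 2) * (norm z)\<^sup>2)"
    have i: "\<alpha> * (norm (z $ i) * wmod \<alpha> k f z) \<le> wmod \<alpha> k (twisted_partial \<alpha> i f) z + wmod \<alpha> k (cpartial i f) z" for i
    proof -
      have "\<alpha> * norm (z $ i) * norm (f z) \<le> norm (twisted_partial \<alpha> i f z) + norm (cpartial i f z)"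
        using norm_triangle_ineq4[of "cpartial i f z" "twisted_partial \<alpha> i f z"] \<alpha>
        by (simp add: twisted_partial_def norm_mult)
      then have "?c * (\<alpha> * norm (z $ i) * norm (f z)) \<le> ?c * (norm (twisted_partial \<alpha> i f z) + norm (cpartial i f z))"
        by (intro mult_left_mono) auto
      then show ?thesis by (simp add: wmod_def algebra_simps)
    qed
    have "norm z \<le> (\<Sum>i\<in>UNIV. norm (z $ i))" unfolding norm_vec_def by (rule L2_set_le_sum) simp
    then have "\<alpha> * (norm z * wmod \<alpha> k f z) \<le> \<alpha> * ((\<Sum>i\<in>UNIV. norm (z $ i)) * wmod \<alpha> k f z)"
      using \<alpha> by (intro mult_left_mono mult_right_mono) auto
    also have "\<dots> = (\<Sum>i\<in>UNIV. \<alpha> * (norm (z $ i) * wmod \<alpha> k f z))"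
      by (simp add: sum_distrib_left sum_distrib_right)
    also have "\<dots> \<le> S z" unfolding S_def by (intro sum_mono i)
    finally have "norm z * wmod \<alpha> k f z \<le> (1 / \<alpha>) * S z" using \<alpha> by (simp add: field_simps)
    moreover have "wmod \<alpha> (Suc k) f z = wmod \<alpha> k f z + norm z * wmod \<alpha> k f z"
      by (simp add: wmod_def algebra_simps)
    ultimately show "wmod \<alpha> (Suc k) f z \<le> wmod \<alpha> k f z + (1 / \<alpha>) * S z" by simp
  qed (use s in auto)
qed

section \<open>Fock--Sobolev spaces\<close>

lemma wmod_powr:
  "wmod \<alpha> k f z powr s =
    ((1 + norm z) ^ k) powr s * norm (f z) powr s * exp (- (\<alpha> * s / 2) * (norm z)\<^sup>2)"
  unfolding wmod_def by (simp add: powr_mult) (simp add: powr_def)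

lemma entire_fold_cpartial: "entire f \<Longrightarrow> entire (fold cpartial xs f)"
  by (induction xs arbitrary: f) (auto intro: entire_cpartial)

text \<open>Partial derivatives commute only on entire functions, whereas permuting a fold requires operators
that commute everywhere; outside the entire functions they are replaced by the identity.\<close>

lemma fold_cpartial_permute:
  fixes f :: "complex^'n \<Rightarrow> complex"
  assumes f: "entire f" and "mset xs = mset ys"
  shows "fold cpartial xs f = fold cpartial ys f"
proof -
  define d where "d i f = (if entire f then cpartial i f else f)" for i and f :: "complex^'n \<Rightarrow> complex"
  have d: "fold cpartial xs f = fold d xs f" if "entire f" for xs and f :: "complex^'n \<Rightarrow> complex"
    using that by (induction xs arbitrary: f) (auto simp: d_def entire_cpartial)
  have "d i \<circ> d j = d j \<circ> d i" for i j
    by (auto simp: d_def fun_eq_iff entire_cpartial cpartial_commute)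
  then have "fold d xs = fold d ys"
    using assms(2) by (intro fold_multiset_equiv)
  then show ?thesis using d[OF f] by simp
qed

lemma mixed_partial_count:
  assumes "entire f" shows "mixed_partial (count_list xs) f = fold cpartial xs f"
proof -
  define ys where "ys = (SOME is. \<forall>i. count_list is i = count_list xs i)"
  have "\<forall>i. count_list ys i = count_list xs i" unfolding ys_def by (rule someI[of _ xs]) simp
  then have "mset ys = mset xs" by (auto simp: multiset_eq_iff count_mset)
  then show ?thesis
    unfolding mixed_partial_def ys_def[symmetric] by (rule fold_cpartial_permute[OF assms])
qed

lemma fock_norm_finite_iff:
  fixes f :: "complex^'n \<Rightarrow> complex"
  assumes "0 < \<alpha>" "0 < p"
  shows "fock_norm \<alpha> p f < \<infinity> \<longleftrightarrow> energy \<alpha> p 0 f < \<infinity>"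
proof -
  have "0 < (\<alpha> * p / (2 * pi)) ^ CARD('n)" using assms by simp
  then show ?thesis
    unfolding fock_norm_def enn_powr_finite_iff energy_def wmod_powr
    using assms by (auto simp: ennreal_mult_less_top)
qed

text \<open>Both directions trade derivatives for powers of the weight one at a time. From the derivatives to
the weight, all derivatives of order at most \<open>m - k\<close> carry the weight of order \<open>k\<close>, by induction on
\<open>k\<close>; from the weight to the derivatives, a derivative of order \<open>j\<close> keeps the weight of order
\<open>m - j\<close>, by induction on \<open>j\<close>.\<close>

theorem fock_sobolev_iff:
  fixes f :: "complex^'n \<Rightarrow> complex"
  assumes \<alpha>: "0 < \<alpha>" and p: "0 < p"
  shows "f \<in> fock_sobolev \<alpha> p m \<longleftrightarrow> entire f \<and> energy \<alpha> p m f < \<infinity>"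
proof (cases "entire f")
  case f: True
  have len: "(\<Sum>i\<in>(UNIV::'n set). count_list xs i) = length xs" for xs :: "'n list"
    by (rule sum_count_set) auto
  have "f \<in> fock_sobolev \<alpha> p m \<longleftrightarrow>
      (\<forall>\<beta>. (\<Sum>i\<in>UNIV. \<beta> i) \<le> m \<longrightarrow> energy \<alpha> p 0 (mixed_partial \<beta> f) < \<infinity>)"
    unfolding fock_sobolev_def using f finite_multi_indices[of m, where 'n='n]
    by (simp add: fock_norm_finite_iff[OF \<alpha> p, unfolded infinity_ennreal_def])
  also have "\<dots> \<longleftrightarrow> (\<forall>xs. length xs \<le> m \<longrightarrow> energy \<alpha> p 0 (fold cpartial xs f) < \<infinity>)"
  proof (intro iffI allI impI)
    fix xs :: "'n list" assume "\<forall>\<beta>. (\<Sum>i\<in>UNIV. \<beta> i) \<le> m \<longrightarrow> energy \<alpha> p 0 (mixed_partial \<beta> f) < \<infinity>" "length xs \<le> m"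
    then show "energy \<alpha> p 0 (fold cpartial xs f) < \<infinity>"
      using len[of xs] mixed_partial_count[OF f, of xs] by metis
  next
    fix \<beta> :: "'n \<Rightarrow> nat"
    assume *: "\<forall>xs. length xs \<le> m \<longrightarrow> energy \<alpha> p 0 (fold cpartial xs f) < \<infinity>" "(\<Sum>i\<in>UNIV. \<beta> i) \<le> m"
    obtain xs where "\<forall>i. count_list xs i = \<beta> i" using ex_count_list by blast
    then have "\<beta> = count_list xs" by auto
    then show "energy \<alpha> p 0 (mixed_partial \<beta> f) < \<infinity>"
      using * len[of xs] mixed_partial_count[OF f, of xs] by simp
  qed
  also have "\<dots> \<longleftrightarrow> energy \<alpha> p m f < \<infinity>"
  proof
    assume *: "\<forall>xs. length xs \<le> m \<longrightarrow> energy \<alpha> p 0 (fold cpartial xs f) < \<infinity>"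
    have "energy \<alpha> p k (fold cpartial xs f) < \<infinity>" if "length xs + k \<le> m" for k xs
      using that
    proof (induction k arbitrary: xs)
      case (Suc k)
      show ?case
      proof (rule energy_Suc_finite[OF \<alpha> p entire_fold_cpartial[OF f]])
        show "energy \<alpha> p k (fold cpartial xs f) < \<infinity>" using Suc by simp
        show "energy \<alpha> p k (cpartial i (fold cpartial xs f)) < \<infinity>" for i
          using Suc.IH[of "xs @ [i]"] Suc.prems by simp
      qed
    qed (use * in simp)
    from this[of "[]" m] show "energy \<alpha> p m f < \<infinity>" by simp
  next
    assume *: "energy \<alpha> p m f < \<infinity>"
    have "energy \<alpha> p (m - length xs) (fold cpartial xs f) < \<infinity>" if "length xs \<le> m" for xs
      using that
    proof (induction xs rule: rev_induct)
      case (snoc i xs)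
      then have "m - length xs = Suc (m - length (xs @ [i]))" by simp
      then show ?case
        using snoc energy_cpartial_finite[OF \<alpha> p entire_fold_cpartial[OF f]] by simp
    qed (use * in simp)
    then show "\<forall>xs. length xs \<le> m \<longrightarrow> energy \<alpha> p 0 (fold cpartial xs f) < \<infinity>"
      using energy_mono[of 0 _ p \<alpha>] p by (meson le_less_trans less_imp_le zero_le)
  qed
  finally show ?thesis using f by simp
qed (simp add: fock_sobolev_def)

text \<open>The integral inside \<open>fs_norm\<close>, without constant and root.\<close>

definition fs_integral :: "real \<Rightarrow> real \<Rightarrow> nat \<Rightarrow> (complex^'n \<Rightarrow> complex) \<Rightarrow> ennreal" where
  "fs_integral \<alpha> p m f = (\<integral>\<^sup>+ z. ennreal ((norm z ^ m) powr p * norm (f z) powr p *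
                     exp (- (\<alpha> * p / 2) * (norm z)\<^sup>2)) \<partial>lborel)"

lemma fs_integral_le_energy:
  assumes "0 \<le> p" shows "fs_integral \<alpha> p m f \<le> energy \<alpha> p m f"
  unfolding fs_integral_def energy_def wmod_powr using assms
  by (intro nn_integral_mono ennreal_leI mult_right_mono powr_mono2 power_mono) auto

text \<open>The two weights are comparable for \<open>norm z \<ge> 1\<close>. In the unit ball, where \<open>norm z ^ m\<close> degenerates,
the mean value property on a circle bounds \<open>f\<close> by its values on \<open>2 \<le> norm z \<le> 4\<close>, and there \<open>f\<close> is
bounded by integrals over unit balls that avoid the unit ball at the origin.\<close>

lemma energy_le_fs_integral:
  assumes \<alpha>: "0 \<le> \<alpha>" and p: "0 < p"
  shows "\<exists>C>0. \<forall>f. entire (f :: complex^'n \<Rightarrow> complex) \<longrightarrow>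
    energy \<alpha> p m f \<le> ennreal C * fs_integral \<alpha> p m f"
proof -
  obtain C where C: "0 < C" "\<And>f z. entire (f :: complex^'n \<Rightarrow> complex) \<Longrightarrow>
    ennreal (wmod \<alpha> m f z powr p) \<le> ennreal C * (\<integral>\<^sup>+w\<in>ball z 1. ennreal (wmod \<alpha> m f w powr p) \<partial>lborel)"
    using wmod_submean[OF \<alpha> p, where 'n='n and k=m] by blast
  define V where "V = unit_ball_vol (real DIM(complex^'n))"
  have V: "0 < V" by (simp add: V_def unit_ball_vol_pos)
  define A where "A = (2 ^ m :: real) powr p"
  have A: "0 < A" by (simp add: A_def)
  define E where "E = exp (\<alpha> / 2 * 4\<^sup>2) powr p"
  have E: "0 < E" by (simp add: E_def)
  show ?thesis
  proof (intro exI[of _ "A + A * E * C * A * V"] conjI allI impI)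
    show "0 < A + A * E * C * A * V" using A E C V by (simp add: add_pos_pos)
    fix f :: "complex^'n \<Rightarrow> complex" assume f: "entire f"
    have [measurable]: "f \<in> borel_measurable borel" using f by (rule entire_measurable)
    define g where "g z = (norm z ^ m) powr p * norm (f z) powr p * exp (- (\<alpha> * p / 2) * (norm z)\<^sup>2)" for z
    have g_nonneg: "0 \<le> g z" for z by (simp add: g_def)
    have e_meas: "(\<lambda>z::complex^'n. exp (- (\<alpha> * p / 2) * (norm z)\<^sup>2)) \<in> borel_measurable borel"
      by (intro borel_measurable_continuous_onI continuous_intros)
    have [measurable]: "g \<in> borel_measurable borel"
      unfolding g_def[abs_def] by (intro borel_measurable_times e_meas) measurable
    define J where "J = fs_integral \<alpha> p m f"
    have J: "J = (\<integral>\<^sup>+z. ennreal (g z) \<partial>lborel)" by (simp add: J_def fs_integral_def g_def)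
    have far: "wmod \<alpha> m f z powr p \<le> A * g z" if z: "1 \<le> norm z" for z
    proof -
      have "(1 + norm z) ^ m \<le> (2 * norm z) ^ m" using z by (intro power_mono) auto
      then have "((1 + norm z) ^ m) powr p \<le> (2 ^ m * norm z ^ m) powr p"
        using p by (intro powr_mono2) (auto simp: power_mult_distrib)
      then have "((1 + norm z) ^ m) powr p \<le> A * (norm z ^ m) powr p"
        by (simp add: A_def powr_mult)
      then show ?thesis unfolding wmod_powr g_def mult.assoc[symmetric]
        by (intro mult_right_mono) auto
    qed
    have near: "ennreal (wmod \<alpha> m f z powr p) \<le> ennreal (A * E * C * A) * J" if z: "norm z < 1" for z
    proof (cases J)
      case (real I)
      define B where "B = exp (\<alpha> / 2 * 4\<^sup>2) * (C * A * I) powr (1 / p)"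
      have "norm (f v) \<le> B" if v: "2 \<le> norm v" "norm v \<le> 4" for v
      proof -
        have "ennreal (wmod \<alpha> m f v powr p) \<le> ennreal C * (\<integral>\<^sup>+w\<in>ball v 1. ennreal (wmod \<alpha> m f w powr p) \<partial>lborel)"
          by (rule C(2)[OF f])
        also have "\<dots> \<le> ennreal C * (\<integral>\<^sup>+w. ennreal A * ennreal (g w) \<partial>lborel)"
        proof (intro mult_left_mono nn_integral_mono)
          fix w
          have "1 \<le> norm w" if "w \<in> ball v 1"
            using that v norm_triangle_sub[of v w] by (simp add: dist_norm)
          then show "ennreal (wmod \<alpha> m f w powr p) * indicator (ball v 1) w \<le> ennreal A * ennreal (g w)"
            using far[of w] A g_nonneg[of w] by (auto simp: indicator_def ennreal_leI simp flip: ennreal_mult)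
        qed simp
        also have "\<dots> = ennreal (C * A * I)"
          using C A real by (simp add: nn_integral_cmult J[symmetric] ennreal_mult mult.assoc)
        finally have "wmod \<alpha> m f v powr p \<le> C * A * I"
          using C A real by (simp add: ennreal_le_iff)
        then have "wmod \<alpha> m f v \<le> (C * A * I) powr (1 / p)"
          using p by (intro powr_le_imp_le_root) auto
        moreover have "norm (f v) \<le> exp (\<alpha> / 2 * 4\<^sup>2) * wmod \<alpha> m f v"
          using \<alpha> v by (intro norm_le_wmod)
        ultimately show ?thesis unfolding B_def by (meson exp_ge_zero mult_left_mono order_trans)
      qed
      note fv = this
      have B: "0 \<le> B" by (simp add: B_def)
      \<comment> \<open>A circle of radius \<open>3\<close> around a point of the unit ball lies in the shell \<open>2 \<le> norm v \<le> 4\<close>.\<close>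
      obtain e :: "complex^'n" where e: "norm e = 3"
        using vector_choose_size[of 3] by auto
      have "ennreal (norm (f z)) \<le> (\<integral>\<^sup>+x\<in>{0..1}. ennreal (norm (f (z + circ x *s e))) \<partial>lborel)"
        by (rule entire_norm_le_circle_mean[OF f])
      also have "\<dots> \<le> (\<integral>\<^sup>+x\<in>{0..1::real}. ennreal B \<partial>lborel)"
      proof (intro nn_integral_mono mult_right_mono ennreal_leI fv)
        fix x :: real
        have "norm (circ x *s e) = 3" using e by simp
        then show "2 \<le> norm (z + circ x *s e)" "norm (z + circ x *s e) \<le> 4"
          using z norm_triangle_ineq[of z "circ x *s e"] norm_triangle_ineq4[of "z + circ x *s e" z] by auto
      qed simp
      also have "\<dots> = ennreal B" by (simp add: nn_integral_cmult)
      finally have "norm (f z) \<le> B" using B by (simp add: ennreal_le_iff)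
      moreover have "wmod \<alpha> m f z \<le> 2 ^ m * norm (f z)"
      proof -
        have "(1 + norm z) ^ m \<le> 2 ^ m" using z by (intro power_mono) auto
        then have "(1 + norm z) ^ m * norm (f z) * exp (- (\<alpha> / 2) * (norm z)\<^sup>2) \<le> 2 ^ m * norm (f z) * 1"
          using \<alpha> by (intro mult_mono) auto
        then show ?thesis by (simp add: wmod_def)
      qed
      ultimately have "wmod \<alpha> m f z \<le> 2 ^ m * B"
        by (meson mult_left_mono order_trans zero_le_numeral zero_le_power)
      then have "wmod \<alpha> m f z powr p \<le> (2 ^ m * B) powr p" using p by (intro powr_mono2) auto
      also have "\<dots> = A * (E * (C * A * I))"
        using p C A real by (simp add: A_def E_def B_def powr_mult powr_powr)
      finally have "ennreal (wmod \<alpha> m f z powr p) \<le> ennreal (A * E * C * A * I)"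
        by (intro ennreal_leI) (simp add: mult_ac)
      also have "\<dots> = ennreal (A * E * C * A) * J" using A E C real by (simp add: ennreal_mult)
      finally show ?thesis .
    next
      case top
      then show ?thesis using A E C by (simp add: ennreal_mult_top)
    qed
    have [measurable]: "ball (0::complex^'n) 1 \<in> sets borel" by simp
    have "energy \<alpha> p m f \<le> (\<integral>\<^sup>+z. ennreal A * ennreal (g z)
        + (ennreal (A * E * C * A) * J) * indicator (ball 0 1) z \<partial>lborel)"
      unfolding energy_def
    proof (rule nn_integral_mono)
      fix z :: "complex^'n"
      show "ennreal (wmod \<alpha> m f z powr p) \<le> ennreal A * ennreal (g z) + (ennreal (A * E * C * A) * J) * indicator (ball 0 1) z"
      proof (cases "norm z < 1")
        case True
        then show ?thesis using near[OF True] by (simp add: add_increasing)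
      next
        case False
        then show ?thesis
          using far[of z] A g_nonneg[of z]
          by (simp add: add_increasing2 ennreal_leI flip: ennreal_mult)
      qed
    qed
    also have "\<dots> = ennreal A * J + (ennreal (A * E * C * A) * J) * ennreal V"
      by (simp add: nn_integral_add nn_integral_cmult J[symmetric] emeasure_ball V_def)
    also have "\<dots> = ennreal (A + A * E * C * A * V) * J"
      using A E C V by (simp add: ennreal_mult ennreal_plus distrib_left distrib_right mult_ac)
    finally show "energy \<alpha> p m f \<le> ennreal (A + A * E * C * A * V) * fs_integral \<alpha> p m f"
      by (simp add: J_def)
  qed
qed

lemma fs_const_pos:
  assumes "0 < \<alpha>" "0 < p" "0 < n" shows "0 < fs_const \<alpha> p m n"
  using assms unfolding fs_const_def
  by (intro mult_pos_pos divide_pos_pos Gamma_real_pos add_nonneg_pos) auto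

lemma fs_norm_fs_integral:
  "fs_norm \<alpha> p m (f :: complex^'n \<Rightarrow> complex) =
    enn_powr (ennreal (fs_const \<alpha> p m CARD('n)) * fs_integral \<alpha> p m f) (1 / p)"
  by (simp add: fs_norm_def fs_integral_def)

lemma fs_norm_le_energy:
  assumes "0 < \<alpha>" "0 < p"
  shows "\<exists>C>0. \<forall>f :: complex^'n \<Rightarrow> complex.
    fs_norm \<alpha> p m f \<le> ennreal C * enn_powr (energy \<alpha> p m f) (1 / p)"
proof -
  define c where "c = fs_const \<alpha> p m CARD('n)"
  have c: "0 < c" using assms by (simp add: c_def fs_const_pos)
  show ?thesis
  proof (intro exI[of _ "c powr (1 / p)"] conjI allI)
    fix f :: "complex^'n \<Rightarrow> complex"
    show "fs_norm \<alpha> p m f \<le> ennreal (c powr (1 / p)) * enn_powr (energy \<alpha> p m f) (1 / p)"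
      unfolding fs_norm_fs_integral c_def[symmetric] enn_powr_mult[OF c]
      using assms by (intro mult_left_mono enn_powr_mono fs_integral_le_energy) auto
  qed (use c in simp)
qed

lemma energy_le_fs_norm:
  assumes "0 < \<alpha>" "0 < p"
  shows "\<exists>C>0. \<forall>f. entire (f :: complex^'n \<Rightarrow> complex) \<longrightarrow>
    enn_powr (energy \<alpha> p m f) (1 / p) \<le> ennreal C * fs_norm \<alpha> p m f"
proof -
  obtain C where C: "0 < C" "\<And>f. entire (f :: complex^'n \<Rightarrow> complex) \<Longrightarrow>
    energy \<alpha> p m f \<le> ennreal C * fs_integral \<alpha> p m f"
    using energy_le_fs_integral[of \<alpha> p, where 'n='n and m=m] assms by auto
  define c where "c = fs_const \<alpha> p m CARD('n)"
  have c: "0 < c" using assms by (simp add: c_def fs_const_pos)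
  show ?thesis
  proof (intro exI[of _ "(C / c) powr (1 / p)"] conjI allI impI)
    fix f :: "complex^'n \<Rightarrow> complex" assume "entire f"
    then have "enn_powr (energy \<alpha> p m f) (1 / p) \<le> enn_powr (ennreal C * fs_integral \<alpha> p m f) (1 / p)"
      using C assms by (intro enn_powr_mono) auto
    also have "ennreal C * fs_integral \<alpha> p m f = ennreal (C / c) * (ennreal c * fs_integral \<alpha> p m f)"
      using C c by (simp add: mult.assoc[symmetric] flip: ennreal_mult)
    also have "enn_powr \<dots> (1 / p) = ennreal ((C / c) powr (1 / p)) * fs_norm \<alpha> p m f"
      unfolding fs_norm_fs_integral c_def[symmetric] using C c by (intro enn_powr_mult) simp
    finally show "enn_powr (energy \<alpha> p m f) (1 / p) \<le> ennreal ((C / c) powr (1 / p)) * fs_norm \<alpha> p m f" .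
  qed (use C c in simp)
qed

text \<open>The sub-mean value inequality bounds \<open>wmod \<alpha> m f\<close> pointwise by its \<open>p\<close>-integral, so that the
factor \<open>wmod \<alpha> m f z powr (q - p)\<close> can be taken out of the \<open>q\<close>-integral.\<close>

lemma energy_embedding:
  assumes \<alpha>: "0 < \<alpha>" and p: "0 < p" "p \<le> q"
  shows "\<exists>C>0. \<forall>f. entire (f :: complex^'n \<Rightarrow> complex) \<longrightarrow>
    energy \<alpha> q m f \<le> ennreal C * enn_powr (enn_powr (energy \<alpha> p m f) (1 / p)) q"
proof -
  obtain C where C: "0 < C" "\<And>f z. entire (f :: complex^'n \<Rightarrow> complex) \<Longrightarrow>
    ennreal (wmod \<alpha> m f z powr p) \<le> ennreal C * energy \<alpha> p m f"
    using wmod_le_energy[of \<alpha> p, where 'n='n and k=m] assms by auto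
  show ?thesis
  proof (intro exI[of _ "C powr (q / p - 1)"] conjI allI impI)
    fix f :: "complex^'n \<Rightarrow> complex" assume f: "entire f"
    have [measurable]: "f \<in> borel_measurable borel" using f by (rule entire_measurable)
    have q: "0 < q" using p by simp
    show "energy \<alpha> q m f \<le> ennreal (C powr (q / p - 1)) * enn_powr (enn_powr (energy \<alpha> p m f) (1 / p)) q"
    proof (cases "energy \<alpha> p m f")
      case (real I)
      have le: "wmod \<alpha> m f z powr p \<le> C * I" for z
        using C(2)[OF f, of z] C(1) real by (simp add: ennreal_le_iff flip: ennreal_mult)
      have "energy \<alpha> q m f \<le> (\<integral>\<^sup>+z. ennreal ((C * I) powr (q / p - 1)) * ennreal (wmod \<alpha> m f z powr p) \<partial>lborel)"
        unfolding energy_def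
      proof (rule nn_integral_mono)
        fix z
        have "wmod \<alpha> m f z powr q = (wmod \<alpha> m f z powr p) powr (q / p - 1) * wmod \<alpha> m f z powr p"
          using p by (simp add: powr_powr algebra_simps flip: powr_add)
        also have "\<dots> \<le> (C * I) powr (q / p - 1) * wmod \<alpha> m f z powr p"
          using le p by (intro mult_right_mono powr_mono2) (auto simp: field_simps)
        finally show "ennreal (wmod \<alpha> m f z powr q) \<le> ennreal ((C * I) powr (q / p - 1)) * ennreal (wmod \<alpha> m f z powr p)"
          by (simp add: ennreal_leI flip: ennreal_mult)
      qed
      also have "\<dots> = ennreal ((C * I) powr (q / p - 1)) * energy \<alpha> p m f"
        unfolding energy_def by (rule nn_integral_cmult) simp
      also have "\<dots> = ennreal (C powr (q / p - 1) * (I powr (q / p - 1) * I))"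
        using real C by (simp add: powr_mult mult.assoc flip: ennreal_mult)
      also have "I powr (q / p - 1) * I = I powr (q / p)"
        using real by (cases "I = 0") (auto simp: powr_diff)
      also have "ennreal (C powr (q / p - 1) * I powr (q / p)) =
          ennreal (C powr (q / p - 1)) * enn_powr (enn_powr (energy \<alpha> p m f) (1 / p)) q"
        using real p by (simp add: enn_powr_ennreal powr_powr ennreal_mult)
      finally show ?thesis .
    next
      case top
      then show ?thesis using C by (simp add: ennreal_mult_top)
    qed
  qed (use C in simp)
qed

section \<open>The Berezin-type transform\<close>

text \<open>Moving the argument of a polynomial weight from \<open>v\<close> to \<open>w\<close> costs only a polynomial in the distance,
which Gaussians absorb.\<close>

lemma one_plus_norm_powr_le:
  fixes v w :: "'a::real_normed_vector"
  assumes "0 \<le> r"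
  shows "(1 + norm v) powr r \<le> (1 + norm (v - w)) powr r * (1 + norm w) powr r"
proof -
  have "norm v \<le> norm w + norm (v - w)" using norm_triangle_sub[of v w] by simp
  then have "1 + norm v \<le> (1 + norm (v - w)) * (1 + norm w)"
    using mult_nonneg_nonneg[OF norm_ge_zero[of "v - w"] norm_ge_zero[of w]]
    unfolding distrib_left distrib_right mult_1_left mult_1_right by linarith
  then have "(1 + norm v) powr r \<le> ((1 + norm (v - w)) * (1 + norm w)) powr r"
    using assms by (intro powr_mono2) auto
  then show ?thesis by (simp add: powr_mult)
qed

lemma power_powr_eq: "0 < x \<Longrightarrow> (x ^ m) powr r = x powr (real m * r)"
  by (simp add: powr_powr flip: powr_realpow)

lemma norm_fock_kernel:
  "norm (fock_kernel \<alpha> w \<zeta>) = exp (\<alpha> / 2 * ((norm \<zeta>)\<^sup>2 - (norm (\<zeta> - w))\<^sup>2))"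
  unfolding fock_kernel_def norm_diff_power2_cdot
  by (simp add: norm_exp_eq_Re algebra_simps)

lemma norm_fock_kernel_powr:
  "norm (fock_kernel \<alpha> w \<zeta>) powr q = exp (\<alpha> * q / 2 * ((norm \<zeta>)\<^sup>2 - (norm (\<zeta> - w))\<^sup>2))"
  by (simp add: norm_fock_kernel powr_def)

lemma entire_fock_kernel: "entire (fock_kernel \<alpha> w)"
  using entire_exp_cdot[of "of_real \<alpha>" w "- of_real (\<alpha> / 2 * (norm w)\<^sup>2)"]
  by (simp add: fock_kernel_def[abs_def])

text \<open>The transform integrates \<open>berezin_kernel\<close> along \<open>\<psi>\<close> against a weight that depends on \<open>u\<close> but not on
\<open>w\<close> (\<open>berezin_eq\<close>); all estimates concern the kernel and pass to the transform by Fubini's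
theorem.\<close>

definition berezin_kernel :: "real \<Rightarrow> real \<Rightarrow> nat \<Rightarrow> complex^'n \<Rightarrow> complex^'n \<Rightarrow> real" where
  "berezin_kernel \<alpha> q m w \<zeta> = norm (fock_kernel \<alpha> w \<zeta>) powr q / (1 + norm \<zeta>) powr (real m * q)"

definition source_weight :: "real \<Rightarrow> real \<Rightarrow> nat \<Rightarrow> (complex^'n \<Rightarrow> complex) \<Rightarrow> complex^'n \<Rightarrow> real" where
  "source_weight \<alpha> q m u z =
    norm (u z) powr q * (norm z ^ m) powr q * exp (- (\<alpha> * q / 2) * (norm z)\<^sup>2)"

lemma berezin_kernel_nonneg [simp]: "0 \<le> berezin_kernel \<alpha> q m w \<zeta>"
  by (simp add: berezin_kernel_def)

lemma continuous_on_gaussian: "continuous_on S (\<lambda>z::complex^'n. exp (c * (norm z)\<^sup>2) :: real)"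
  by (intro continuous_intros)

lemma source_weight_measurable [measurable]:
  assumes "u \<in> borel_measurable borel"
  shows "source_weight \<alpha> q m (u :: complex^'n \<Rightarrow> complex) \<in> borel_measurable borel"
proof -
  have e: "(\<lambda>z::complex^'n. exp (- (\<alpha> * q / 2) * (norm z)\<^sup>2)) \<in> borel_measurable borel"
    by (intro borel_measurable_continuous_onI continuous_on_gaussian)
  have "(\<lambda>z. norm (u z) powr q * (norm z ^ m) powr q) \<in> borel_measurable borel"
    using assms by measurable
  from borel_measurable_times[OF this e] show ?thesis unfolding source_weight_def[abs_def] .
qed

lemma fock_kernel_powr_measurable [measurable]:
  fixes f g :: "'a \<Rightarrow> complex^'n"
  assumes "f \<in> borel_measurable M" "g \<in> borel_measurable M"
  shows "(\<lambda>x. norm (fock_kernel \<alpha> (f x) (g x)) powr q) \<in> borel_measurable M"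
  unfolding norm_fock_kernel_powr using assms
  by (rule borel_measurable_continuous_Pair) (intro continuous_intros)

lemma berezin_kernel_measurable [measurable]:
  fixes f g :: "'a \<Rightarrow> complex^'n"
  assumes [measurable]: "f \<in> borel_measurable M" "g \<in> borel_measurable M"
  shows "(\<lambda>x. berezin_kernel \<alpha> q m (f x) (g x)) \<in> borel_measurable M"
  unfolding berezin_kernel_def by measurable

lemma berezin_eq:
  "berezin \<alpha> q m u \<psi> w =
    (\<integral>\<^sup>+z. ennreal (berezin_kernel \<alpha> q m w (\<psi> z)) * ennreal (source_weight \<alpha> q m u z) \<partial>lborel)"
  unfolding berezin_def
  by (intro nn_integral_cong)
    (simp add: berezin_kernel_def source_weight_def mult.assoc flip: ennreal_mult)

lemma fs_integral_wcomp:
  "fs_integral \<alpha> q m (wcomp u \<psi> f) =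
    (\<integral>\<^sup>+z. ennreal (norm (f (\<psi> z)) powr q) * ennreal (source_weight \<alpha> q m u z) \<partial>lborel)"
  unfolding fs_integral_def
  by (intro nn_integral_cong)
    (simp add: wcomp_def source_weight_def norm_mult powr_mult mult_ac flip: ennreal_mult)

lemma berezin_measurable:
  assumes "u \<in> borel_measurable borel" "\<psi> \<in> borel_measurable borel"
  shows "berezin \<alpha> q m u \<psi> \<in> borel_measurable borel"
proof -
  note [measurable] = assms
  have "(\<lambda>w. \<integral>\<^sup>+z. ennreal (berezin_kernel \<alpha> q m w (\<psi> z)) * ennreal (source_weight \<alpha> q m u z) \<partial>lborel)
      \<in> borel_measurable borel"
    by measurable
  then show ?thesis by (simp add: berezin_eq[abs_def])
qed

text \<open>For \<open>w\<close> in the unit ball around \<open>\<zeta>\<close> the modulus \<open>norm (fock_kernel \<alpha> w \<zeta>)\<close> is comparable to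
\<open>exp (\<alpha> / 2 * norm \<zeta> ^ 2)\<close>, which is what separates \<open>norm (f \<zeta>)\<close> from \<open>wmod \<alpha> m f \<zeta>\<close>. The weighted
sub-mean value inequality thus becomes a reproducing inequality.\<close>

lemma norm_powr_le_berezin_kernel:
  fixes \<alpha> q :: real and m :: nat
  assumes \<alpha>: "0 \<le> \<alpha>" and q: "0 < q"
  shows "\<exists>C>0. \<forall>f \<zeta>. entire (f :: complex^'n \<Rightarrow> complex) \<longrightarrow>
    ennreal (norm (f \<zeta>) powr q) \<le>
      ennreal C * (\<integral>\<^sup>+w. ennreal (wmod \<alpha> m f w powr q) * ennreal (berezin_kernel \<alpha> q m w \<zeta>) \<partial>lborel)"
proof -
  obtain C where C: "0 < C" "\<And>f z. entire (f :: complex^'n \<Rightarrow> complex) \<Longrightarrow>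
    ennreal (wmod \<alpha> m f z powr q) \<le> ennreal C * (\<integral>\<^sup>+w\<in>ball z 1. ennreal (wmod \<alpha> m f w powr q) \<partial>lborel)"
    using wmod_submean[OF \<alpha> q, where 'n='n and k=m] by blast
  define E where "E = exp (\<alpha> * q / 2)"
  show ?thesis
  proof (intro exI[of _ "C * E"] conjI allI impI)
    show "0 < C * E" using C by (simp add: E_def)
    fix f :: "complex^'n \<Rightarrow> complex" and \<zeta> :: "complex^'n" assume f: "entire f"
    have [measurable]: "f \<in> borel_measurable borel" using f by (rule entire_measurable)
    have [measurable]: "ball \<zeta> 1 \<in> sets borel" by simp
    define P where "P = exp (\<alpha> * q / 2 * (norm \<zeta>)\<^sup>2) / (1 + norm \<zeta>) powr (real m * q)"
    have P: "0 \<le> P" by (simp add: P_def)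
    have "0 < 1 + norm \<zeta>" by (rule add_pos_nonneg) auto
    then have "P * wmod \<alpha> m f \<zeta> powr q = norm (f \<zeta>) powr q * (exp (\<alpha> * q / 2 * (norm \<zeta>)\<^sup>2) * exp (- (\<alpha> * q / 2) * (norm \<zeta>)\<^sup>2))"
      unfolding wmod_powr P_def power_powr_eq[OF \<open>0 < 1 + norm \<zeta>\<close>] by simp
    then have "ennreal (norm (f \<zeta>) powr q) = ennreal P * ennreal (wmod \<alpha> m f \<zeta> powr q)"
      using P by (simp flip: exp_add ennreal_mult)
    also have "\<dots> \<le> ennreal P * (ennreal C * (\<integral>\<^sup>+w\<in>ball \<zeta> 1. ennreal (wmod \<alpha> m f w powr q) \<partial>lborel))"
      by (intro mult_left_mono C f) simp
    also have "\<dots> = ennreal C * (\<integral>\<^sup>+w. ennreal P * (ennreal (wmod \<alpha> m f w powr q) * indicator (ball \<zeta> 1) w) \<partial>lborel)"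
      by (subst nn_integral_cmult) (simp_all add: mult_ac)
    also have "\<dots> \<le> ennreal C * (\<integral>\<^sup>+w. ennreal E * (ennreal (wmod \<alpha> m f w powr q) * ennreal (berezin_kernel \<alpha> q m w \<zeta>)) \<partial>lborel)"
    proof (intro mult_left_mono nn_integral_mono)
      fix w
      have "P \<le> E * berezin_kernel \<alpha> q m w \<zeta>" if "w \<in> ball \<zeta> 1"
      proof -
        have "(norm (\<zeta> - w))\<^sup>2 \<le> 1" using that by (simp add: dist_norm power_le_one)
        then have "\<alpha> * q / 2 * (norm (\<zeta> - w))\<^sup>2 \<le> \<alpha> * q / 2 * 1"
          using \<alpha> q by (intro mult_left_mono) auto
        then have "exp (\<alpha> * q / 2 * (norm \<zeta>)\<^sup>2) \<le> E * exp (\<alpha> * q / 2 * ((norm \<zeta>)\<^sup>2 - (norm (\<zeta> - w))\<^sup>2))"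
          unfolding E_def exp_add[symmetric] by (simp add: right_diff_distrib)
        then show ?thesis
          unfolding P_def berezin_kernel_def norm_fock_kernel_powr by (simp add: divide_right_mono)
      qed
      then have "ennreal P * ennreal (wmod \<alpha> m f w powr q) \<le> ennreal (E * berezin_kernel \<alpha> q m w \<zeta>) * ennreal (wmod \<alpha> m f w powr q)"
        if "w \<in> ball \<zeta> 1" using that by (intro mult_right_mono ennreal_leI) auto
      then show "ennreal P * (ennreal (wmod \<alpha> m f w powr q) * indicator (ball \<zeta> 1) w)
          \<le> ennreal E * (ennreal (wmod \<alpha> m f w powr q) * ennreal (berezin_kernel \<alpha> q m w \<zeta>))"
        by (auto simp: indicator_def E_def ennreal_mult mult_ac)
    qed simp
    also have "\<dots> = ennreal (C * E) * (\<integral>\<^sup>+w. ennreal (wmod \<alpha> m f w powr q) * ennreal (berezin_kernel \<alpha> q m w \<zeta>) \<partial>lborel)"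
      using C by (subst nn_integral_cmult) (simp_all add: ennreal_mult E_def mult_ac)
    finally show "ennreal (norm (f \<zeta>) powr q) \<le>
      ennreal (C * E) * (\<integral>\<^sup>+w. ennreal (wmod \<alpha> m f w powr q) * ennreal (berezin_kernel \<alpha> q m w \<zeta>) \<partial>lborel)" .
  qed
qed

lemma fs_integral_wcomp_le_berezin:
  fixes \<alpha> q :: real and m :: nat
  assumes \<alpha>: "0 \<le> \<alpha>" and q: "0 < q"
  shows "\<exists>C>0. \<forall>f u \<psi>. entire (f :: complex^'n \<Rightarrow> complex) \<longrightarrow>
      u \<in> borel_measurable borel \<longrightarrow> \<psi> \<in> borel_measurable borel \<longrightarrow>
    fs_integral \<alpha> q m (wcomp u \<psi> f) \<le>
      ennreal C * (\<integral>\<^sup>+w. ennreal (wmod \<alpha> m f w powr q) * berezin \<alpha> q m u \<psi> w \<partial>lborel)"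
proof -
  obtain C where C: "0 < C" "\<And>f \<zeta>. entire (f :: complex^'n \<Rightarrow> complex) \<Longrightarrow>
    ennreal (norm (f \<zeta>) powr q) \<le>
      ennreal C * (\<integral>\<^sup>+w. ennreal (wmod \<alpha> m f w powr q) * ennreal (berezin_kernel \<alpha> q m w \<zeta>) \<partial>lborel)"
    using norm_powr_le_berezin_kernel[OF \<alpha> q, where 'n='n and m=m] by blast
  show ?thesis
  proof (intro exI[of _ C] conjI allI impI C(1))
    fix f u :: "complex^'n \<Rightarrow> complex" and \<psi> :: "complex^'n \<Rightarrow> complex^'n"
    assume f: "entire f" and [measurable]: "u \<in> borel_measurable borel" "\<psi> \<in> borel_measurable borel"
    have [measurable]: "f \<in> borel_measurable borel" using f by (rule entire_measurable)
    let ?W = "\<lambda>z. ennreal (source_weight \<alpha> q m u z)" and ?M = "\<lambda>w. ennreal (wmod \<alpha> m f w powr q)"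
    let ?R = "\<lambda>w z. ennreal (berezin_kernel \<alpha> q m w (\<psi> z))"
    have "fs_integral \<alpha> q m (wcomp u \<psi> f) \<le> (\<integral>\<^sup>+z. (ennreal C * (\<integral>\<^sup>+w. ?M w * ?R w z \<partial>lborel)) * ?W z \<partial>lborel)"
      unfolding fs_integral_wcomp by (intro nn_integral_mono mult_right_mono C f) simp
    also have "\<dots> = ennreal C * (\<integral>\<^sup>+z. (\<integral>\<^sup>+w. ?M w * ?R w z \<partial>lborel) * ?W z \<partial>lborel)"
      unfolding mult.assoc by (rule nn_integral_cmult) measurable
    also have "(\<integral>\<^sup>+z. (\<integral>\<^sup>+w. ?M w * ?R w z \<partial>lborel) * ?W z \<partial>lborel) = (\<integral>\<^sup>+z. (\<integral>\<^sup>+w. ?M w * ?R w z * ?W z \<partial>lborel) \<partial>lborel)"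
      by (simp add: nn_integral_multc)
    also have "(\<integral>\<^sup>+z. (\<integral>\<^sup>+w. ?M w * ?R w z * ?W z \<partial>lborel) \<partial>lborel) = (\<integral>\<^sup>+w. (\<integral>\<^sup>+z. ?M w * ?R w z * ?W z \<partial>lborel) \<partial>lborel)"
      by (rule lborel_pair.Fubini') measurable
    also have "\<dots> = (\<integral>\<^sup>+w. ?M w * berezin \<alpha> q m u \<psi> w \<partial>lborel)"
      unfolding berezin_eq by (simp add: nn_integral_cmult mult.assoc)
    finally show "fs_integral \<alpha> q m (wcomp u \<psi> f) \<le> ennreal C * (\<integral>\<^sup>+w. ?M w * berezin \<alpha> q m u \<psi> w \<partial>lborel)" .
  qed
qed

section \<open>Normalized kernels\<close>

text \<open>In modulus, \<open>fock_kernel \<alpha> v\<close> times the Gaussian weight is a Gaussian bump at \<open>v\<close>; division by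
\<open>(1 + norm v) ^ m\<close> makes its norm of order \<open>m\<close> bounded in \<open>v\<close>.\<close>

definition test_fun :: "real \<Rightarrow> nat \<Rightarrow> complex^'n \<Rightarrow> complex^'n \<Rightarrow> complex" where
  "test_fun \<alpha> m v \<zeta> = of_real (1 / (1 + norm v) ^ m) * fock_kernel \<alpha> v \<zeta>"

lemma entire_test_fun: "entire (test_fun \<alpha> m v)"
  unfolding test_fun_def[abs_def] by (intro entire_mult entire_const entire_fock_kernel)

lemma norm_test_fun: "norm (test_fun \<alpha> m v \<zeta>) = norm (fock_kernel \<alpha> v \<zeta>) / (1 + norm v) ^ m"
  unfolding test_fun_def norm_mult norm_of_real by simp

lemma energy_test_fun_bounded:
  assumes \<alpha>: "0 < \<alpha>" and p: "0 < p"
  shows "\<exists>M>0. \<forall>v. energy \<alpha> p m (test_fun \<alpha> m (v :: complex^'n)) \<le> ennreal M"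
proof -
  define g where "g x = (1 + norm x) powr (real m * p) * exp (- (\<alpha> * p / 2) * (norm x)\<^sup>2)" for x :: "complex^'n"
  have [measurable]: "g \<in> borel_measurable borel"
  proof -
    have "(\<lambda>z::complex^'n. exp (- (\<alpha> * p / 2) * (norm z)\<^sup>2)) \<in> borel_measurable borel"
      by (intro borel_measurable_continuous_onI continuous_on_gaussian)
    then show ?thesis unfolding g_def[abs_def] by (intro borel_measurable_times) measurable
  qed
  have "(\<integral>\<^sup>+x. ennreal (g x) \<partial>lborel) < \<infinity>"
    unfolding g_def using \<alpha> p by (intro nn_integral_weighted_gaussian_finite) auto
  then obtain I where I: "0 \<le> I" "(\<integral>\<^sup>+x. ennreal (g x) \<partial>lborel) = ennreal I"
    by (cases "\<integral>\<^sup>+x. ennreal (g x) \<partial>lborel") auto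
  \<comment> \<open>The summand \<open>1\<close> only serves to make the bound positive.\<close>
  have "energy \<alpha> p m (test_fun \<alpha> m v) \<le> ennreal (I + 1)" for v :: "complex^'n"
  proof -
    have "energy \<alpha> p m (test_fun \<alpha> m v) \<le> (\<integral>\<^sup>+x. ennreal (g (- v + x)) \<partial>lborel)"
      unfolding energy_def
    proof (intro nn_integral_mono ennreal_leI)
      fix x :: "complex^'n"
      have pos: "0 < 1 + norm y" for y :: "complex^'n" by (rule add_pos_nonneg) auto
      have "wmod \<alpha> m (test_fun \<alpha> m v) x powr p =
          (1 + norm x) powr (real m * p) / (1 + norm v) powr (real m * p) *
          (exp (\<alpha> * p / 2 * ((norm x)\<^sup>2 - (norm (x - v))\<^sup>2)) * exp (- (\<alpha> * p / 2) * (norm x)\<^sup>2))"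
        unfolding wmod_powr norm_test_fun
        using pos[of v] by (simp add: powr_divide norm_fock_kernel_powr power_powr_eq[OF pos])
      also have "exp (\<alpha> * p / 2 * ((norm x)\<^sup>2 - (norm (x - v))\<^sup>2)) * exp (- (\<alpha> * p / 2) * (norm x)\<^sup>2)
          = exp (- (\<alpha> * p / 2) * (norm (x - v))\<^sup>2)"
        by (simp add: algebra_simps flip: exp_add)
      also have "(1 + norm x) powr (real m * p) / (1 + norm v) powr (real m * p) \<le> (1 + norm (x - v)) powr (real m * p)"
        using one_plus_norm_powr_le[of "real m * p" x v] pos[of v] p by (simp add: field_simps)
      finally show "wmod \<alpha> m (test_fun \<alpha> m v) x powr p \<le> g (- v + x)"
        by (simp add: g_def)
    qed
    also have "\<dots> = (\<integral>\<^sup>+x. ennreal (g x) \<partial>lborel)"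
      by (rule nn_integral_lborel_shift) measurable
    also have "\<dots> \<le> ennreal (I + 1)" using I by (simp add: ennreal_leI)
    finally show ?thesis .
  qed
  then show ?thesis using I(1) by (intro exI[of _ "I + 1"]) auto
qed

lemma gaussian_convolution:
  fixes c :: real and \<zeta> w :: "'a::euclidean_space"
  shows "(\<integral>\<^sup>+v. ennreal (exp (- c * ((norm (\<zeta> - v))\<^sup>2 + (norm (v - w))\<^sup>2))) \<partial>lborel)
    = ennreal (exp (- (c / 2) * (norm (\<zeta> - w))\<^sup>2)) * (\<integral>\<^sup>+x. ennreal (exp (- (2 * c) * (norm x)\<^sup>2)) \<partial>(lborel :: 'a measure))"
proof -
  define a where "a = (1/2) *\<^sub>R (\<zeta> + w)"
  have m: "(\<lambda>v::'a. ennreal (exp (- (2 * c) * (norm v)\<^sup>2))) \<in> borel_measurable borel"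
    by (intro measurable_compose[OF _ measurable_ennreal] borel_measurable_continuous_onI continuous_intros)
  have square: "(norm (\<zeta> - v))\<^sup>2 + (norm (v - w))\<^sup>2 = 2 * (norm (- a + v))\<^sup>2 + (norm (\<zeta> - w))\<^sup>2 / 2" for v
    unfolding a_def power2_norm_eq_inner
    by (simp add: inner_diff_left inner_diff_right inner_add_left inner_add_right inner_commute field_simps)
  have "exp (- c * ((norm (\<zeta> - v))\<^sup>2 + (norm (v - w))\<^sup>2))
      = exp (- (c / 2) * (norm (\<zeta> - w))\<^sup>2) * exp (- (2 * c) * (norm (- a + v))\<^sup>2)" for v
    unfolding square exp_add[symmetric] by (simp add: algebra_simps)
  then have "(\<integral>\<^sup>+v. ennreal (exp (- c * ((norm (\<zeta> - v))\<^sup>2 + (norm (v - w))\<^sup>2))) \<partial>lborel)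
    = (\<integral>\<^sup>+v. ennreal (exp (- (c / 2) * (norm (\<zeta> - w))\<^sup>2)) * ennreal (exp (- (2 * c) * (norm (- a + v))\<^sup>2)) \<partial>lborel)"
    by (simp add: ennreal_mult)
  also have "\<dots> = ennreal (exp (- (c / 2) * (norm (\<zeta> - w))\<^sup>2)) * (\<integral>\<^sup>+v. ennreal (exp (- (2 * c) * (norm (- a + v))\<^sup>2)) \<partial>lborel)"
    by (rule nn_integral_cmult) (intro measurable_compose[OF _ measurable_ennreal] borel_measurable_continuous_onI continuous_intros, simp)
  also have "(\<integral>\<^sup>+v. ennreal (exp (- (2 * c) * (norm (- a + v))\<^sup>2)) \<partial>lborel) = (\<integral>\<^sup>+x. ennreal (exp (- (2 * c) * (norm x)\<^sup>2)) \<partial>(lborel :: 'a measure))"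
    by (rule nn_integral_lborel_shift[OF m])
  finally show ?thesis .
qed

definition gauss_weight :: "real \<Rightarrow> real \<Rightarrow> nat \<Rightarrow> complex^'n \<Rightarrow> real" where
  "gauss_weight \<alpha> q m x = (1 + norm x) powr (real m * q) * exp (- (\<alpha> * q / 2) * (norm x)\<^sup>2)"

lemma gauss_weight_nonneg [simp]: "0 \<le> gauss_weight \<alpha> q m x"
  by (simp add: gauss_weight_def)

lemma gauss_weight_measurable [measurable]: "gauss_weight \<alpha> q m \<in> borel_measurable borel"
proof -
  have "(\<lambda>z::complex^'a. exp (- (\<alpha> * q / 2) * (norm z)\<^sup>2)) \<in> borel_measurable borel"
    by (intro borel_measurable_continuous_onI continuous_on_gaussian)
  then show ?thesis unfolding gauss_weight_def[abs_def] by (intro borel_measurable_times) measurable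
qed

text \<open>As a function of \<open>\<zeta>\<close> the kernel is \<open>exp (\<alpha> * q / 2 * norm \<zeta> ^ 2)\<close> times a Gaussian at \<open>w\<close> divided
by \<open>(1 + norm \<zeta>) powr (m * q)\<close>. Replacing \<open>\<zeta>\<close> by \<open>w\<close> in the denominator costs half of the Gaussian.
What remains is a convolution of two of the original Gaussians, with variable \<open>v\<close>: one of them
belongs to the normalized kernel at \<open>v\<close>, the other one is the averaging weight.\<close>

lemma berezin_kernel_le_test_fun:
  assumes \<alpha>: "0 < \<alpha>" and q: "0 < q"
  shows "\<exists>C>0. \<forall>w \<zeta>. ennreal (berezin_kernel \<alpha> q m w \<zeta>) \<le> ennreal C *
    (\<integral>\<^sup>+v. ennreal (gauss_weight \<alpha> q m (v - w)) * ennreal (norm (test_fun \<alpha> m v (\<zeta> :: complex^'n)) powr q) \<partial>lborel)"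
proof -
  \<comment> \<open>The kernel, as a function of \<open>\<zeta>\<close>, contains the Gaussian \<open>exp (- c * norm (\<zeta> - w) ^ 2)\<close>.\<close>
  define c where "c = \<alpha> * q / 2"
  have c: "0 < c" using \<alpha> q by (simp add: c_def)
  define r where "r = real m * q"
  have r: "0 \<le> r" using q by (simp add: r_def)
  define G where "G = (\<integral>\<^sup>+x. ennreal (exp (- (2 * c) * (norm x)\<^sup>2)) \<partial>(lborel :: (complex^'n) measure))"
  have "G < \<infinity>" unfolding G_def using c by (intro nn_integral_gaussian_finite) simp
  moreover have "G \<noteq> 0"
  proof -
    have "ennreal (exp (- (2 * c))) * emeasure lborel (ball (0::complex^'n) 1)
        = (\<integral>\<^sup>+x\<in>ball (0::complex^'n) 1. ennreal (exp (- (2 * c))) \<partial>lborel)"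
      by (simp add: nn_integral_cmult_indicator)
    also have "\<dots> \<le> G"
      unfolding G_def
    proof (rule nn_integral_mono)
      fix x :: "complex^'n"
      have "2 * c * (norm x)\<^sup>2 \<le> 2 * c" if "norm x < 1"
        using that c by (simp add: mult_le_cancel_left2 power_le_one)
      then show "ennreal (exp (- (2 * c))) * indicator (ball 0 1) x \<le> ennreal (exp (- (2 * c) * (norm x)\<^sup>2))"
        by (auto simp: indicator_def intro!: ennreal_leI)
    qed
    finally have "ennreal (exp (- (2 * c)) * unit_ball_vol (real DIM(complex^'n))) \<le> G"
      by (simp add: emeasure_ball ennreal_mult)
    moreover have "0 < exp (- (2 * c)) * unit_ball_vol (real DIM(complex^'n))"
      by (intro mult_pos_pos unit_ball_vol_pos) auto
    ultimately show ?thesis by (metis ennreal_eq_0_iff le_zero_eq not_le)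
  qed
  ultimately obtain g where g: "0 < g" "G = ennreal g"
    by (cases G) (auto simp: zero_less_iff_neq_zero)
  define L where "L = exp (r\<^sup>2 / (2 * c))"
  have L: "0 < L" by (simp add: L_def)
  have pos: "0 < 1 + norm y" for y :: "complex^'n" by (rule add_pos_nonneg) auto
  have gw: "gauss_weight \<alpha> q m x = (1 + norm x) powr r * exp (- c * (norm x)\<^sup>2)" for x :: "complex^'n"
    by (simp add: gauss_weight_def r_def c_def)
  show ?thesis
  proof (intro exI[of _ "L / g"] conjI allI)
    show "0 < L / g" using L g by simp
    fix w \<zeta> :: "complex^'n"
    define A where "A = exp (c * (norm \<zeta>)\<^sup>2)"
    have A: "0 < A" by (simp add: A_def)
    have "berezin_kernel \<alpha> q m w \<zeta> = A * exp (- c * (norm (\<zeta> - w))\<^sup>2) / (1 + norm \<zeta>) powr r"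
      unfolding berezin_kernel_def norm_fock_kernel_powr A_def r_def c_def
      by (simp add: right_diff_distrib flip: exp_add)
    also have "\<dots> = A * exp (- c * (norm (\<zeta> - w))\<^sup>2) * (1 / (1 + norm \<zeta>) powr r)" by simp
    also have "\<dots> \<le> A * exp (- c * (norm (\<zeta> - w))\<^sup>2) * ((1 + norm (\<zeta> - w)) powr r / (1 + norm w) powr r)"
    proof (rule mult_left_mono)
      show "1 / (1 + norm \<zeta>) powr r \<le> (1 + norm (\<zeta> - w)) powr r / (1 + norm w) powr r"
        using one_plus_norm_powr_le[OF r, of w \<zeta>] pos[of w] pos[of \<zeta>]
        by (simp add: field_simps norm_minus_commute)
    qed (use A in simp)
    also have "\<dots> \<le> A * exp (- c * (norm (\<zeta> - w))\<^sup>2) * (L * exp (c / 2 * (norm (\<zeta> - w))\<^sup>2) / (1 + norm w) powr r)"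
      using powr_le_exp_square[of "norm (\<zeta> - w)" r "c/2"] A r c
      by (intro mult_left_mono divide_right_mono) (auto simp: L_def)
    also have "\<dots> = L * A / (1 + norm w) powr r * exp (- (c / 2) * (norm (\<zeta> - w))\<^sup>2)"
      by (simp add: mult_ac flip: exp_add)
    finally have le: "berezin_kernel \<alpha> q m w \<zeta> \<le> L * A / (1 + norm w) powr r * exp (- (c / 2) * (norm (\<zeta> - w))\<^sup>2)" .
    define D where "D = L * A / (1 + norm w) powr r"
    have D: "0 \<le> D" using L A by (simp add: D_def)
    have "ennreal (berezin_kernel \<alpha> q m w \<zeta>) \<le> ennreal (D / g) * (ennreal (exp (- (c / 2) * (norm (\<zeta> - w))\<^sup>2)) * G)"
      using le D g by (simp add: D_def[symmetric] ennreal_leI flip: ennreal_mult)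
    also have "\<dots> = ennreal (D / g) * (\<integral>\<^sup>+v. ennreal (exp (- c * ((norm (\<zeta> - v))\<^sup>2 + (norm (v - w))\<^sup>2))) \<partial>lborel)"
      unfolding G_def by (subst gaussian_convolution) simp
    also have "\<dots> = (\<integral>\<^sup>+v. ennreal (D / g) * ennreal (exp (- c * ((norm (\<zeta> - v))\<^sup>2 + (norm (v - w))\<^sup>2))) \<partial>lborel)"
    proof (rule nn_integral_cmult[symmetric])
      have "(\<lambda>v. exp (- c * ((norm (\<zeta> - v))\<^sup>2 + (norm (v - w))\<^sup>2))) \<in> borel_measurable borel"
        by (intro borel_measurable_continuous_onI continuous_intros)
      from measurable_compose[OF this measurable_ennreal]
      show "(\<lambda>v. ennreal (exp (- c * ((norm (\<zeta> - v))\<^sup>2 + (norm (v - w))\<^sup>2)))) \<in> borel_measurable lborel"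
        by simp
    qed
    also have "\<dots> \<le> (\<integral>\<^sup>+v. ennreal (L / g) * (ennreal (gauss_weight \<alpha> q m (v - w)) * ennreal (norm (test_fun \<alpha> m v \<zeta>) powr q)) \<partial>lborel)"
    proof (rule nn_integral_mono)
      fix v :: "complex^'n"
      have "1 / (1 + norm w) powr r \<le> (1 + norm (v - w)) powr r / (1 + norm v) powr r"
        using one_plus_norm_powr_le[OF r, of v w] pos[of w] pos[of v] by (simp add: field_simps)
      then have "L / g * (A * exp (- c * ((norm (\<zeta> - v))\<^sup>2 + (norm (v - w))\<^sup>2))) * (1 / (1 + norm w) powr r)
          \<le> L / g * (A * exp (- c * ((norm (\<zeta> - v))\<^sup>2 + (norm (v - w))\<^sup>2))) * ((1 + norm (v - w)) powr r / (1 + norm v) powr r)"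
        using L A g by (intro mult_left_mono) auto
      moreover have "norm (test_fun \<alpha> m v \<zeta>) powr q = A * exp (- c * (norm (\<zeta> - v))\<^sup>2) / (1 + norm v) powr r"
        using pos[of v]
        by (simp add: norm_test_fun powr_divide norm_fock_kernel_powr power_powr_eq[OF pos] A_def r_def c_def
            right_diff_distrib flip: exp_add)
      moreover have "exp (- c * ((norm (\<zeta> - v))\<^sup>2 + (norm (v - w))\<^sup>2)) = exp (- c * (norm (\<zeta> - v))\<^sup>2) * exp (- c * (norm (v - w))\<^sup>2)"
        by (simp add: distrib_left exp_add[symmetric] algebra_simps)
      ultimately have "D / g * exp (- c * ((norm (\<zeta> - v))\<^sup>2 + (norm (v - w))\<^sup>2))
          \<le> L / g * (gauss_weight \<alpha> q m (v - w) * norm (test_fun \<alpha> m v \<zeta>) powr q)"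
        by (simp add: D_def gw mult_ac)
      then show "ennreal (D / g) * ennreal (exp (- c * ((norm (\<zeta> - v))\<^sup>2 + (norm (v - w))\<^sup>2)))
          \<le> ennreal (L / g) * (ennreal (gauss_weight \<alpha> q m (v - w)) * ennreal (norm (test_fun \<alpha> m v \<zeta>) powr q))"
        using D L g by (simp add: ennreal_leI flip: ennreal_mult)
    qed
    also have "\<dots> = ennreal (L / g) * (\<integral>\<^sup>+v. ennreal (gauss_weight \<alpha> q m (v - w)) * ennreal (norm (test_fun \<alpha> m v \<zeta>) powr q) \<partial>lborel)"
    proof (rule nn_integral_cmult)
      have "(\<lambda>v. norm (test_fun \<alpha> m v \<zeta>) powr q) \<in> borel_measurable borel"
        unfolding norm_test_fun using pos
        by (simp add: powr_divide less_imp_le)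
      then show "(\<lambda>v. ennreal (gauss_weight \<alpha> q m (v - w)) * ennreal (norm (test_fun \<alpha> m v \<zeta>) powr q)) \<in> borel_measurable lborel"
        by measurable
    qed
    finally show "ennreal (berezin_kernel \<alpha> q m w \<zeta>) \<le> ennreal (L / g) *
      (\<integral>\<^sup>+v. ennreal (gauss_weight \<alpha> q m (v - w)) * ennreal (norm (test_fun \<alpha> m v \<zeta>) powr q) \<partial>lborel)" .
  qed
qed

lemma test_fun_powr_measurable [measurable]:
  fixes f g :: "'a \<Rightarrow> complex^'n"
  assumes [measurable]: "f \<in> borel_measurable M" "g \<in> borel_measurable M"
  shows "(\<lambda>x. norm (test_fun \<alpha> m (f x) (g x)) powr q) \<in> borel_measurable M"
proof -
  have "(\<lambda>x. norm (fock_kernel \<alpha> (f x) (g x)) powr q / ((1 + norm (f x)) ^ m) powr q) \<in> borel_measurable M"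
    by measurable
  then show ?thesis by (simp add: norm_test_fun powr_divide)
qed

lemma berezin_le_test_fun:
  assumes \<alpha>: "0 < \<alpha>" and q: "0 < q"
  shows "\<exists>C>0. \<forall>u \<psi> w. u \<in> borel_measurable borel \<longrightarrow> \<psi> \<in> borel_measurable borel \<longrightarrow>
    berezin \<alpha> q m u \<psi> w \<le> ennreal C *
    (\<integral>\<^sup>+v. ennreal (gauss_weight \<alpha> q m (v - w)) * fs_integral \<alpha> q m (wcomp u \<psi> (test_fun \<alpha> m (v :: complex^'n))) \<partial>lborel)"
proof -
  obtain C where C: "0 < C" "\<And>w \<zeta>. ennreal (berezin_kernel \<alpha> q m w \<zeta>) \<le> ennreal C *
    (\<integral>\<^sup>+v. ennreal (gauss_weight \<alpha> q m (v - w)) * ennreal (norm (test_fun \<alpha> m v (\<zeta> :: complex^'n)) powr q) \<partial>lborel)"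
    using berezin_kernel_le_test_fun[OF \<alpha> q, where 'n='n and m=m] by blast
  show ?thesis
  proof (intro exI[of _ C] conjI allI impI C(1))
    fix u :: "complex^'n \<Rightarrow> complex" and \<psi> :: "complex^'n \<Rightarrow> complex^'n" and w :: "complex^'n"
    assume [measurable]: "u \<in> borel_measurable borel" "\<psi> \<in> borel_measurable borel"
    let ?W = "\<lambda>z. ennreal (source_weight \<alpha> q m u z)" and ?g = "\<lambda>v. ennreal (gauss_weight \<alpha> q m (v - w))"
    let ?t = "\<lambda>v z. ennreal (norm (test_fun \<alpha> m v (\<psi> z)) powr q)"
    have "berezin \<alpha> q m u \<psi> w \<le> (\<integral>\<^sup>+z. (ennreal C * (\<integral>\<^sup>+v. ?g v * ?t v z \<partial>lborel)) * ?W z \<partial>lborel)"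
      unfolding berezin_eq by (intro nn_integral_mono mult_right_mono C) simp
    also have "\<dots> = ennreal C * (\<integral>\<^sup>+z. (\<integral>\<^sup>+v. ?g v * ?t v z \<partial>lborel) * ?W z \<partial>lborel)"
      unfolding mult.assoc by (rule nn_integral_cmult) measurable
    also have "(\<integral>\<^sup>+z. (\<integral>\<^sup>+v. ?g v * ?t v z \<partial>lborel) * ?W z \<partial>lborel) = (\<integral>\<^sup>+z. (\<integral>\<^sup>+v. ?g v * ?t v z * ?W z \<partial>lborel) \<partial>lborel)"
      by (simp add: nn_integral_multc)
    also have "(\<integral>\<^sup>+z. (\<integral>\<^sup>+v. ?g v * ?t v z * ?W z \<partial>lborel) \<partial>lborel) = (\<integral>\<^sup>+v. (\<integral>\<^sup>+z. ?g v * ?t v z * ?W z \<partial>lborel) \<partial>lborel)"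
      by (rule lborel_pair.Fubini') measurable
    also have "\<dots> = (\<integral>\<^sup>+v. ?g v * fs_integral \<alpha> q m (wcomp u \<psi> (test_fun \<alpha> m v)) \<partial>lborel)"
      unfolding fs_integral_wcomp by (simp add: nn_integral_cmult mult.assoc)
    finally show "berezin \<alpha> q m u \<psi> w \<le> ennreal C *
      (\<integral>\<^sup>+v. ?g v * fs_integral \<alpha> q m (wcomp u \<psi> (test_fun \<alpha> m v)) \<partial>lborel)" .
  qed
qed

section \<open>Elementary properties of the norms\<close>

lemma entire_wcomp:
  "entire u \<Longrightarrow> entire_map \<psi> \<Longrightarrow> entire f \<Longrightarrow> entire (wcomp u \<psi> f)"
  unfolding wcomp_def by (rule entire_mult[OF _ entire_compose])

lemma fs_integral_cmult:
  assumes "entire f" "0 \<le> c"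
  shows "fs_integral \<alpha> p m (\<lambda>z. of_real c * f z) = ennreal (c powr p) * fs_integral \<alpha> p m f"
proof -
  have [measurable]: "f \<in> borel_measurable borel" using assms(1) by (rule entire_measurable)
  have "fs_integral \<alpha> p m (\<lambda>z. of_real c * f z) = (\<integral>\<^sup>+z. ennreal (c powr p) *
      ennreal ((norm z ^ m) powr p * norm (f z) powr p * exp (- (\<alpha> * p / 2) * (norm z)\<^sup>2)) \<partial>lborel)"
    unfolding fs_integral_def using assms(2)
    by (intro nn_integral_cong) (simp add: norm_mult powr_mult mult_ac flip: ennreal_mult)
  also have "\<dots> = ennreal (c powr p) * fs_integral \<alpha> p m f"
    unfolding fs_integral_def by (rule nn_integral_cmult) measurable
  finally show ?thesis .
qed

lemma fs_integral_triangle: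
  assumes "entire f" "entire g" "0 \<le> p" and h: "\<And>z. norm (h z) \<le> norm (f z) + norm (g z)"
  shows "fs_integral \<alpha> p m h \<le> ennreal (2 powr p) * (fs_integral \<alpha> p m f + fs_integral \<alpha> p m g)"
proof -
  have [measurable]: "f \<in> borel_measurable borel" "g \<in> borel_measurable borel"
    using assms by (auto intro: entire_measurable)
  let ?a = "\<lambda>z. (norm z ^ m) powr p" and ?e = "\<lambda>z. exp (- (\<alpha> * p / 2) * (norm z)\<^sup>2)"
  have "fs_integral \<alpha> p m h \<le> (\<integral>\<^sup>+z. ennreal (2 powr p) *
      (ennreal (?a z * norm (f z) powr p * ?e z) + ennreal (?a z * norm (g z) powr p * ?e z)) \<partial>lborel)"
    unfolding fs_integral_def
  proof (rule nn_integral_mono)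
    fix z
    have "norm (h z) powr p \<le> (norm (f z) + norm (g z)) powr p"
      using assms(3) by (intro powr_mono2 h) auto
    also have "\<dots> \<le> 2 powr p * (norm (f z) powr p + norm (g z) powr p)"
      using assms(3) by (intro powr_add_le) auto
    finally have "?a z * norm (h z) powr p * ?e z \<le> ?a z * (2 powr p * (norm (f z) powr p + norm (g z) powr p)) * ?e z"
      by (intro mult_right_mono mult_left_mono) auto
    then show "ennreal (?a z * norm (h z) powr p * ?e z) \<le> ennreal (2 powr p) *
        (ennreal (?a z * norm (f z) powr p * ?e z) + ennreal (?a z * norm (g z) powr p * ?e z))"
      by (simp add: algebra_simps ennreal_leI flip: ennreal_mult ennreal_plus)
  qed
  also have "\<dots> = ennreal (2 powr p) * (fs_integral \<alpha> p m f + fs_integral \<alpha> p m g)"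
    unfolding fs_integral_def by (subst nn_integral_cmult) (simp_all add: nn_integral_add)
  finally show ?thesis .
qed

lemma fs_norm_powr:
  assumes "0 < p"
  shows "enn_powr (fs_norm \<alpha> p m (f :: complex^'n \<Rightarrow> complex)) p = ennreal (fs_const \<alpha> p m CARD('n)) * fs_integral \<alpha> p m f"
  using assms by (simp add: fs_norm_fs_integral)

lemma fs_norm_cmult:
  assumes "entire (f :: complex^'n \<Rightarrow> complex)" "0 < c" "0 < p"
  shows "fs_norm \<alpha> p m (\<lambda>z. of_real c * f z) = ennreal c * fs_norm \<alpha> p m f"
proof -
  have "fs_norm \<alpha> p m (\<lambda>z. of_real c * f z) =
      enn_powr (ennreal (c powr p) * (ennreal (fs_const \<alpha> p m CARD('n)) * fs_integral \<alpha> p m f)) (1 / p)"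
    using assms by (simp add: fs_norm_fs_integral fs_integral_cmult mult_ac)
  also have "\<dots> = ennreal ((c powr p) powr (1 / p)) * fs_norm \<alpha> p m f"
    using assms unfolding fs_norm_fs_integral by (intro enn_powr_mult) simp
  finally show ?thesis using assms by (simp add: powr_powr)
qed

lemma fs_norm_finite:
  assumes "0 < \<alpha>" "0 < p" "f \<in> fock_sobolev \<alpha> p m"
  shows "entire f" "fs_norm \<alpha> p m (f :: complex^'n \<Rightarrow> complex) < \<infinity>" "fs_integral \<alpha> p m f < \<infinity>"
proof -
  show "entire f" using assms by (simp add: fock_sobolev_iff)
  show "fs_integral \<alpha> p m f < \<infinity>"
    using assms fs_integral_le_energy[of p \<alpha> m f] by (simp add: fock_sobolev_iff le_less_trans)
  then show "fs_norm \<alpha> p m f < \<infinity>"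
    unfolding fs_norm_fs_integral enn_powr_finite_iff by (simp add: ennreal_mult_less_top)
qed

lemma fock_sobolevI:
  assumes "0 < \<alpha>" "0 < p" and f: "entire f" and fin: "fs_integral \<alpha> p m (f :: complex^'n \<Rightarrow> complex) < \<infinity>"
  shows "f \<in> fock_sobolev \<alpha> p m"
proof -
  obtain C where "energy \<alpha> p m f \<le> ennreal C * fs_integral \<alpha> p m f"
    using energy_le_fs_integral[of \<alpha> p, where 'n='n and m=m] assms(1,2) f by auto
  also have "\<dots> < \<infinity>" using fin by (simp add: ennreal_mult_less_top)
  finally show ?thesis using assms by (simp add: fock_sobolev_iff)
qed

lemma fs_integral_finite_iff_norm:
  assumes "0 < \<alpha>" "0 < p"
  shows "fs_norm \<alpha> p m (f :: complex^'n \<Rightarrow> complex) < \<infinity> \<longleftrightarrow> fs_integral \<alpha> p m f < \<infinity>"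
  using fs_const_pos[OF assms, of "CARD('n)" m]
  unfolding fs_norm_fs_integral enn_powr_finite_iff by (auto simp: ennreal_mult_less_top)

section \<open>Boundedness\<close>

lemma energy_le_fs_norm_embedding:
  assumes \<alpha>: "0 < \<alpha>" and p: "0 < p" "p \<le> q"
  shows "\<exists>C>0. \<forall>f. entire (f :: complex^'n \<Rightarrow> complex) \<longrightarrow>
    energy \<alpha> q m f \<le> ennreal C * enn_powr (fs_norm \<alpha> p m f) q"
proof -
  obtain C1 where C1: "0 < C1" "\<And>f. entire (f :: complex^'n \<Rightarrow> complex) \<Longrightarrow>
      energy \<alpha> q m f \<le> ennreal C1 * enn_powr (enn_powr (energy \<alpha> p m f) (1 / p)) q"
    using energy_embedding[OF assms, where 'n='n and m=m] by blast
  obtain C2 where C2: "0 < C2" "\<And>f. entire (f :: complex^'n \<Rightarrow> complex) \<Longrightarrow>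
      enn_powr (energy \<alpha> p m f) (1 / p) \<le> ennreal C2 * fs_norm \<alpha> p m f"
    using energy_le_fs_norm[OF \<alpha> p(1), where 'n='n and m=m] by blast
  show ?thesis
  proof (intro exI[of _ "C1 * C2 powr q"] conjI allI impI)
    show "0 < C1 * C2 powr q" using C1 C2 by simp
    fix f :: "complex^'n \<Rightarrow> complex" assume f: "entire f"
    have "energy \<alpha> q m f \<le> ennreal C1 * enn_powr (enn_powr (energy \<alpha> p m f) (1 / p)) q"
      by (rule C1(2)[OF f])
    also have "\<dots> \<le> ennreal C1 * enn_powr (ennreal C2 * fs_norm \<alpha> p m f) q"
      using p by (intro mult_left_mono enn_powr_mono C2 f) auto
    also have "\<dots> = ennreal (C1 * C2 powr q) * enn_powr (fs_norm \<alpha> p m f) q"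
      using C1 C2 by (simp add: enn_powr_mult ennreal_mult mult.assoc)
    finally show "energy \<alpha> q m f \<le> ennreal (C1 * C2 powr q) * enn_powr (fs_norm \<alpha> p m f) q" .
  qed
qed

text \<open>In the bound by \<open>wmod \<alpha> m f w powr q * berezin \<alpha> q m u \<psi> w\<close> the transform is replaced by its essential
supremum; what is left is the \<open>q\<close>-energy of \<open>f\<close>, which the embedding bounds by the norm with exponent \<open>p\<close>.\<close>

lemma fs_norm_wcomp_le:
  assumes \<alpha>: "0 < \<alpha>" and p: "0 < p" "p \<le> q"
  shows "\<exists>C>0. \<forall>u \<psi> f. entire u \<longrightarrow> entire_map \<psi> \<longrightarrow> entire (f :: complex^'n \<Rightarrow> complex) \<longrightarrow>
    fs_norm \<alpha> q m (wcomp u \<psi> f) \<le>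
      ennreal C * enn_powr (esssup lborel (berezin \<alpha> q m u \<psi>)) (1 / q) * fs_norm \<alpha> p m f"
proof -
  have q: "0 < q" using p by simp
  obtain C1 where C1: "0 < C1" "\<And>f u \<psi>. entire (f :: complex^'n \<Rightarrow> complex) \<Longrightarrow>
      u \<in> borel_measurable borel \<Longrightarrow> \<psi> \<in> borel_measurable borel \<Longrightarrow>
      fs_integral \<alpha> q m (wcomp u \<psi> f) \<le>
      ennreal C1 * (\<integral>\<^sup>+w. ennreal (wmod \<alpha> m f w powr q) * berezin \<alpha> q m u \<psi> w \<partial>lborel)"
    using fs_integral_wcomp_le_berezin[of \<alpha> q, where 'n='n and m=m] \<alpha> q by auto
  obtain C2 where C2: "0 < C2" "\<And>f. entire (f :: complex^'n \<Rightarrow> complex) \<Longrightarrow>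
      energy \<alpha> q m f \<le> ennreal C2 * enn_powr (fs_norm \<alpha> p m f) q"
    using energy_le_fs_norm_embedding[OF assms, where 'n='n and m=m] by blast
  define c where "c = fs_const \<alpha> q m CARD('n)"
  have c: "0 < c" using \<alpha> q by (simp add: c_def fs_const_pos)
  show ?thesis
  proof (intro exI[of _ "(c * C1 * C2) powr (1 / q)"] conjI allI impI)
    show "0 < (c * C1 * C2) powr (1 / q)" using c C1 C2 by simp
    fix u f :: "complex^'n \<Rightarrow> complex" and \<psi> :: "complex^'n \<Rightarrow> complex^'n"
    assume u: "entire u" and psi: "entire_map \<psi>" and f: "entire f"
    have [measurable]: "u \<in> borel_measurable borel" "\<psi> \<in> borel_measurable borel" "f \<in> borel_measurable borel"
      using u psi f by (auto intro: entire_measurable entire_map_measurable)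
    define S where "S = esssup lborel (berezin \<alpha> q m u \<psi>)"
    have "fs_integral \<alpha> q m (wcomp u \<psi> f) \<le>
        ennreal C1 * (\<integral>\<^sup>+w. ennreal (wmod \<alpha> m f w powr q) * berezin \<alpha> q m u \<psi> w \<partial>lborel)"
      by (rule C1(2)[OF f]) measurable
    also have "\<dots> \<le> ennreal C1 * (\<integral>\<^sup>+w. ennreal (wmod \<alpha> m f w powr q) * S \<partial>lborel)"
    proof (intro mult_left_mono nn_integral_mono_AE)
      have "AE w in lborel. berezin \<alpha> q m u \<psi> w \<le> S" unfolding S_def by (rule esssup_AE)
      then show "AE w in lborel. ennreal (wmod \<alpha> m f w powr q) * berezin \<alpha> q m u \<psi> w \<le> ennreal (wmod \<alpha> m f w powr q) * S"
        by (auto elim!: eventually_mono intro: mult_left_mono)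
    qed simp
    also have "\<dots> = ennreal C1 * (energy \<alpha> q m f * S)"
      unfolding energy_def by (subst nn_integral_multc) simp_all
    also have "\<dots> \<le> ennreal C1 * ((ennreal C2 * enn_powr (fs_norm \<alpha> p m f) q) * S)"
      by (intro mult_left_mono mult_right_mono C2 f) auto
    finally have "ennreal c * fs_integral \<alpha> q m (wcomp u \<psi> f) \<le>
        ennreal c * (ennreal C1 * ((ennreal C2 * enn_powr (fs_norm \<alpha> p m f) q) * S))"
      by (rule mult_left_mono) simp
    also have "\<dots> = ennreal (c * C1 * C2) * (S * enn_powr (fs_norm \<alpha> p m f) q)"
      using c C1 C2 by (simp add: ennreal_mult mult_ac)
    finally have "fs_norm \<alpha> q m (wcomp u \<psi> f) \<le> enn_powr (ennreal (c * C1 * C2) * (S * enn_powr (fs_norm \<alpha> p m f) q)) (1 / q)"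
      unfolding fs_norm_fs_integral c_def[symmetric] using q by (intro enn_powr_mono) auto
    also have "\<dots> = ennreal ((c * C1 * C2) powr (1 / q)) * enn_powr S (1 / q) * fs_norm \<alpha> p m f"
      using q c C1 C2 by (simp add: enn_powr_ennreal enn_powr_times mult.assoc)
    finally show "fs_norm \<alpha> q m (wcomp u \<psi> f) \<le>
      ennreal ((c * C1 * C2) powr (1 / q)) * enn_powr (esssup lborel (berezin \<alpha> q m u \<psi>)) (1 / q) * fs_norm \<alpha> p m f"
      by (simp add: S_def)
  qed
qed

lemma bounded_fs_if_in_Linf:
  fixes u :: "complex^'n \<Rightarrow> complex"
  assumes \<alpha>: "0 < \<alpha>" and p: "0 < p" "p \<le> q" and u: "entire u" and psi: "entire_map \<psi>"
    and Linf: "in_Linf (berezin \<alpha> q m u \<psi>)"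
  shows "bounded_fs \<alpha> p q m (wcomp u \<psi>)"
proof -
  have q: "0 < q" using p by simp
  obtain C where C: "0 < C" "\<And>f. entire (f :: complex^'n \<Rightarrow> complex) \<Longrightarrow>
    fs_norm \<alpha> q m (wcomp u \<psi> f) \<le>
      ennreal C * enn_powr (esssup lborel (berezin \<alpha> q m u \<psi>)) (1 / q) * fs_norm \<alpha> p m f"
    using fs_norm_wcomp_le[OF \<alpha> p, where 'n='n and m=m] u psi by blast
  define S where "S = enn_powr (esssup lborel (berezin \<alpha> q m u \<psi>)) (1 / q)"
  have "S < \<infinity>" using Linf by (simp only: S_def enn_powr_finite_iff in_Linf_def)
  then obtain s where s: "0 \<le> s" "S = ennreal s" by (cases S) auto
  have bd: "fs_norm \<alpha> q m (wcomp u \<psi> f) \<le> ennreal (C * s) * fs_norm \<alpha> p m f" if "entire f" for f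
    using C(2)[OF that] C(1) s by (simp add: S_def[symmetric] ennreal_mult)
  have "wcomp u \<psi> f \<in> fock_sobolev \<alpha> q m" if f: "f \<in> fock_sobolev \<alpha> p m" for f
  proof (rule fock_sobolevI[OF \<alpha> q])
    show "entire (wcomp u \<psi> f)" using u psi fs_norm_finite(1)[OF \<alpha> p(1) f] by (rule entire_wcomp)
    have "fs_norm \<alpha> q m (wcomp u \<psi> f) < \<infinity>"
      using bd[OF fs_norm_finite(1)[OF \<alpha> p(1) f]] fs_norm_finite(2)[OF \<alpha> p(1) f]
      by (simp add: le_less_trans ennreal_mult_less_top)
    then show "fs_integral \<alpha> q m (wcomp u \<psi> f) < \<infinity>" by (simp only: fs_integral_finite_iff_norm[OF \<alpha> q])
  qed
  then show ?thesis
    unfolding bounded_fs_def maps_fs_def using bd fs_norm_finite(1)[OF \<alpha> p(1)] by blast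
qed

lemma test_fun_fs_norm_bounded:
  assumes \<alpha>: "0 < \<alpha>" and p: "0 < p"
  shows "\<exists>c>0. \<forall>v :: complex^'n. test_fun \<alpha> m v \<in> fock_sobolev \<alpha> p m \<and> fs_norm \<alpha> p m (test_fun \<alpha> m v) \<le> ennreal c"
proof -
  obtain M where M: "0 < M" "\<And>v :: complex^'n. energy \<alpha> p m (test_fun \<alpha> m v) \<le> ennreal M"
    using energy_test_fun_bounded[OF assms, where 'n='n and m=m] by blast
  obtain C where C: "0 < C" "\<And>f :: complex^'n \<Rightarrow> complex.
    fs_norm \<alpha> p m f \<le> ennreal C * enn_powr (energy \<alpha> p m f) (1 / p)"
    using fs_norm_le_energy[OF assms, where 'n='n and m=m] by blast
  show ?thesis
  proof (intro exI[of _ "C * M powr (1 / p)"] conjI allI)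
    show "0 < C * M powr (1 / p)" using C M by simp
    fix v :: "complex^'n"
    show "test_fun \<alpha> m v \<in> fock_sobolev \<alpha> p m"
      using M(2)[of v] assms by (simp add: fock_sobolev_iff entire_test_fun le_less_trans)
    have "fs_norm \<alpha> p m (test_fun \<alpha> m v) \<le> ennreal C * enn_powr (energy \<alpha> p m (test_fun \<alpha> m v)) (1 / p)"
      by (rule C(2))
    also have "\<dots> \<le> ennreal C * enn_powr (ennreal M) (1 / p)"
      using p by (intro mult_left_mono enn_powr_mono M) auto
    also have "\<dots> = ennreal (C * M powr (1 / p))" using C M by (simp add: enn_powr_ennreal ennreal_mult)
    finally show "fs_norm \<alpha> p m (test_fun \<alpha> m v) \<le> ennreal (C * M powr (1 / p))" .
  qed
qed

lemma berezin_le_sup_test_fun: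
  assumes \<alpha>: "0 < \<alpha>" and q: "0 < q"
  shows "\<exists>C>0. \<forall>u \<psi> S w. entire u \<longrightarrow> entire_map \<psi> \<longrightarrow>
    (\<forall>v. fs_integral \<alpha> q m (wcomp u \<psi> (test_fun \<alpha> m (v :: complex^'n))) \<le> S) \<longrightarrow>
    berezin \<alpha> q m u \<psi> w \<le> ennreal C * S"
proof -
  obtain C where C: "0 < C" "\<And>u \<psi> w. u \<in> borel_measurable borel \<Longrightarrow> \<psi> \<in> borel_measurable borel \<Longrightarrow>
    berezin \<alpha> q m u \<psi> w \<le> ennreal C *
    (\<integral>\<^sup>+v. ennreal (gauss_weight \<alpha> q m (v - w)) * fs_integral \<alpha> q m (wcomp u \<psi> (test_fun \<alpha> m (v :: complex^'n))) \<partial>lborel)"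
    using berezin_le_test_fun[OF assms, where 'n='n and m=m] by blast
  have "(\<integral>\<^sup>+x. ennreal (gauss_weight \<alpha> q m x) \<partial>(lborel :: (complex^'n) measure)) < \<infinity>"
    unfolding gauss_weight_def using \<alpha> q by (intro nn_integral_weighted_gaussian_finite) auto
  then obtain K where K: "0 \<le> K" "(\<integral>\<^sup>+x. ennreal (gauss_weight \<alpha> q m x) \<partial>(lborel :: (complex^'n) measure)) = ennreal K"
    by (cases "\<integral>\<^sup>+x. ennreal (gauss_weight \<alpha> q m x) \<partial>(lborel :: (complex^'n) measure)") auto
  show ?thesis
  proof (intro exI[of _ "C * (K + 1)"] conjI allI impI)
    show "0 < C * (K + 1)" using C K by simp
    fix u \<psi> S and w :: "complex^'n"
    assume u: "entire u" "entire_map \<psi>" and S: "\<forall>v. fs_integral \<alpha> q m (wcomp u \<psi> (test_fun \<alpha> m (v :: complex^'n))) \<le> S"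
    have "berezin \<alpha> q m u \<psi> w \<le> ennreal C *
      (\<integral>\<^sup>+v. ennreal (gauss_weight \<alpha> q m (v - w)) * fs_integral \<alpha> q m (wcomp u \<psi> (test_fun \<alpha> m v)) \<partial>lborel)"
      using u by (intro C entire_measurable entire_map_measurable)
    also have "\<dots> \<le> ennreal C * (\<integral>\<^sup>+v. ennreal (gauss_weight \<alpha> q m (- w + v)) * S \<partial>lborel)"
      using S by (intro mult_left_mono nn_integral_mono) (auto intro: mult_left_mono)
    also have "\<dots> = ennreal C * ((\<integral>\<^sup>+v. ennreal (gauss_weight \<alpha> q m (- w + v)) \<partial>lborel) * S)"
      by (subst nn_integral_multc) simp_all
    also have "(\<integral>\<^sup>+v. ennreal (gauss_weight \<alpha> q m (- w + v)) \<partial>lborel) = ennreal K"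
      unfolding K(2)[symmetric] by (rule nn_integral_lborel_shift) measurable
    also have "ennreal C * (ennreal K * S) = ennreal (C * K) * S"
      using C K by (simp add: ennreal_mult mult.assoc)
    also have "\<dots> \<le> ennreal (C * (K + 1)) * S"
      using C by (intro mult_right_mono ennreal_leI) auto
    finally show "berezin \<alpha> q m u \<psi> w \<le> ennreal (C * (K + 1)) * S" .
  qed
qed

text \<open>The test functions, divided by a bound for their norms, lie in the unit ball over which the
operator norm is taken, so all their images are bounded by the operator norm, and hence so is the
Gaussian average of these images.\<close>

lemma berezin_le_opnorm:
  assumes \<alpha>: "0 < \<alpha>" and p: "0 < p" and q: "0 < q"
  shows "\<exists>C>0. \<forall>u \<psi> w. entire u \<longrightarrow> entire_map (\<psi> :: complex^'n \<Rightarrow> complex^'n) \<longrightarrow>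
    berezin \<alpha> q m u \<psi> w \<le> ennreal C * enn_powr (opnorm_fs \<alpha> p q m (wcomp u \<psi>)) q"
proof -
  obtain C where C: "0 < C" "\<And>u \<psi> S w. entire u \<Longrightarrow> entire_map \<psi> \<Longrightarrow>
    (\<And>v. fs_integral \<alpha> q m (wcomp u \<psi> (test_fun \<alpha> m (v :: complex^'n))) \<le> S) \<Longrightarrow>
    berezin \<alpha> q m u \<psi> w \<le> ennreal C * S"
    using berezin_le_sup_test_fun[OF \<alpha> q, where 'n='n and m=m] by blast
  obtain c where c: "0 < c" "\<And>v :: complex^'n. test_fun \<alpha> m v \<in> fock_sobolev \<alpha> p m"
    "\<And>v :: complex^'n. fs_norm \<alpha> p m (test_fun \<alpha> m v) \<le> ennreal c"
    using test_fun_fs_norm_bounded[OF \<alpha> p, where 'n='n and m=m] by blast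
  define b where "b = fs_const \<alpha> q m CARD('n)"
  have b: "0 < b" using \<alpha> q by (simp add: b_def fs_const_pos)
  show ?thesis
  proof (intro exI[of _ "C * (c powr q / b)"] conjI allI impI)
    show "0 < C * (c powr q / b)" using C c b by simp
    fix u :: "complex^'n \<Rightarrow> complex" and \<psi> :: "complex^'n \<Rightarrow> complex^'n" and w
    assume u: "entire u" and psi: "entire_map \<psi>"
    define N where "N = opnorm_fs \<alpha> p q m (wcomp u \<psi>)"
    have "fs_integral \<alpha> q m (wcomp u \<psi> (test_fun \<alpha> m v)) \<le> ennreal (c powr q / b) * enn_powr N q" for v
    proof -
      let ?t = "test_fun \<alpha> m v"
      define g where "g = (\<lambda>z. of_real (1 / c) * ?t z)"
      have g_norm: "fs_norm \<alpha> p m g = ennreal (1 / c) * fs_norm \<alpha> p m ?t"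
        unfolding g_def using c p by (intro fs_norm_cmult entire_test_fun) auto
      also have "\<dots> \<le> ennreal (1 / c) * ennreal c" by (intro mult_left_mono c) simp
      also have "\<dots> = 1" using c by (simp flip: ennreal_mult)
      finally have "fs_norm \<alpha> p m g \<le> 1" .
      have g: "entire g" unfolding g_def by (intro entire_mult entire_const entire_test_fun)
      have "g \<in> fock_sobolev \<alpha> p m"
      proof (rule fock_sobolevI[OF \<alpha> p g])
        have "fs_norm \<alpha> p m g < \<infinity>" using \<open>fs_norm \<alpha> p m g \<le> 1\<close> by (simp add: le_less_trans)
        then show "fs_integral \<alpha> p m g < \<infinity>" by (simp only: fs_integral_finite_iff_norm[OF \<alpha> p])
      qed
      with \<open>fs_norm \<alpha> p m g \<le> 1\<close> have "fs_norm \<alpha> q m (wcomp u \<psi> g) \<le> N"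
        unfolding N_def opnorm_fs_def by (intro SUP_upper) simp
      moreover have "wcomp u \<psi> ?t = (\<lambda>z. of_real c * wcomp u \<psi> g z)"
        using c by (simp add: wcomp_def g_def fun_eq_iff)
      then have "fs_norm \<alpha> q m (wcomp u \<psi> ?t) = ennreal c * fs_norm \<alpha> q m (wcomp u \<psi> g)"
        using fs_norm_cmult[OF entire_wcomp[OF u psi g] c(1) q, of \<alpha> m] by simp
      ultimately have "fs_norm \<alpha> q m (wcomp u \<psi> ?t) \<le> ennreal c * N"
        by (simp add: mult_left_mono)
      then have "enn_powr (fs_norm \<alpha> q m (wcomp u \<psi> ?t)) q \<le> enn_powr (ennreal c * N) q"
        using q by (intro enn_powr_mono) auto
      then have "ennreal b * fs_integral \<alpha> q m (wcomp u \<psi> ?t) \<le> ennreal (c powr q) * enn_powr N q"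
        using c q by (simp add: fs_norm_powr b_def enn_powr_mult)
      then have "ennreal (1 / b) * (ennreal b * fs_integral \<alpha> q m (wcomp u \<psi> ?t)) \<le> ennreal (1 / b) * (ennreal (c powr q) * enn_powr N q)"
        by (rule mult_left_mono) simp
      then show ?thesis using b by (simp add: mult.assoc[symmetric] flip: ennreal_mult)
    qed
    then have "berezin \<alpha> q m u \<psi> w \<le> ennreal C * (ennreal (c powr q / b) * enn_powr N q)"
      by (rule C(2)[OF u psi])
    also have "\<dots> = ennreal (C * (c powr q / b)) * enn_powr N q"
      using C b by (subst ennreal_mult) (auto simp: mult.assoc)
    finally show "berezin \<alpha> q m u \<psi> w \<le> ennreal (C * (c powr q / b)) * enn_powr N q" .
  qed
qed

lemma opnorm_fs_finite:
  fixes T :: "(complex^'n \<Rightarrow> complex) \<Rightarrow> complex^'n \<Rightarrow> complex"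
  assumes "bounded_fs \<alpha> p q m T" shows "opnorm_fs \<alpha> p q m T < \<infinity>"
proof -
  obtain C :: real where C: "\<And>f. f \<in> fock_sobolev \<alpha> p m \<Longrightarrow> fs_norm \<alpha> q m (T f) \<le> ennreal C * fs_norm \<alpha> p m f"
    using assms unfolding bounded_fs_def by blast
  have "opnorm_fs \<alpha> p q m T \<le> ennreal C"
    unfolding opnorm_fs_def
  proof (rule SUP_least)
    fix f :: "complex^'n \<Rightarrow> complex" assume f: "f \<in> {f \<in> fock_sobolev \<alpha> p m. fs_norm \<alpha> p m f \<le> 1}"
    then have "fs_norm \<alpha> q m (T f) \<le> ennreal C * fs_norm \<alpha> p m f" using C by simp
    also have "\<dots> \<le> ennreal C * 1" using f by (intro mult_left_mono) auto
    finally show "fs_norm \<alpha> q m (T f) \<le> ennreal C" by simp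
  qed
  then show ?thesis by (simp add: le_less_trans)
qed

lemma opnorm_fs_le:
  fixes T :: "(complex^'n \<Rightarrow> complex) \<Rightarrow> complex^'n \<Rightarrow> complex"
  assumes "\<And>f. f \<in> fock_sobolev \<alpha> p m \<Longrightarrow> fs_norm \<alpha> q m (T f) \<le> K * fs_norm \<alpha> p m f"
  shows "opnorm_fs \<alpha> p q m T \<le> K"
  unfolding opnorm_fs_def
proof (rule SUP_least)
  fix f :: "complex^'n \<Rightarrow> complex" assume f: "f \<in> {f \<in> fock_sobolev \<alpha> p m. fs_norm \<alpha> p m f \<le> 1}"
  then have "fs_norm \<alpha> q m (T f) \<le> K * fs_norm \<alpha> p m f" using assms by simp
  also have "\<dots> \<le> K * 1" using f by (intro mult_left_mono) auto
  finally show "fs_norm \<alpha> q m (T f) \<le> K" by simp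
qed

section \<open>Compactness\<close>

text \<open>By the parallelogram law the squared distances of \<open>\<zeta>\<close> to \<open>w + a\<close> and \<open>w - a\<close> have the mean
\<open>norm (\<zeta> - w) ^ 2 + norm a ^ 2\<close>, so one of them is at most that. Hence the transform near the origin is
bounded by its values far out.\<close>

lemma berezin_kernel_le_translates:
  assumes "0 \<le> \<alpha>" "0 \<le> q"
  shows "berezin_kernel \<alpha> q m w \<zeta> \<le> exp (\<alpha> * q / 2 * (norm a)\<^sup>2) *
    (berezin_kernel \<alpha> q m (w + a) \<zeta> + berezin_kernel \<alpha> q m (w - a) (\<zeta> :: complex^'n))"
proof -
  define c where "c = \<alpha> * q / 2"
  have c: "0 \<le> c" using assms by (simp add: c_def)
  let ?d = "\<lambda>w. (norm (\<zeta> - w))\<^sup>2" and ?k = "\<lambda>w. exp (c * ((norm \<zeta>)\<^sup>2 - (norm (\<zeta> - w))\<^sup>2))"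
  have "?d (w + a) + ?d (w - a) = 2 * (?d w + (norm a)\<^sup>2)"
    unfolding power2_norm_eq_inner
    by (simp add: inner_diff_left inner_diff_right inner_add_left inner_add_right inner_commute algebra_simps)
  then consider "?d (w + a) \<le> ?d w + (norm a)\<^sup>2" | "?d (w - a) \<le> ?d w + (norm a)\<^sup>2" by argo
  then have "?k w \<le> exp (c * (norm a)\<^sup>2) * (?k (w + a) + ?k (w - a))"
  proof cases
    case 1
    then have "c * ?d (w + a) \<le> c * (?d w + (norm a)\<^sup>2)" using c by (intro mult_left_mono)
    then have "?k w \<le> exp (c * (norm a)\<^sup>2) * ?k (w + a)"
      unfolding exp_add[symmetric] by (simp add: algebra_simps)
    then show ?thesis by (simp add: distrib_left add_increasing2)
  next
    case 2
    then have "c * ?d (w - a) \<le> c * (?d w + (norm a)\<^sup>2)" using c by (intro mult_left_mono)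
    then have "?k w \<le> exp (c * (norm a)\<^sup>2) * ?k (w - a)"
      unfolding exp_add[symmetric] by (simp add: algebra_simps)
    then show ?thesis by (simp add: distrib_left add_increasing)
  qed
  then have "?k w / (1 + norm \<zeta>) powr (real m * q)
      \<le> exp (c * (norm a)\<^sup>2) * (?k (w + a) + ?k (w - a)) / (1 + norm \<zeta>) powr (real m * q)"
    by (rule divide_right_mono) simp
  then show ?thesis
    unfolding berezin_kernel_def norm_fock_kernel_powr c_def
    by (simp add: add_divide_distrib distrib_left)
qed

lemma berezin_le_translates:
  assumes "0 \<le> \<alpha>" "0 \<le> q" and [measurable]: "u \<in> borel_measurable borel" "\<psi> \<in> borel_measurable borel"
  shows "berezin \<alpha> q m u \<psi> w \<le> ennreal (exp (\<alpha> * q / 2 * (norm a)\<^sup>2)) *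
    (berezin \<alpha> q m u \<psi> (w + a) + berezin \<alpha> q m u \<psi> (w - (a :: complex^'n)))"
proof -
  let ?W = "\<lambda>z. ennreal (source_weight \<alpha> q m u z)"
  let ?R = "\<lambda>w z. ennreal (berezin_kernel \<alpha> q m w (\<psi> z))"
  let ?E = "exp (\<alpha> * q / 2 * (norm a)\<^sup>2)"
  have "berezin \<alpha> q m u \<psi> w \<le> (\<integral>\<^sup>+z. ennreal ?E * (?R (w + a) z * ?W z + ?R (w - a) z * ?W z) \<partial>lborel)"
    unfolding berezin_eq
  proof (rule nn_integral_mono)
    fix z
    have "?R w z \<le> ennreal ?E * (?R (w + a) z + ?R (w - a) z)"
      using berezin_kernel_le_translates[OF assms(1,2), of m w "\<psi> z" a]
      by (simp add: ennreal_leI flip: ennreal_mult ennreal_plus)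
    then have "?R w z * ?W z \<le> (ennreal ?E * (?R (w + a) z + ?R (w - a) z)) * ?W z"
      by (rule mult_right_mono) simp
    then show "?R w z * ?W z \<le> ennreal ?E * (?R (w + a) z * ?W z + ?R (w - a) z * ?W z)"
      by (simp add: distrib_right distrib_left mult.assoc)
  qed
  also have "\<dots> = ennreal ?E * (berezin \<alpha> q m u \<psi> (w + a) + berezin \<alpha> q m u \<psi> (w - a))"
    unfolding berezin_eq by (simp add: nn_integral_cmult nn_integral_add)
  finally show ?thesis .
qed

lemma berezin_bounded_if_tendsto_0:
  fixes u :: "complex^'n \<Rightarrow> complex"
  assumes "0 \<le> \<alpha>" "0 \<le> q" "u \<in> borel_measurable borel" "\<psi> \<in> borel_measurable borel"
    and lim: "(berezin \<alpha> q m u \<psi> \<longlongrightarrow> 0) at_infinity"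
  shows "\<exists>b>0. \<forall>w. berezin \<alpha> q m u \<psi> w \<le> ennreal b"
proof -
  have "\<forall>\<^sub>F w in at_infinity. berezin \<alpha> q m u \<psi> w < 1"
    using lim by (rule order_tendstoD) simp
  then obtain R where R: "\<And>w. R \<le> norm w \<Longrightarrow> berezin \<alpha> q m u \<psi> w < 1"
    unfolding eventually_at_infinity by blast
  \<comment> \<open>Translating a point of norm less than \<open>R\<close> by \<open>a\<close> or \<open>- a\<close> leaves the ball of radius \<open>R\<close>.\<close>
  obtain a :: "complex^'n" where a: "norm a = 2 * \<bar>R\<bar>"
    using vector_choose_size[of "2 * \<bar>R\<bar>"] by auto
  define E where "E = exp (\<alpha> * q / 2 * (norm a)\<^sup>2)"
  have "berezin \<alpha> q m u \<psi> w \<le> ennreal (1 + 2 * E)" for w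
  proof (cases "R \<le> norm w")
    case True
    then have "berezin \<alpha> q m u \<psi> w \<le> ennreal 1" using R[of w] by simp
    also have "\<dots> \<le> ennreal (1 + 2 * E)" by (intro ennreal_leI) (simp add: E_def)
    finally show ?thesis .
  next
    case False
    then have "R \<le> norm (w + a)" "R \<le> norm (w - a)"
      using a norm_triangle_ineq4[of "w + a" w] norm_triangle_ineq4[of w "w - a"] by auto
    then have "berezin \<alpha> q m u \<psi> (w + a) \<le> 1" "berezin \<alpha> q m u \<psi> (w - a) \<le> 1"
      using R by (auto simp: less_imp_le)
    then have "ennreal E * (berezin \<alpha> q m u \<psi> (w + a) + berezin \<alpha> q m u \<psi> (w - a)) \<le> ennreal E * (1 + 1)"
      by (intro mult_left_mono add_mono) auto
    then have "berezin \<alpha> q m u \<psi> w \<le> ennreal E * (1 + 1)"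
      using berezin_le_translates[OF assms(1-4), of m w a] unfolding E_def by (rule order_trans[rotated])
    also have "\<dots> = ennreal (E * 2)" by (subst ennreal_mult) (auto simp: E_def)
    also have "\<dots> \<le> ennreal (1 + 2 * E)" by (intro ennreal_leI) simp
    finally show ?thesis .
  qed
  moreover have "0 < 1 + 2 * E" by (simp add: E_def add_pos_pos)
  ultimately show ?thesis by blast
qed

lemma wmod_locally_uniform:
  fixes h :: "nat \<Rightarrow> complex^'n \<Rightarrow> complex"
  assumes "0 \<le> \<alpha>" "0 < q" and lim: "uniform_limit (cball 0 R) h (\<lambda>_. 0) sequentially" and "0 < e"
  shows "\<forall>\<^sub>F k in sequentially. \<forall>w\<in>cball 0 R. wmod \<alpha> m (h k) w powr q \<le> e"
proof -
  define A where "A = (1 + \<bar>R\<bar>) ^ m"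
  have A: "0 < A" by (simp add: A_def add_pos_nonneg)
  define d where "d = e powr (1 / q) / A"
  have d: "0 < d" using A assms by (simp add: d_def)
  from uniform_limitD[OF lim d] show ?thesis
  proof eventually_elim
    case (elim k)
    show ?case
    proof
      fix w :: "complex^'n" assume w: "w \<in> cball 0 R"
      have "norm (h k w) \<le> d" using elim w by (auto simp: less_imp_le)
      moreover have "(1 + norm w) ^ m \<le> A" unfolding A_def using w by (intro power_mono) auto
      ultimately have "wmod \<alpha> m (h k) w \<le> A * d * 1"
        unfolding wmod_def using A d assms(1) by (intro mult_mono) auto
      then have "wmod \<alpha> m (h k) w powr q \<le> (e powr (1 / q)) powr q"
        using A assms by (intro powr_mono2) (auto simp: d_def)
      then show "wmod \<alpha> m (h k) w powr q \<le> e" using assms by (simp add: powr_powr)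
    qed
  qed
qed

text \<open>Outside a large ball the transform is small and the energies are bounded; inside, the
transform is bounded and the functions are uniformly small.\<close>

lemma fs_integral_wcomp_tendsto_0:
  fixes h :: "nat \<Rightarrow> complex^'n \<Rightarrow> complex"
  assumes \<alpha>: "0 < \<alpha>" and q: "0 < q" and u: "entire u" and psi: "entire_map \<psi>"
    and lim: "(berezin \<alpha> q m u \<psi> \<longlongrightarrow> 0) at_infinity"
    and h: "\<And>k. entire (h k)" "\<And>R. uniform_limit (cball 0 R) h (\<lambda>_. 0) sequentially"
    and H: "0 < H" "\<And>k. energy \<alpha> q m (h k) \<le> ennreal H"
  shows "(\<lambda>k. fs_integral \<alpha> q m (wcomp u \<psi> (h k))) \<longlonglongrightarrow> 0"
proof (rule tendsto_ennreal_0I)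
  fix e :: real assume e: "0 < e"
  have [measurable]: "u \<in> borel_measurable borel" "\<psi> \<in> borel_measurable borel" "h k \<in> borel_measurable borel" for k
    using u psi h(1) by (auto intro: entire_measurable entire_map_measurable)
  obtain C where C: "0 < C" "\<And>f u \<psi>. entire (f :: complex^'n \<Rightarrow> complex) \<Longrightarrow>
      u \<in> borel_measurable borel \<Longrightarrow> \<psi> \<in> borel_measurable borel \<Longrightarrow>
      fs_integral \<alpha> q m (wcomp u \<psi> f) \<le>
      ennreal C * (\<integral>\<^sup>+w. ennreal (wmod \<alpha> m f w powr q) * berezin \<alpha> q m u \<psi> w \<partial>lborel)"
    using fs_integral_wcomp_le_berezin[of \<alpha> q, where 'n='n and m=m] \<alpha> q by auto
  obtain b where b: "0 < b" "\<And>w. berezin \<alpha> q m u \<psi> w \<le> ennreal b"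
    using berezin_bounded_if_tendsto_0[of \<alpha> q u \<psi> m] \<alpha> q lim by auto
  \<comment> \<open>The parts outside and inside the ball contribute at most \<open>C * d1 * H\<close> and \<open>C * d2 * b * V\<close>.\<close>
  define d1 where "d1 = e / (2 * C * H)"
  have d1: "0 < d1" using e C H by (simp add: d1_def)
  have "\<forall>\<^sub>F w in at_infinity. berezin \<alpha> q m u \<psi> w < ennreal d1"
    using lim by (rule order_tendstoD) (use d1 in simp)
  then obtain R where R: "\<And>w. R \<le> norm w \<Longrightarrow> berezin \<alpha> q m u \<psi> w < ennreal d1"
    unfolding eventually_at_infinity by blast
  have [measurable]: "cball (0::complex^'n) R \<in> sets borel" by simp
  define V where "V = measure lborel (cball (0::complex^'n) R)"
  have V: "emeasure lborel (cball (0::complex^'n) R) = ennreal V" "0 \<le> V"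
    using emeasure_lborel_cball_finite[of "0::complex^'n" R]
    by (auto simp: V_def emeasure_eq_ennreal_measure top.not_eq_extremum)
  define d2 where "d2 = e / (2 * C * b * (V + 1))"
  have d2: "0 < d2" using e C b V by (simp add: d2_def)
  from wmod_locally_uniform[OF _ q h(2)[of R] d2, of \<alpha> m]
  have "\<forall>\<^sub>F k in sequentially. \<forall>w\<in>cball 0 R. wmod \<alpha> m (h k) w powr q \<le> d2" using \<alpha> by simp
  then show "\<forall>\<^sub>F k in sequentially. fs_integral \<alpha> q m (wcomp u \<psi> (h k)) \<le> ennreal e"
  proof eventually_elim
    case (elim k)
    let ?M = "\<lambda>w. ennreal (wmod \<alpha> m (h k) w powr q)"
    have "fs_integral \<alpha> q m (wcomp u \<psi> (h k)) \<le> ennreal C * (\<integral>\<^sup>+w. ?M w * berezin \<alpha> q m u \<psi> w \<partial>lborel)"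
      by (rule C(2)[OF h(1)]) measurable
    also have "\<dots> \<le> ennreal C * (\<integral>\<^sup>+w. ennreal d1 * ?M w + ennreal (d2 * b) * indicator (cball 0 R) w \<partial>lborel)"
    proof (intro mult_left_mono nn_integral_mono)
      fix w
      show "?M w * berezin \<alpha> q m u \<psi> w \<le> ennreal d1 * ?M w + ennreal (d2 * b) * indicator (cball 0 R) w"
      proof (cases "w \<in> cball 0 R")
        case True
        then have "?M w * berezin \<alpha> q m u \<psi> w \<le> ennreal d2 * ennreal b"
          using elim b by (intro mult_mono ennreal_leI) auto
        then show ?thesis using True d2 b by (simp add: ennreal_mult add_increasing)
      next
        case False
        then have "berezin \<alpha> q m u \<psi> w \<le> ennreal d1" using R[of w] by simp
        then have "?M w * berezin \<alpha> q m u \<psi> w \<le> ?M w * ennreal d1" by (rule mult_left_mono) simp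
        then show ?thesis using False by (simp add: mult.commute)
      qed
    qed simp
    also have "\<dots> = ennreal C * (ennreal d1 * energy \<alpha> q m (h k) + ennreal (d2 * b) * ennreal V)"
      unfolding energy_def V(1)[symmetric] by (simp add: nn_integral_add nn_integral_cmult)
    also have "\<dots> \<le> ennreal C * (ennreal d1 * ennreal H + ennreal (d2 * b) * ennreal V)"
      by (intro mult_left_mono add_mono H) auto
    also have "\<dots> = ennreal (C * (d1 * H + d2 * b * V))"
      using C(1) d1 d2 b(1) V(2) H(1) by (simp flip: ennreal_mult ennreal_plus)
    also have "C * (d1 * H + d2 * b * V) \<le> e"
    proof -
      have "C * (d1 * H) = e / 2" using C(1) H(1) by (simp add: d1_def)
      moreover have "C * (d2 * b * V) = e / 2 * (V / (V + 1))" using C(1) b(1) by (simp add: d2_def)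
      moreover have "e / 2 * (V / (V + 1)) \<le> e / 2 * 1" using V(2) e by (intro mult_left_mono) auto
      ultimately show ?thesis unfolding distrib_left by linarith
    qed
    finally show ?case by (simp add: ennreal_leI)
  qed
qed

text \<open>Bounded sequences in the domain are locally bounded, so Montel's theorem gives a locally uniform limit
of a subsequence, which belongs to the domain by Fatou's lemma. The images converge by the
preceding lemma applied to the differences.\<close>

lemma compact_fs_if_tendsto_0:
  fixes u :: "complex^'n \<Rightarrow> complex"
  assumes \<alpha>: "0 < \<alpha>" and p: "0 < p" "p \<le> q" and u: "entire u" and psi: "entire_map \<psi>"
    and lim: "(berezin \<alpha> q m u \<psi> \<longlongrightarrow> 0) at_infinity"
  shows "compact_fs \<alpha> p q m (wcomp u \<psi>)"
proof -
  have q: "0 < q" using p by simp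
  have [measurable]: "u \<in> borel_measurable borel" "\<psi> \<in> borel_measurable borel"
    using u psi by (auto intro: entire_measurable entire_map_measurable)
  obtain b where b: "0 < b" "\<And>w. berezin \<alpha> q m u \<psi> w \<le> ennreal b"
    using berezin_bounded_if_tendsto_0[of \<alpha> q u \<psi> m] \<alpha> q lim by auto
  have "in_Linf (berezin \<alpha> q m u \<psi>)"
  proof -
    have meas: "berezin \<alpha> q m u \<psi> \<in> borel_measurable lborel" using berezin_measurable[of u \<psi> \<alpha> q m] by simp
    then have "esssup lborel (berezin \<alpha> q m u \<psi>) \<le> ennreal b" using b by (intro esssup_I) auto
    then show ?thesis using meas by (simp add: in_Linf_def le_less_trans)
  qed
  then have bd: "bounded_fs \<alpha> p q m (wcomp u \<psi>)" by (rule bounded_fs_if_in_Linf[OF \<alpha> p u psi])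
  then have maps: "maps_fs \<alpha> p q m (wcomp u \<psi>)" by (simp add: bounded_fs_def)
  have "\<exists>r g. strict_mono r \<and> g \<in> fock_sobolev \<alpha> q m \<and>
      (\<lambda>k. fs_norm \<alpha> q m (\<lambda>z. wcomp u \<psi> (F (r k)) z - g z)) \<longlonglongrightarrow> 0"
    if F: "\<And>k. F k \<in> fock_sobolev \<alpha> p m" and M: "\<And>k. fs_norm \<alpha> p m (F k) \<le> ennreal M"
    for F :: "nat \<Rightarrow> complex^'n \<Rightarrow> complex" and M
  proof -
    have entF: "entire (F k)" for k using fs_norm_finite(1)[OF \<alpha> p(1) F] .
    note [measurable] = entire_measurable[OF entF]
    obtain C1 where C1: "0 < C1" "\<And>f. entire (f :: complex^'n \<Rightarrow> complex) \<Longrightarrow>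
        energy \<alpha> p m f \<le> ennreal C1 * enn_powr (fs_norm \<alpha> p m f) p"
      using energy_le_fs_norm_embedding[OF \<alpha> p(1) order_refl, where 'n='n and m=m] by blast
    define N where "N = C1 * \<bar>M\<bar> powr p"
    have "energy \<alpha> p m (F k) \<le> ennreal N" for k
    proof -
      have "energy \<alpha> p m (F k) \<le> ennreal C1 * enn_powr (fs_norm \<alpha> p m (F k)) p" by (rule C1(2)[OF entF])
      also have "\<dots> \<le> ennreal C1 * enn_powr (ennreal \<bar>M\<bar>) p"
      proof (intro mult_left_mono enn_powr_mono)
        have "ennreal M \<le> ennreal \<bar>M\<bar>" by (intro ennreal_leI) simp
        then show "fs_norm \<alpha> p m (F k) \<le> ennreal \<bar>M\<bar>" using M[of k] by (rule order_trans[rotated])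
      qed (use p in auto)
      also have "\<dots> = ennreal N" using C1 by (simp add: enn_powr_ennreal N_def ennreal_mult)
      finally show ?thesis .
    qed
    note EN = this
    have N: "0 \<le> N" using C1 by (simp add: N_def)
    obtain C2 where C2: "0 < C2" "\<And>f z. entire (f :: complex^'n \<Rightarrow> complex) \<Longrightarrow>
        ennreal (wmod \<alpha> m f z powr p) \<le> ennreal C2 * energy \<alpha> p m f"
      using wmod_le_energy[of \<alpha> p, where 'n='n and k=m] \<alpha> p by auto
    have "\<exists>B. \<forall>k. \<forall>z\<in>cball 0 R. norm (F k z) \<le> B" for R
    proof (intro exI allI ballI)
      fix k and z :: "complex^'n" assume z: "z \<in> cball 0 R"
      have "ennreal (wmod \<alpha> m (F k) z powr p) \<le> ennreal C2 * ennreal N"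
        using C2(2)[OF entF] EN[of k] by (meson mult_left_mono order_trans zero_le)
      then have "wmod \<alpha> m (F k) z powr p \<le> C2 * N" using C2(1) N by (simp add: ennreal_le_iff flip: ennreal_mult)
      then have le: "wmod \<alpha> m (F k) z \<le> (C2 * N) powr (1 / p)"
        using p by (intro powr_le_imp_le_root) auto
      have "norm (F k z) \<le> exp (\<alpha> / 2 * R\<^sup>2) * wmod \<alpha> m (F k) z"
        using \<alpha> z by (intro norm_le_wmod) auto
      also have "\<dots> \<le> exp (\<alpha> / 2 * R\<^sup>2) * (C2 * N) powr (1 / p)" using le by (intro mult_left_mono) auto
      finally show "norm (F k z) \<le> exp (\<alpha> / 2 * R\<^sup>2) * (C2 * N) powr (1 / p)" .
    qed
    from entire_montel[OF entF this] obtain r g where r: "strict_mono r" and g: "entire g"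
      and unif: "\<And>R. uniform_limit (cball 0 R) (\<lambda>k. F (r k)) g sequentially" by blast
    note [measurable] = entire_measurable[OF g]
    have ptw: "(\<lambda>k. F (r k) z) \<longlonglongrightarrow> g z" for z
      using unif[of "norm z"] by (rule tendsto_uniform_limitI) simp
    have "energy \<alpha> p m g \<le> ennreal N"
    proof -
      have wl: "(\<lambda>k. ennreal (wmod \<alpha> m (F (r k)) z powr p)) \<longlonglongrightarrow> ennreal (wmod \<alpha> m g z powr p)" for z
        unfolding wmod_def using p(1)
        by (intro tendsto_ennrealI tendsto_powr2 tendsto_intros ptw) auto
      have "energy \<alpha> p m g = (\<integral>\<^sup>+z. liminf (\<lambda>k. ennreal (wmod \<alpha> m (F (r k)) z powr p)) \<partial>lborel)"
        unfolding energy_def by (intro nn_integral_cong lim_imp_Liminf[symmetric] wl) simp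
      also have "\<dots> \<le> liminf (\<lambda>k. energy \<alpha> p m (F (r k)))"
        unfolding energy_def by (rule nn_integral_liminf) measurable
      also have "\<dots> \<le> liminf (\<lambda>k. ennreal N)" by (intro Liminf_mono always_eventually allI EN)
      also have "\<dots> = ennreal N" by (simp add: Liminf_const)
      finally show ?thesis .
    qed
    then have g_mem: "g \<in> fock_sobolev \<alpha> p m"
      using g \<alpha> p(1) by (simp add: fock_sobolev_iff le_less_trans)
    define h where "h k = (\<lambda>z. F (r k) z - g z)" for k
    have h: "entire (h k)" for k unfolding h_def by (intro entire_diff entF g)
    obtain C3 where C3: "0 < C3" "\<And>f. entire (f :: complex^'n \<Rightarrow> complex) \<Longrightarrow>
        energy \<alpha> q m f \<le> ennreal C3 * enn_powr (enn_powr (energy \<alpha> p m f) (1 / p)) q"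
      using energy_embedding[OF \<alpha> p, where 'n='n and m=m] by blast
    obtain C4 where C4: "0 < C4" "\<And>f. entire (f :: complex^'n \<Rightarrow> complex) \<Longrightarrow>
        energy \<alpha> p m f \<le> ennreal C4 * fs_integral \<alpha> p m f"
      using energy_le_fs_integral[of \<alpha> p, where 'n='n and m=m] \<alpha> p by auto
    define H0 where "H0 = C4 * (2 powr p * (N + N))"
    have H0: "0 \<le> H0" using N C4 by (simp add: H0_def)
    have "energy \<alpha> p m (h k) \<le> ennreal H0" for k
    proof -
      have "energy \<alpha> p m (h k) \<le> ennreal C4 * fs_integral \<alpha> p m (h k)" by (rule C4(2)[OF h])
      also have "\<dots> \<le> ennreal C4 * (ennreal (2 powr p) * (fs_integral \<alpha> p m (F (r k)) + fs_integral \<alpha> p m g))"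
        using p unfolding h_def
        by (intro mult_left_mono fs_integral_triangle entF g norm_triangle_ineq4) auto
      also have "\<dots> \<le> ennreal C4 * (ennreal (2 powr p) * (ennreal N + ennreal N))"
        using p EN \<open>energy \<alpha> p m g \<le> ennreal N\<close>
        by (intro mult_left_mono add_mono order_trans[OF fs_integral_le_energy]) auto
      also have "\<dots> = ennreal H0" using N C4 by (simp add: H0_def flip: ennreal_mult ennreal_plus)
      finally show ?thesis .
    qed
    note EH0 = this
    define H where "H = C3 * (H0 powr (1 / p)) powr q + 1"
    have H: "0 < H" using C3 by (simp add: H_def add_nonneg_pos)
    have EH: "energy \<alpha> q m (h k) \<le> ennreal H" for k
    proof -
      have "energy \<alpha> q m (h k) \<le> ennreal C3 * enn_powr (enn_powr (energy \<alpha> p m (h k)) (1 / p)) q"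
        by (rule C3(2)[OF h])
      also have "\<dots> \<le> ennreal C3 * enn_powr (enn_powr (ennreal H0) (1 / p)) q"
        using p q EH0 by (intro mult_left_mono enn_powr_mono) auto
      also have "\<dots> = ennreal (C3 * (H0 powr (1 / p)) powr q)"
        using C3 H0 by (simp add: enn_powr_ennreal ennreal_mult)
      also have "\<dots> \<le> ennreal H" by (intro ennreal_leI) (simp add: H_def)
      finally show ?thesis .
    qed
    have "uniform_limit (cball 0 R) h (\<lambda>_. 0) sequentially" for R
      using unif[of R] unfolding uniform_limit_iff h_def by (simp add: dist_norm)
    from fs_integral_wcomp_tendsto_0[OF \<alpha> q u psi lim h this H EH]
    have "(\<lambda>k. fs_integral \<alpha> q m (wcomp u \<psi> (h k))) \<longlonglongrightarrow> 0" .
    then have "(\<lambda>k. enn_powr (ennreal (fs_const \<alpha> q m CARD('n)) * fs_integral \<alpha> q m (wcomp u \<psi> (h k))) (1 / q)) \<longlonglongrightarrow> 0"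
      using q ennreal_tendsto_cmult[of "ennreal (fs_const \<alpha> q m CARD('n))" _ 0 sequentially]
      by (intro tendsto_enn_powr_0) auto
    moreover have "wcomp u \<psi> (h k) = (\<lambda>z. wcomp u \<psi> (F (r k)) z - wcomp u \<psi> g z)" for k
      by (simp add: wcomp_def h_def fun_eq_iff right_diff_distrib)
    ultimately have "(\<lambda>k. fs_norm \<alpha> q m (\<lambda>z. wcomp u \<psi> (F (r k)) z - wcomp u \<psi> g z)) \<longlonglongrightarrow> 0"
      by (simp add: fs_norm_fs_integral)
    moreover have "wcomp u \<psi> g \<in> fock_sobolev \<alpha> q m"
      using maps g_mem by (simp add: maps_fs_def)
    ultimately show ?thesis using r by blast
  qed
  then show ?thesis unfolding compact_fs_def using maps by blast
qed

lemma test_fun_tendsto_0: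
  assumes \<alpha>: "0 < \<alpha>" shows "((\<lambda>v. test_fun \<alpha> m v (\<zeta> :: complex^'n)) \<longlongrightarrow> 0) at_infinity"
proof (rule Lim_null_comparison)
  have "norm (test_fun \<alpha> m v \<zeta>) \<le> exp (\<alpha> / 2 * ((norm \<zeta>)\<^sup>2 - (norm (\<zeta> - v))\<^sup>2))" for v
  proof -
    have "1 \<le> (1 + norm v) ^ m" by (intro one_le_power) simp
    then have "norm (fock_kernel \<alpha> v \<zeta>) / (1 + norm v) ^ m \<le> norm (fock_kernel \<alpha> v \<zeta>) / 1"
      by (intro divide_left_mono) (auto intro!: zero_less_power add_pos_nonneg)
    then show ?thesis by (simp add: norm_test_fun norm_fock_kernel)
  qed
  then show "\<forall>\<^sub>F v in at_infinity. norm (test_fun \<alpha> m v \<zeta>) \<le> exp (\<alpha> / 2 * ((norm \<zeta>)\<^sup>2 - (norm (\<zeta> - v))\<^sup>2))"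
    by simp
  have "filterlim (\<lambda>v. norm (\<zeta> - v)) at_top at_infinity"
  proof (rule filterlim_at_top_mono)
    show "filterlim (\<lambda>v. - norm \<zeta> + norm v) at_top at_infinity"
      by (intro filterlim_tendsto_add_at_top[OF tendsto_const] filterlim_norm_at_top)
    show "\<forall>\<^sub>F v in at_infinity. - norm \<zeta> + norm v \<le> norm (\<zeta> - v)"
      using norm_triangle_ineq3 by (intro always_eventually allI) (smt (verit) norm_minus_commute norm_triangle_sub)
  qed
  then have "filterlim (\<lambda>v. (norm (\<zeta> - v))\<^sup>2) at_top at_infinity"
    by (intro filterlim_pow_at_top) auto
  then have "filterlim (\<lambda>v. \<alpha> / 2 * (norm (\<zeta> - v))\<^sup>2) at_top at_infinity"
    using \<alpha> by (intro filterlim_tendsto_pos_mult_at_top[OF tendsto_const]) auto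
  then have "filterlim (\<lambda>v. - (\<alpha> / 2 * (norm (\<zeta> - v))\<^sup>2)) at_bot at_infinity"
    by (simp add: filterlim_uminus_at_bot)
  then have "((\<lambda>v. exp (- (\<alpha> / 2 * (norm (\<zeta> - v))\<^sup>2))) \<longlongrightarrow> 0) at_infinity"
    by (rule filterlim_compose[OF exp_at_bot])
  then have "((\<lambda>v. exp (\<alpha> / 2 * (norm \<zeta>)\<^sup>2) * exp (- (\<alpha> / 2 * (norm (\<zeta> - v))\<^sup>2))) \<longlongrightarrow> exp (\<alpha> / 2 * (norm \<zeta>)\<^sup>2) * 0) at_infinity"
    by (intro tendsto_mult tendsto_const)
  then show "((\<lambda>v. exp (\<alpha> / 2 * ((norm \<zeta>)\<^sup>2 - (norm (\<zeta> - v))\<^sup>2))) \<longlongrightarrow> 0) at_infinity"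
    by (simp add: right_diff_distrib flip: exp_add)
qed

text \<open>Point evaluations are bounded by the norm; this identifies limits in the norm with pointwise
limits.\<close>

lemma fs_integral_tendsto_0_pointwise:
  fixes f :: "nat \<Rightarrow> complex^'n \<Rightarrow> complex"
  assumes \<alpha>: "0 < \<alpha>" and q: "0 < q" and f: "\<And>k. entire (f k)"
    and lim: "(\<lambda>k. fs_integral \<alpha> q m (f k)) \<longlonglongrightarrow> 0"
  shows "(\<lambda>k. f k z) \<longlonglongrightarrow> 0"
proof -
  obtain C1 where C1: "\<And>f. entire (f :: complex^'n \<Rightarrow> complex) \<Longrightarrow> energy \<alpha> q m f \<le> ennreal C1 * fs_integral \<alpha> q m f"
    using energy_le_fs_integral[of \<alpha> q, where 'n='n and m=m] \<alpha> q by auto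
  obtain C2 where C2: "\<And>f z. entire (f :: complex^'n \<Rightarrow> complex) \<Longrightarrow> ennreal (wmod \<alpha> m f z powr q) \<le> ennreal C2 * energy \<alpha> q m f"
    using wmod_le_energy[of \<alpha> q, where 'n='n and k=m] \<alpha> q by auto
  have le: "ennreal (wmod \<alpha> m (f k) z powr q) \<le> ennreal C2 * (ennreal C1 * fs_integral \<alpha> q m (f k))" for k
    using C2[OF f, of k z] C1[OF f, of k] by (meson mult_left_mono order_trans zero_le)
  have "(\<lambda>k. ennreal C2 * (ennreal C1 * fs_integral \<alpha> q m (f k))) \<longlonglongrightarrow> ennreal C2 * (ennreal C1 * 0)"
    using lim by (intro ennreal_tendsto_cmult) auto
  then have lim2: "(\<lambda>k. ennreal C2 * (ennreal C1 * fs_integral \<alpha> q m (f k))) \<longlonglongrightarrow> 0" by simp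
  have "(\<lambda>k. ennreal (wmod \<alpha> m (f k) z powr q)) \<longlonglongrightarrow> 0"
    by (rule tendsto_sandwich[OF _ _ tendsto_const lim2]) (auto intro: always_eventually le)
  then have "(\<lambda>k. enn_powr (ennreal (wmod \<alpha> m (f k) z powr q)) (1 / q)) \<longlonglongrightarrow> 0"
    using q by (intro tendsto_enn_powr_0) auto
  then have "(\<lambda>k. ennreal (wmod \<alpha> m (f k) z)) \<longlonglongrightarrow> ennreal 0"
    using q by (simp add: enn_powr_ennreal powr_powr)
  then have "(\<lambda>k. wmod \<alpha> m (f k) z) \<longlonglongrightarrow> 0"
    by (subst (asm) tendsto_ennreal_iff) auto
  moreover have nz: "1 + norm z \<noteq> 0" using norm_ge_zero[of z] by linarith
  ultimately have "(\<lambda>k. wmod \<alpha> m (f k) z / ((1 + norm z) ^ m * exp (- (\<alpha> / 2) * (norm z)\<^sup>2))) \<longlonglongrightarrow>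
      0 / ((1 + norm z) ^ m * exp (- (\<alpha> / 2) * (norm z)\<^sup>2))"
    by (intro tendsto_divide tendsto_const) auto
  with nz have "(\<lambda>k. norm (f k z)) \<longlonglongrightarrow> 0" by (simp add: wmod_def)
  then show ?thesis by (rule tendsto_norm_zero_cancel)
qed

lemma compact_fs_test_fun_subsequence:
  fixes u :: "complex^'n \<Rightarrow> complex" and v :: "nat \<Rightarrow> complex^'n"
  assumes \<alpha>: "0 < \<alpha>" and p: "0 < p" and q: "0 < q"
    and compact: "compact_fs \<alpha> p q m (wcomp u \<psi>)"
  shows "\<exists>r g. strict_mono r \<and> g \<in> fock_sobolev \<alpha> q m \<and>
    (\<lambda>k. fs_integral \<alpha> q m (\<lambda>z. wcomp u \<psi> (test_fun \<alpha> m (v (r k))) z - g z)) \<longlonglongrightarrow> 0"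
proof -
  obtain c where c: "\<And>v :: complex^'n. test_fun \<alpha> m v \<in> fock_sobolev \<alpha> p m"
    "\<And>v :: complex^'n. fs_norm \<alpha> p m (test_fun \<alpha> m v) \<le> ennreal c"
    using test_fun_fs_norm_bounded[OF \<alpha> p, where 'n='n and m=m] by blast
  have "\<exists>r g. strict_mono r \<and> g \<in> fock_sobolev \<alpha> q m \<and>
      (\<lambda>k. fs_norm \<alpha> q m (\<lambda>z. wcomp u \<psi> (test_fun \<alpha> m (v (r k))) z - g z)) \<longlonglongrightarrow> 0"
    using compact[unfolded compact_fs_def, THEN conjunct2, rule_format, of "\<lambda>k. test_fun \<alpha> m (v k)"] c by blast
  then obtain r g where rg: "strict_mono r" "g \<in> fock_sobolev \<alpha> q m"
    and lim: "(\<lambda>k. fs_norm \<alpha> q m (\<lambda>z. wcomp u \<psi> (test_fun \<alpha> m (v (r k))) z - g z)) \<longlonglongrightarrow> 0" by blast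
  define b where "b = fs_const \<alpha> q m CARD('n)"
  have b: "0 < b" using \<alpha> q by (simp add: b_def fs_const_pos)
  have "(\<lambda>k. ennreal (1 / b) * enn_powr (fs_norm \<alpha> q m (\<lambda>z. wcomp u \<psi> (test_fun \<alpha> m (v (r k))) z - g z)) q)
      \<longlonglongrightarrow> ennreal (1 / b) * 0"
    using lim q by (intro ennreal_tendsto_cmult tendsto_enn_powr_0) auto
  moreover have "ennreal (1 / b) * enn_powr (fs_norm \<alpha> q m f) q = fs_integral \<alpha> q m f" for f :: "complex^'n \<Rightarrow> complex"
    using b q by (simp add: fs_norm_powr b_def[symmetric] mult.assoc[symmetric] flip: ennreal_mult)
  ultimately show ?thesis using rg by auto
qed

text \<open>Otherwise there would be a sequence of test functions whose \<open>k\<close>-th image has an integral exceeding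
\<open>k\<close>; but the images along some subsequence converge in the norm and hence are bounded.\<close>

lemma compact_fs_test_fun_bounded:
  fixes u :: "complex^'n \<Rightarrow> complex"
  assumes \<alpha>: "0 < \<alpha>" and p: "0 < p" and q: "0 < q" and u: "entire u" and psi: "entire_map \<psi>"
    and compact: "compact_fs \<alpha> p q m (wcomp u \<psi>)"
  shows "\<exists>S. \<forall>v. fs_integral \<alpha> q m (wcomp u \<psi> (test_fun \<alpha> m v)) \<le> of_nat S"
proof (rule ccontr)
  assume "\<not> ?thesis"
  then have "\<forall>S::nat. \<exists>v. of_nat S < fs_integral \<alpha> q m (wcomp u \<psi> (test_fun \<alpha> m v))" by (auto simp: not_le)
  then obtain v where v: "\<And>S::nat. of_nat S < fs_integral \<alpha> q m (wcomp u \<psi> (test_fun \<alpha> m (v S)))" by metis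
  obtain r g where r: "strict_mono r" and g: "g \<in> fock_sobolev \<alpha> q m"
    and lim: "(\<lambda>k. fs_integral \<alpha> q m (\<lambda>z. wcomp u \<psi> (test_fun \<alpha> m (v (r k))) z - g z)) \<longlonglongrightarrow> 0"
    using compact_fs_test_fun_subsequence[OF \<alpha> p q compact, of v] by blast
  note g_fin = fs_norm_finite[OF \<alpha> q g]
  obtain G where G: "fs_integral \<alpha> q m g = ennreal G" "0 \<le> G"
    using g_fin(3) by (cases "fs_integral \<alpha> q m g") auto
  define B where "B = 2 powr q * (1 + G)"
  have "\<forall>\<^sub>F k in sequentially. fs_integral \<alpha> q m (\<lambda>z. wcomp u \<psi> (test_fun \<alpha> m (v (r k))) z - g z) < 1"
    using lim by (rule order_tendstoD) simp
  then have "\<forall>\<^sub>F k in sequentially. of_nat k \<le> ennreal B"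
  proof eventually_elim
    case (elim k)
    let ?T = "wcomp u \<psi> (test_fun \<alpha> m (v (r k)))"
    have "of_nat k \<le> (of_nat (r k) :: ennreal)" using seq_suble[OF r, of k] by simp
    also have "\<dots> \<le> fs_integral \<alpha> q m ?T" using v[of "r k"] by simp
    also have "\<dots> \<le> ennreal (2 powr q) * (fs_integral \<alpha> q m (\<lambda>z. ?T z - g z) + fs_integral \<alpha> q m g)"
    proof (rule fs_integral_triangle)
      show "entire (\<lambda>z. ?T z - g z)"
        by (intro entire_diff entire_wcomp[OF u psi] entire_test_fun g_fin(1))
      show "norm (?T z) \<le> norm (?T z - g z) + norm (g z)" for z
        using norm_triangle_ineq[of "?T z - g z" "g z"] by simp
    qed (use q g_fin(1) in auto)
    also have "\<dots> \<le> ennreal (2 powr q) * (1 + ennreal G)"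
      using elim G by (intro mult_left_mono add_mono) auto
    also have "\<dots> = ennreal B" using G by (simp add: B_def ennreal_mult ennreal_plus)
    finally show ?case .
  qed
  then obtain K where K: "\<And>k. K \<le> k \<Longrightarrow> of_nat k \<le> ennreal B" unfolding eventually_sequentially by blast
  define k where "k = max K (nat \<lceil>B\<rceil> + 1)"
  have "of_nat k \<le> ennreal B" by (rule K) (simp add: k_def)
  then have "ennreal (real k) \<le> ennreal B" by (simp add: ennreal_of_nat_eq_real_of_nat)
  moreover have "0 \<le> B" using G by (simp add: B_def)
  ultimately have "real k \<le> B" by (simp add: ennreal_le_iff)
  moreover have "B < real k" unfolding k_def by linarith
  ultimately show False by simp
qed

text \<open>Otherwise there would be test functions at points tending to infinity whose images stay away from
zero in the norm. A norm limit of a subsequence of the images is also their pointwise limit, which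
is zero because the test functions tend to zero pointwise.\<close>

lemma compact_fs_test_fun_tendsto_0:
  fixes u :: "complex^'n \<Rightarrow> complex"
  assumes \<alpha>: "0 < \<alpha>" and p: "0 < p" and q: "0 < q" and u: "entire u" and psi: "entire_map \<psi>"
    and compact: "compact_fs \<alpha> p q m (wcomp u \<psi>)"
  shows "((\<lambda>v. fs_integral \<alpha> q m (wcomp u \<psi> (test_fun \<alpha> m v))) \<longlongrightarrow> 0) at_infinity"
proof (rule tendsto_ennreal_0I, rule ccontr)
  fix e :: real assume e: "0 < e"
  assume "\<not> (\<forall>\<^sub>F v in at_infinity. fs_integral \<alpha> q m (wcomp u \<psi> (test_fun \<alpha> m v)) \<le> ennreal e)"
  then have "\<forall>k::nat. \<exists>v. real k \<le> norm v \<and> ennreal e < fs_integral \<alpha> q m (wcomp u \<psi> (test_fun \<alpha> m v))"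
    unfolding eventually_at_infinity by (auto simp: not_le)
  then obtain v where v: "\<And>k. real k \<le> norm (v k)"
      "\<And>k. ennreal e < fs_integral \<alpha> q m (wcomp u \<psi> (test_fun \<alpha> m (v k)))" by metis
  obtain r g where r: "strict_mono r" and g: "g \<in> fock_sobolev \<alpha> q m"
    and lim: "(\<lambda>k. fs_integral \<alpha> q m (\<lambda>z. wcomp u \<psi> (test_fun \<alpha> m (v (r k))) z - g z)) \<longlonglongrightarrow> 0"
    using compact_fs_test_fun_subsequence[OF \<alpha> p q compact, of v] by blast
  note g_fin = fs_norm_finite[OF \<alpha> q g]
  have v_inf: "filterlim (\<lambda>k. v (r k)) at_infinity sequentially"
  proof -
    have "filterlim (\<lambda>k. real k) at_top sequentially" by (rule filterlim_real_sequentially)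
    then have "filterlim (\<lambda>k. norm (v (r k))) at_top sequentially"
    proof (rule filterlim_at_top_mono)
      have "real k \<le> norm (v (r k))" for k
        using v(1)[of "r k"] seq_suble[OF r, of k] by linarith
      then show "\<forall>\<^sub>F k in sequentially. real k \<le> norm (v (r k))" by simp
    qed
    then show ?thesis by (rule filterlim_norm_at_top_imp_at_infinity)
  qed
  have "g z = 0" for z
  proof -
    have "(\<lambda>k. wcomp u \<psi> (test_fun \<alpha> m (v (r k))) z - g z) \<longlonglongrightarrow> 0"
      by (rule fs_integral_tendsto_0_pointwise[OF \<alpha> q _ lim])
        (intro entire_diff entire_wcomp[OF u psi] entire_test_fun g_fin(1))
    moreover have "(\<lambda>k. u z * test_fun \<alpha> m (v (r k)) (\<psi> z) - g z) \<longlonglongrightarrow> u z * 0 - g z"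
      by (intro tendsto_intros filterlim_compose[OF test_fun_tendsto_0[OF \<alpha>] v_inf])
    ultimately show ?thesis
      using LIMSEQ_unique by (fastforce simp: wcomp_def)
  qed
  then have "(\<lambda>k. fs_integral \<alpha> q m (wcomp u \<psi> (test_fun \<alpha> m (v (r k))))) \<longlonglongrightarrow> 0"
    using lim by simp
  then have "\<forall>\<^sub>F k in sequentially. fs_integral \<alpha> q m (wcomp u \<psi> (test_fun \<alpha> m (v (r k)))) < ennreal e"
    by (rule order_tendstoD) (use e in simp)
  then obtain k where "fs_integral \<alpha> q m (wcomp u \<psi> (test_fun \<alpha> m (v (r k)))) < ennreal e"
    by (meson eventually_happens' sequentially_bot)
  with v(2)[of "r k"] show False by simp
qed

text \<open>The Gaussian average around \<open>w\<close> of a bounded function that tends to zero at infinity tends to zero: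
points within distance \<open>norm w / 2\<close> of \<open>w\<close> are far out, and the others carry exponentially little
Gaussian mass.\<close>

lemma tendsto_0_if_compact_fs:
  fixes u :: "complex^'n \<Rightarrow> complex"
  assumes \<alpha>: "0 < \<alpha>" and p: "0 < p" and q: "0 < q" and u: "entire u" and psi: "entire_map \<psi>"
    and compact: "compact_fs \<alpha> p q m (wcomp u \<psi>)"
  shows "(berezin \<alpha> q m u \<psi> \<longlongrightarrow> 0) at_infinity"
proof (rule tendsto_ennreal_0I)
  fix e :: real assume e: "0 < e"
  define \<Phi> where "\<Phi> v = fs_integral \<alpha> q m (wcomp u \<psi> (test_fun \<alpha> m v))" for v
  have [measurable]: "u \<in> borel_measurable borel" "\<psi> \<in> borel_measurable borel"
    using u psi by (auto intro: entire_measurable entire_map_measurable)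
  obtain S0 :: nat where S0: "\<And>v. \<Phi> v \<le> of_nat S0"
    using compact_fs_test_fun_bounded[OF assms] unfolding \<Phi>_def by blast
  define S where "S = real S0"
  have S: "0 \<le> S" "\<And>v. \<Phi> v \<le> ennreal S"
    using S0 by (auto simp: S_def ennreal_of_nat_eq_real_of_nat)
  obtain C where C: "0 < C" "\<And>u \<psi> w. u \<in> borel_measurable borel \<Longrightarrow> \<psi> \<in> borel_measurable borel \<Longrightarrow>
    berezin \<alpha> q m u \<psi> w \<le> ennreal C *
    (\<integral>\<^sup>+v. ennreal (gauss_weight \<alpha> q m (v - w)) * fs_integral \<alpha> q m (wcomp u \<psi> (test_fun \<alpha> m (v :: complex^'n))) \<partial>lborel)"
    using berezin_le_test_fun[OF \<alpha> q, where 'n='n and m=m] by blast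
  define c where "c = \<alpha> * q / 2"
  have c: "0 < c" using \<alpha> q by (simp add: c_def)
  define L where "L = exp ((real m * q)\<^sup>2 / (2 * c))"
  have L: "0 < L" by (simp add: L_def)
  define f where "f x = exp (- (c / 4) * (norm x)\<^sup>2)" for x :: "complex^'n"
  have f_pos: "0 < f x" for x by (simp add: f_def)
  have [measurable]: "f \<in> borel_measurable borel"
    unfolding f_def[abs_def] by (intro borel_measurable_continuous_onI continuous_on_gaussian)
  have "(\<integral>\<^sup>+x. ennreal (f x) \<partial>lborel) < \<infinity>"
    unfolding f_def using c by (intro nn_integral_gaussian_finite) simp
  then obtain I where I: "0 \<le> I" "(\<integral>\<^sup>+x. ennreal (f x) \<partial>lborel) = ennreal I"
    by (cases "\<integral>\<^sup>+x. ennreal (f x) \<partial>lborel") auto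
  \<comment> \<open>One factor \<open>f x\<close> gives smallness for large \<open>x\<close>, the other one integrability.\<close>
  have gw: "gauss_weight \<alpha> q m x \<le> L * f x * f x" for x :: "complex^'n"
  proof -
    have "gauss_weight \<alpha> q m x = (1 + norm x) powr (real m * q) * exp (- c * (norm x)\<^sup>2)"
      by (simp add: gauss_weight_def c_def)
    also have "\<dots> \<le> (L * exp (c / 2 * (norm x)\<^sup>2)) * exp (- c * (norm x)\<^sup>2)"
      using powr_le_exp_square[of "norm x" "real m * q" "c/2"] c q by (simp add: L_def)
    also have "\<dots> = L * f x * f x"
      by (simp add: f_def mult.assoc flip: exp_add)
    finally show ?thesis .
  qed
  define d where "d = e / (2 * C * L * (I + 1))"
  have d: "0 < d" using e C(1) L I(1) by (simp add: d_def)
  have "\<forall>\<^sub>F v in at_infinity. \<Phi> v < ennreal d"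
    using compact_fs_test_fun_tendsto_0[OF assms] unfolding \<Phi>_def by (rule order_tendstoD) (use d in simp)
  then obtain R where R: "\<And>v. R \<le> norm v \<Longrightarrow> \<Phi> v < ennreal d" unfolding eventually_at_infinity by blast
  have "\<forall>\<^sub>F w in at_infinity. S * exp (- (c / 16) * (norm (w :: complex^'n))\<^sup>2) < d"
  proof -
    have "filterlim (\<lambda>w::complex^'n. (norm w)\<^sup>2) at_top at_infinity"
      by (intro filterlim_pow_at_top filterlim_norm_at_top) auto
    then have "filterlim (\<lambda>w::complex^'n. c / 16 * (norm w)\<^sup>2) at_top at_infinity"
      using c by (intro filterlim_tendsto_pos_mult_at_top[OF tendsto_const]) auto
    then have "filterlim (\<lambda>w::complex^'n. - (c / 16 * (norm w)\<^sup>2)) at_bot at_infinity"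
      by (simp add: filterlim_uminus_at_bot)
    then have "((\<lambda>w::complex^'n. exp (- (c / 16 * (norm w)\<^sup>2))) \<longlongrightarrow> 0) at_infinity"
      by (rule filterlim_compose[OF exp_at_bot])
    then have "((\<lambda>w::complex^'n. S * exp (- (c / 16 * (norm w)\<^sup>2))) \<longlongrightarrow> S * 0) at_infinity"
      by (intro tendsto_mult tendsto_const)
    then have "\<forall>\<^sub>F w in at_infinity. S * exp (- (c / 16 * (norm (w :: complex^'n))\<^sup>2)) < d"
      by (rule order_tendstoD) (use d in simp)
    then show ?thesis by simp
  qed
  moreover have "\<forall>\<^sub>F w in at_infinity. 2 * R \<le> norm (w :: complex^'n)"
    unfolding eventually_at_infinity by blast
  ultimately show "\<forall>\<^sub>F w in at_infinity. berezin \<alpha> q m u \<psi> w \<le> ennreal e"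
  proof eventually_elim
    case (elim w)
    have "berezin \<alpha> q m u \<psi> w \<le> ennreal C * (\<integral>\<^sup>+v. ennreal (gauss_weight \<alpha> q m (v - w)) * \<Phi> v \<partial>lborel)"
      unfolding \<Phi>_def by (rule C(2)) measurable
    also have "\<dots> \<le> ennreal C * (\<integral>\<^sup>+v. ennreal (2 * L * d) * ennreal (f (- w + v)) \<partial>lborel)"
    proof (intro mult_left_mono nn_integral_mono)
      fix v
      \<comment> \<open>Near \<open>w\<close> the value \<open>\<Phi> v\<close> is small, away from \<open>w\<close> the Gaussian is.\<close>
      define x where "x = v - w"
      have split: "ennreal (gauss_weight \<alpha> q m x) * \<Phi> v \<le> ennreal (L * f x * f x * t)" if "\<Phi> v \<le> ennreal t" "0 \<le> t" for t
      proof -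
        have "ennreal (gauss_weight \<alpha> q m x) * \<Phi> v \<le> ennreal (L * f x * f x) * ennreal t"
          using gw that by (intro mult_mono ennreal_leI) auto
        then show ?thesis using L f_pos[of x] that by (simp flip: ennreal_mult)
      qed
      have f1: "f x \<le> 1" using c by (simp add: f_def)
      have "ennreal (gauss_weight \<alpha> q m x) * \<Phi> v \<le> ennreal (2 * L * d * f x)"
      proof (cases "norm x \<le> norm w / 2")
        case True
        then have "R \<le> norm v"
          using elim(2) norm_triangle_ineq4[of v x] norm_triangle_sub[of w v] by (simp add: x_def norm_minus_commute)
        then have "ennreal (gauss_weight \<alpha> q m x) * \<Phi> v \<le> ennreal (L * f x * f x * d)"
          using R d by (intro split) (auto simp: less_imp_le)
        also have "L * f x * f x * d \<le> L * f x * 1 * d"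
          using L f_pos[of x] f1 d by (intro mult_right_mono mult_left_mono) auto
        also have "\<dots> \<le> 2 * L * d * f x" using L f_pos[of x] d by simp
        finally show ?thesis by (simp add: ennreal_leI)
      next
        case False
        then have "(norm w / 2)\<^sup>2 \<le> (norm x)\<^sup>2" by (intro power_mono) auto
        then have "c / 4 * (norm w / 2)\<^sup>2 \<le> c / 4 * (norm x)\<^sup>2" using c by (intro mult_left_mono) auto
        then have "f x \<le> exp (- (c / 16) * (norm w)\<^sup>2)"
          by (simp add: f_def power_divide)
        then have "f x * S \<le> exp (- (c / 16) * (norm w)\<^sup>2) * S" using S by (intro mult_right_mono)
        then have fS: "f x * S \<le> d" using elim(1) by (simp add: mult.commute)
        have "ennreal (gauss_weight \<alpha> q m x) * \<Phi> v \<le> ennreal (L * f x * f x * S)"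
          using S by (intro split)
        also have "L * f x * f x * S = L * f x * (f x * S)" by simp
        also have "\<dots> \<le> L * f x * d" using fS L f_pos[of x] by (intro mult_left_mono) auto
        also have "\<dots> \<le> 2 * L * d * f x" using L f_pos[of x] d by simp
        finally show ?thesis by (simp add: ennreal_leI)
      qed
      then show "ennreal (gauss_weight \<alpha> q m (v - w)) * \<Phi> v \<le> ennreal (2 * L * d) * ennreal (f (- w + v))"
        using L d f_pos[of x] by (simp add: x_def ennreal_mult[symmetric])
    qed simp
    also have "\<dots> = ennreal C * (ennreal (2 * L * d) * (\<integral>\<^sup>+v. ennreal (f (- w + v)) \<partial>lborel))"
      by (subst nn_integral_cmult) simp_all
    also have "(\<integral>\<^sup>+v. ennreal (f (- w + v)) \<partial>lborel) = ennreal I"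
      unfolding I(2)[symmetric] by (rule nn_integral_lborel_shift) measurable
    also have "ennreal C * (ennreal (2 * L * d) * ennreal I) = ennreal (C * (2 * L * d * I))"
      using C(1) L d I(1) by (simp flip: ennreal_mult)
    also have "C * (2 * L * d * I) = e * (I / (I + 1))"
      using C(1) L I(1) by (simp add: d_def)
    also have "\<dots> \<le> e * 1" using I(1) e by (intro mult_left_mono) auto
    finally show ?case by (simp add: ennreal_leI)
  qed
qed

section \<open>Boundedness and compactness of weighted composition operators\<close>

theorem theorem3p1:
  fixes \<alpha> p q :: real and m :: nat
  assumes "\<alpha> > 0" and "0 < p" and "p \<le> q"
  shows
    "(\<forall>(u :: complex ^ 'n \<Rightarrow> complex) \<psi>. entire u \<and> entire_map \<psi> \<longrightarrow>
        (bounded_fs \<alpha> p q m (wcomp u \<psi>) \<longleftrightarrow> in_Linf (berezin \<alpha> q m u \<psi>))) \<and>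
     (\<exists>C::real. C > 0 \<and>
        (\<forall>(u :: complex ^ 'n \<Rightarrow> complex) \<psi>.
           entire u \<and> entire_map \<psi> \<and> bounded_fs \<alpha> p q m (wcomp u \<psi>) \<longrightarrow>
           opnorm_fs \<alpha> p q m (wcomp u \<psi>)
             \<le> ennreal C * enn_powr (esssup lborel (berezin \<alpha> q m u \<psi>)) (1 / q) \<and>
           enn_powr (esssup lborel (berezin \<alpha> q m u \<psi>)) (1 / q)
             \<le> ennreal C * opnorm_fs \<alpha> p q m (wcomp u \<psi>))) \<and>
     (\<forall>(u :: complex ^ 'n \<Rightarrow> complex) \<psi>. entire u \<and> entire_map \<psi> \<longrightarrow>
        (compact_fs \<alpha> p q m (wcomp u \<psi>) \<longleftrightarrow> ((berezin \<alpha> q m u \<psi>) \<longlongrightarrow> 0) at_infinity))"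
proof -
  have q: "0 < q" using assms by simp
  obtain C1 where C1: "0 < C1" "\<And>u \<psi> f. entire u \<Longrightarrow> entire_map \<psi> \<Longrightarrow> entire (f :: complex^'n \<Rightarrow> complex) \<Longrightarrow>
      fs_norm \<alpha> q m (wcomp u \<psi> f) \<le>
      ennreal C1 * enn_powr (esssup lborel (berezin \<alpha> q m u \<psi>)) (1 / q) * fs_norm \<alpha> p m f"
    using fs_norm_wcomp_le[OF assms, where 'n='n and m=m] by blast
  obtain C2 where C2: "0 < C2" "\<And>u \<psi> w. entire u \<Longrightarrow> entire_map (\<psi> :: complex^'n \<Rightarrow> complex^'n) \<Longrightarrow>
      berezin \<alpha> q m u \<psi> w \<le> ennreal C2 * enn_powr (opnorm_fs \<alpha> p q m (wcomp u \<psi>)) q"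
    using berezin_le_opnorm[OF assms(1,2) q, where 'n='n and m=m] by blast
  have meas: "berezin \<alpha> q m u \<psi> \<in> borel_measurable lborel" if "entire u" "entire_map \<psi>"
    for u :: "complex^'n \<Rightarrow> complex" and \<psi>
    using berezin_measurable[OF entire_measurable entire_map_measurable, OF that, of \<alpha> q m] by simp
  have sup: "esssup lborel (berezin \<alpha> q m u \<psi>) \<le> ennreal C2 * enn_powr (opnorm_fs \<alpha> p q m (wcomp u \<psi>)) q"
    if "entire u" "entire_map \<psi>" for u :: "complex^'n \<Rightarrow> complex" and \<psi>
    using meas[OF that] C2(2)[OF that] by (intro esssup_I) auto
  have bounded: "bounded_fs \<alpha> p q m (wcomp u \<psi>) \<longleftrightarrow> in_Linf (berezin \<alpha> q m u \<psi>)"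
    if "entire u" "entire_map \<psi>" for u :: "complex^'n \<Rightarrow> complex" and \<psi>
  proof
    assume "bounded_fs \<alpha> p q m (wcomp u \<psi>)"
    then have "enn_powr (opnorm_fs \<alpha> p q m (wcomp u \<psi>)) q < \<infinity>"
      unfolding enn_powr_finite_iff by (rule opnorm_fs_finite)
    then have "ennreal C2 * enn_powr (opnorm_fs \<alpha> p q m (wcomp u \<psi>)) q < \<infinity>"
      by (simp add: ennreal_mult_less_top)
    with sup[OF that] have "esssup lborel (berezin \<alpha> q m u \<psi>) < \<infinity>" by (rule le_less_trans)
    then show "in_Linf (berezin \<alpha> q m u \<psi>)" using meas[OF that] by (simp add: in_Linf_def)
  next
    assume "in_Linf (berezin \<alpha> q m u \<psi>)"
    then show "bounded_fs \<alpha> p q m (wcomp u \<psi>)" by (rule bounded_fs_if_in_Linf[OF assms that])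
  qed
  define C where "C = max C1 (C2 powr (1 / q))"
  have norm1: "opnorm_fs \<alpha> p q m (wcomp u \<psi>)
      \<le> ennreal C * enn_powr (esssup lborel (berezin \<alpha> q m u \<psi>)) (1 / q)"
    if "entire u" "entire_map \<psi>" for u :: "complex^'n \<Rightarrow> complex" and \<psi>
  proof (rule opnorm_fs_le)
    fix f :: "complex^'n \<Rightarrow> complex" assume "f \<in> fock_sobolev \<alpha> p m"
    then have "entire f" by (rule fs_norm_finite(1)[OF assms(1,2)])
    then have "fs_norm \<alpha> q m (wcomp u \<psi> f) \<le>
        ennreal C1 * enn_powr (esssup lborel (berezin \<alpha> q m u \<psi>)) (1 / q) * fs_norm \<alpha> p m f"
      by (rule C1(2)[OF that])
    also have "\<dots> \<le> ennreal C * enn_powr (esssup lborel (berezin \<alpha> q m u \<psi>)) (1 / q) * fs_norm \<alpha> p m f"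
      by (intro mult_right_mono ennreal_leI) (auto simp: C_def)
    finally show "fs_norm \<alpha> q m (wcomp u \<psi> f) \<le>
        ennreal C * enn_powr (esssup lborel (berezin \<alpha> q m u \<psi>)) (1 / q) * fs_norm \<alpha> p m f" .
  qed
  have norm2: "enn_powr (esssup lborel (berezin \<alpha> q m u \<psi>)) (1 / q) \<le> ennreal C * opnorm_fs \<alpha> p q m (wcomp u \<psi>)"
    if "entire u" "entire_map \<psi>" for u :: "complex^'n \<Rightarrow> complex" and \<psi>
  proof -
    have "enn_powr (esssup lborel (berezin \<alpha> q m u \<psi>)) (1 / q)
        \<le> enn_powr (ennreal C2 * enn_powr (opnorm_fs \<alpha> p q m (wcomp u \<psi>)) q) (1 / q)"
      using sup[OF that] q by (intro enn_powr_mono) auto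
    also have "\<dots> = ennreal (C2 powr (1 / q)) * opnorm_fs \<alpha> p q m (wcomp u \<psi>)"
      using C2(1) q by (simp add: enn_powr_mult)
    also have "\<dots> \<le> ennreal C * opnorm_fs \<alpha> p q m (wcomp u \<psi>)"
      by (intro mult_right_mono ennreal_leI) (auto simp: C_def)
    finally show ?thesis .
  qed
  have compact: "compact_fs \<alpha> p q m (wcomp u \<psi>) \<longleftrightarrow> ((berezin \<alpha> q m u \<psi>) \<longlongrightarrow> 0) at_infinity"
    if "entire u" "entire_map \<psi>" for u :: "complex^'n \<Rightarrow> complex" and \<psi>
    using tendsto_0_if_compact_fs[OF assms(1,2) q that] compact_fs_if_tendsto_0[OF assms that] by blast
  have "0 < C" using C1(1) by (simp add: C_def less_max_iff_disj)
  then show ?thesis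
    using bounded norm1 norm2 compact by blast
qed

end
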